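(* Let $k\in\mathbb{N}_0$ and $\lambda^{(0)}\in\sigma_{\mathrm{odd}}(\mathcal{D})$. If $2^k\lambda^{(0)}$ is a Courant-sharp eigenvalue of the Neumann Laplacian on $\mathcal{D}$, then both of the following hold: (1) the eigenvalue $2^k\lambda^{(0)}$ is a simple eigenvalue in $\sigma(\mathcal{D}_i^{(k)})$ for all $i\in\{1,\dots,M(k)\}$; (2) the eigenvalue $2^k\lambda^{(0)}$ is a simple eigenvalue of the Neumann Laplacian on $\mathcal{D}$.
   Context: $\mathbb{N}_0=\mathbb{N}\cup\{0\}$. $\mathcal{D}=\{(x,y)\in[0,\pi]^2 : y\le x\}$ is the isosceles right triangle, considered with the Neumann Laplacian $-\Delta$ on its interior $\mathcal{D}^\circ$. Its eigenvalues (with multiplicity) are $\lambda_{m,n}=m^2+n^2$, $(m,n)\in\mathcal{Q}=\{(m,n)\in\mathbb{N}_0\times\mathbb{N}_0 : m\ge n\}$, with basis eigenfunctions $\varphi_{m,n}(x,y)=\cos(mx)\cos(ny)+\cos(my)\cos(nx)$. Let $\sigma_{\mathrm{odd}}(\mathcal{D})=\{\lambda_{m,n} : (m,n)\in\mathcal{Q},\ m\not\equiv n\pmod 2\}$. Courant-sharpness: write the Neumann eigenvalues with multiplicity as $0=\lambda_1<\lambda_2\le\cdots$ and $N(\lambda)=|\{j:\lambda_j<\lambda\}|+1$ for an eigenvalue $\lambda$. An eigenvalue $\lambda$ is Courant-sharp if it has an eigenfunction $\varphi$ for which the number $\nu(\varphi)$ of connected components of $\mathcal{D}^\circ\setminus\varphi^{-1}(0)$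 equals $N(\lambda)$. $k$-frame: let $\mathrm{L}=\{(x,y)\in\mathcal{D} : x+y=\pi\}$, $R(x,y)=(\pi-y,\pi-x)$, $\frac12\mathcal{D}=\{(x,y)\in\mathcal{D} : (x+y,x-y)\in[0,\pi]^2\}$, and $F:\frac12\mathcal{D}\to\mathcal{D}$, $F(x,y)=(x+y,x-y)$. For $A\subseteq\mathcal{D}$ put $$U(A)=\{(x,y)\in\tfrac12\mathcal{D} : F(x,y)\in A\}\cup\{(x,y)\in\mathcal{D}\setminus\tfrac12\mathcal{D} : F(R(x,y))\in A\}.$$ The $k$-frame is $S^{(0)}=\mathrm{L}$, $S^{(k)}=U^k(\mathrm{L})$ for $k\ge1$. The $k$-frame partition is $\mathcal{D}^\circ\setminus S^{(k)}=\bigsqcup_{i=1}^{M(k)}\mathcal{D}_i^{(k)}$, where the $\mathcal{D}_i^{(k)}$ are the subdomains (connected components) and $M(k)$ is their number. $\sigma(\mathcal{D}_i^{(k)})$ denotes the spectrum of the mixed problem on $\mathcal{D}_i^{(k)}$: $-\Delta\varphi=\lambda\varphi$, $\varphi=0$ on $S^{(k)}\cap\partial\mathcal{D}_i^{(k)}$, $\partial\varphi/\partial\vec n=0$ on $\partial\mathcal{D}\cap\partial\mathcal{D}_i^{(k)}$. *)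

theory Defs
  imports "HOL-Analysis.Analysis" "HOL-Library.Function_Algebras"
begin

text \<open>
  The Laplacian on a bounded open set \<open>\<Omega>\<close> of the plane (below always a polygon), with the Dirichlet
  condition on \<open>\<Gamma> \<subseteq> frontier \<Omega>\<close> and the Neumann condition on the rest of the boundary, in its
  variational form.  The form domain is the closure, in the norm of \<open>H\<^sup>1(\<Omega>)\<close>, of the functions that
  are \<open>C\<^sup>1\<close> up to the boundary and vanish on \<open>\<Gamma>\<close>.  The Neumann condition is the natural one: it is
  imposed by allowing test functions that are free on the rest of the boundary.  \<open>\<Gamma> = {}\<close> gives the
  Neumann Laplacian.
\<close>

definition has_C1_gradient :: "(real \<times> real \<Rightarrow> real) \<Rightarrow> (real \<times> real \<Rightarrow> real \<times> real) \<Rightarrow> bool" where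
  "has_C1_gradient v G \<longleftrightarrow> (\<forall>z. GDERIV v z :> G z) \<and> continuous_on UNIV G"

definition core_function ::
    "(real \<times> real) set \<Rightarrow> (real \<times> real \<Rightarrow> real) \<Rightarrow> (real \<times> real \<Rightarrow> real \<times> real) \<Rightarrow> bool" where
  "core_function \<Gamma> v G \<longleftrightarrow> has_C1_gradient v G \<and> (\<forall>z\<in>\<Gamma>. v z = 0)"

text \<open>
  \<open>u\<close> lies in the form domain and \<open>g\<close> is its weak gradient.  Convergence of the extended
  nonnegative integrals below to \<open>0\<close> is convergence in \<open>H\<^sup>1(\<Omega>)\<close>; as \<open>\<Omega>\<close> is bounded, it also forces
  \<open>u\<close> and \<open>g\<close> to be square integrable over \<open>\<Omega>\<close>.
\<close>

definition in_form_domain ::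
    "(real \<times> real) set \<Rightarrow> (real \<times> real) set \<Rightarrow> (real \<times> real \<Rightarrow> real) \<Rightarrow> (real \<times> real \<Rightarrow> real \<times> real) \<Rightarrow> bool"
  where
  "in_form_domain \<Omega> \<Gamma> u g \<longleftrightarrow>
     set_borel_measurable lborel \<Omega> u \<and> set_borel_measurable lborel \<Omega> g \<and>
     (\<exists>v G. (\<forall>n. core_function \<Gamma> (v n) (G n)) \<and>
        (\<lambda>n::nat. \<integral>\<^sup>+z\<in>\<Omega>. ennreal ((u z - v n z)\<^sup>2 + (norm (g z - G n z))\<^sup>2) \<partial>lborel) \<longlonglongrightarrow> 0)"

definition weak_eigenfunction ::
    "(real \<times> real) set \<Rightarrow> (real \<times> real) set \<Rightarrow> real \<Rightarrow> (real \<times> real \<Rightarrow> real) \<Rightarrow> bool" where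
  "weak_eigenfunction \<Omega> \<Gamma> \<mu> u \<longleftrightarrow>
     (\<exists>g. in_form_domain \<Omega> \<Gamma> u g \<and>
       (\<forall>v G. core_function \<Gamma> v G \<longrightarrow>
          (LINT z:\<Omega>|lborel. g z \<bullet> G z) = \<mu> * (LINT z:\<Omega>|lborel. u z * v z)))"

text \<open>
  By interior regularity every eigenfunction, a class of functions modulo null sets, has exactly one
  representative that is continuous on \<open>\<Omega>\<close>; this is the one whose nodal set is considered.  The value
  \<open>0\<close> off \<open>\<Omega>\<close> is a convention that makes functions on \<open>\<Omega>\<close> into functions on the plane.
\<close>

definition eigenspace ::
    "(real \<times> real) set \<Rightarrow> (real \<times> real) set \<Rightarrow> real \<Rightarrow> (real \<times> real \<Rightarrow> real) set" where
  "eigenspace \<Omega> \<Gamma> \<mu> =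
     {u. continuous_on \<Omega> u \<and> (\<forall>z. z \<notin> \<Omega> \<longrightarrow> u z = 0) \<and> weak_eigenfunction \<Omega> \<Gamma> \<mu> u}"

global_interpretation fun_space: vector_space "\<lambda>(c::real) (f :: 'a \<Rightarrow> real) x. c * f x"
  by unfold_locales (auto simp: fun_eq_iff algebra_simps)

text \<open>
  The dimension function is \<open>0\<close> on infinite-dimensional spaces; the form domains of the polygons
  considered here embed compactly into \<open>L\<^sup>2\<close>, so that all eigenspaces are finite-dimensional.
\<close>

definition eigenvalue_multiplicity :: "(real \<times> real) set \<Rightarrow> (real \<times> real) set \<Rightarrow> real \<Rightarrow> nat" where
  "eigenvalue_multiplicity \<Omega> \<Gamma> \<mu> = fun_space.dim (eigenspace \<Omega> \<Gamma> \<mu>)"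

definition simple_eigenvalue :: "(real \<times> real) set \<Rightarrow> (real \<times> real) set \<Rightarrow> real \<Rightarrow> bool" where
  "simple_eigenvalue \<Omega> \<Gamma> \<mu> \<longleftrightarrow> eigenvalue_multiplicity \<Omega> \<Gamma> \<mu> = 1"

text \<open>\<open>lam 0 \<le> lam 1 \<le> \<dots>\<close> lists the eigenvalues, each one as often as its multiplicity.\<close>

definition eigenvalue_sequence ::
    "(real \<times> real) set \<Rightarrow> (real \<times> real) set \<Rightarrow> (nat \<Rightarrow> real) \<Rightarrow> bool" where
  "eigenvalue_sequence \<Omega> \<Gamma> lam \<longleftrightarrow>
     mono lam \<and>
     (\<forall>\<mu>. finite {j. lam j = \<mu>} \<and> card {j. lam j = \<mu>} = eigenvalue_multiplicity \<Omega> \<Gamma> \<mu>)"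

definition nodal_count :: "(real \<times> real) set \<Rightarrow> (real \<times> real \<Rightarrow> real) \<Rightarrow> nat" where
  "nodal_count \<Omega> u = card (components (\<Omega> - {z. u z = 0}))"

text \<open>
  The sequence in the next definition exists and is unique.  The number on the right being positive,
  the equation implies that there are finitely many nodal domains.
\<close>

definition neumann_courant_sharp :: "(real \<times> real) set \<Rightarrow> real \<Rightarrow> bool" where
  "neumann_courant_sharp \<Omega> \<mu> \<longleftrightarrow>
     (\<exists>lam u. eigenvalue_sequence \<Omega> {} lam \<and> u \<in> eigenspace \<Omega> {} \<mu> \<and> u \<noteq> 0 \<and>
        nodal_count \<Omega> u = card {j. lam j < \<mu>} + 1)"

definition iso_triangle :: "(real \<times> real) set" where
  "iso_triangle = {(x, y). x \<in> {0..pi} \<and> y \<in> {0..pi} \<and> y \<le> x}"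

definition sigma_odd :: "real set" where
  "sigma_odd = {real (m\<^sup>2 + n\<^sup>2) | m n :: nat. n \<le> m \<and> m mod 2 \<noteq> n mod 2}"

definition segment_L :: "(real \<times> real) set" where
  "segment_L = {(x, y). (x, y) \<in> iso_triangle \<and> x + y = pi}"

definition refl_L :: "real \<times> real \<Rightarrow> real \<times> real" where
  "refl_L = (\<lambda>(x, y). (pi - y, pi - x))"

definition half_triangle :: "(real \<times> real) set" where
  "half_triangle = {(x, y). (x, y) \<in> iso_triangle \<and> x + y \<in> {0..pi} \<and> x - y \<in> {0..pi}}"

definition fold_map :: "real \<times> real \<Rightarrow> real \<times> real" where
  "fold_map = (\<lambda>(x, y). (x + y, x - y))"

definition unfold_set :: "(real \<times> real) set \<Rightarrow> (real \<times> real) set" where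
  "unfold_set A =
     {z \<in> half_triangle. fold_map z \<in> A} \<union>
     {z \<in> iso_triangle - half_triangle. fold_map (refl_L z) \<in> A}"

definition frame :: "nat \<Rightarrow> (real \<times> real) set" where
  "frame k = (unfold_set ^^ k) segment_L"

definition frame_subdomains :: "nat \<Rightarrow> (real \<times> real) set set" where
  "frame_subdomains k = components (interior iso_triangle - frame k)"

end

theory Submission
  imports Defs
begin

text \<open>
  Let \<open>u\<close> be an eigenfunction at \<open>\<mu> = 2\<^sup>k \<lambda>\<close> with \<open>N\<close> nodal domains, where \<open>N - 1\<close> eigenvalues lie below \<open>\<mu>\<close>.
  Folding \<open>k\<close> times turns the modes at \<open>\<mu>\<close> into modes at \<open>\<lambda>\<close>, which are odd across \<open>L\<close>; hence every Neumann
  eigenfunction at \<open>\<mu>\<close> vanishes on the \<open>k\<close>-frame and each nodal domain lies in one subdomain.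

  Let \<open>e\<close> be an eigenfunction at \<open>\<mu>\<close> of a subdomain \<open>D\<close>.  On the span of \<open>e\<close> and of the \<open>N\<close> pieces of \<open>u\<close>, all extended
  by \<open>0\<close>, the Dirichlet form equals \<open>\<mu>\<close> times the square of the \<open>L\<^sup>2\<close> norm.  The \<open>N + 1\<close> coefficients can be chosen,
  not all zero, so that the combination is orthogonal to the \<open>N - 1\<close> lower modes and has no component on some
  nodal domain outside \<open>D\<close>.  By the variational principle it is a Neumann eigenfunction, and it vanishes on an open set,
  so it is \<open>0\<close>.  Therefore \<open>e\<close> is a multiple of \<open>u\<close> on a nodal domain in \<open>D\<close>, hence on \<open>D\<close>, by unique continuation.
  So \<open>D\<close> has a one-dimensional eigenspace, and restricting to \<open>D\<close> shows the same for the triangle.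
\<close>

section \<open>Square integrable maps and the form domain\<close>

text \<open>All mixed terms of the form vanish for one reason: the nodal set of \<open>u\<close>
  contains the frame, so a piece of \<open>u\<close>, restricted to \<open>D\<close>, is an
  admissible test function in the equation of \<open>e\<close>. The obstacle is that
  \<open>e\<close> and the pieces are known only as elements of form domains, on sets whose boundary
  is described merely through zero sets. Three tools therefore avoid regularity of functions and of
  boundaries. Extension by zero uses convexity of the triangle, which forces a boundary point
  between a component and its neighbours into the removed closed set, together with a truncation
  near the zeros. Unique continuation comes from moments: an eigenfunction that vanishes near a
  point is orthogonal, with a positive radial weight, to every polynomial on a ball about that
  point. The variational principle rests on explicit cosine modes, complete by Stone-Weierstrass;
  they also turn the count of lower eigenvalues into a count of index pairs. Oddness of \<lambda>
  enters once: it makes every mode at \<mu>, whatever its indices, vanish on the frame.\<close>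

definition L2 :: "'a measure \<Rightarrow> ('a \<Rightarrow> 'b::euclidean_space) \<Rightarrow> bool" where
  "L2 M f \<longleftrightarrow> f \<in> borel_measurable M \<and> integrable M (\<lambda>x. (norm (f x))\<^sup>2)"

lemma L2_measurable [measurable_dest]: "L2 M f \<Longrightarrow> f \<in> borel_measurable M"
  by (simp add: L2_def)

lemma L2_bound:
  fixes f :: "'a \<Rightarrow> 'b::euclidean_space"
  assumes [measurable]: "f \<in> borel_measurable M" and "integrable M h" and "\<And>x. x \<in> space M \<Longrightarrow> (norm (f x))\<^sup>2 \<le> h x"
  shows "L2 M f"
  unfolding L2_def
proof
  show "integrable M (\<lambda>x. (norm (f x))\<^sup>2)"
    by (rule Bochner_Integration.integrable_bound[OF assms(2)]) (use assms(3) in \<open>auto simp: abs_le_iff intro!: AE_I2 order_trans[OF assms(3)]\<close>)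
qed fact

lemma L2_inner_integrable:
  assumes "L2 M f" "L2 M g"
  shows "integrable M (\<lambda>x. f x \<bullet> g x)"
proof -
  note [measurable] = L2_measurable[OF assms(1)] L2_measurable[OF assms(2)]
  have "integrable M (\<lambda>x. (norm (f x))\<^sup>2 + (norm (g x))\<^sup>2)"
    using assms by (simp add: L2_def)
  then show ?thesis
  proof (rule Bochner_Integration.integrable_bound)
    show "AE x in M. norm (f x \<bullet> g x) \<le> norm ((norm (f x))\<^sup>2 + (norm (g x))\<^sup>2)"
    proof (rule AE_I2)
      fix x
      have "\<bar>f x \<bullet> g x\<bar> \<le> norm (f x) * norm (g x)" by (rule Cauchy_Schwarz_ineq2)
      also have "\<dots> \<le> (norm (f x))\<^sup>2 + (norm (g x))\<^sup>2"
        using sum_squares_bound[of "norm (f x)" "norm (g x)"] mult_nonneg_nonneg[OF norm_ge_zero[of "f x"] norm_ge_zero[of "g x"]]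
        by linarith
      finally show "norm (f x \<bullet> g x) \<le> norm ((norm (f x))\<^sup>2 + (norm (g x))\<^sup>2)" by simp
    qed
  qed measurable
qed

lemma norm_add_power2_le:
  fixes a b :: "'a::real_inner"
  shows "(norm (a + b))\<^sup>2 \<le> 2 * (norm a)\<^sup>2 + 2 * (norm b)\<^sup>2"
proof -
  have "0 \<le> (norm (a - b))\<^sup>2" by simp
  then show ?thesis
    by (simp add: power2_norm_eq_inner inner_add inner_diff inner_commute)
qed

lemma L2_add:
  fixes f g :: "'a \<Rightarrow> 'b::euclidean_space"
  assumes "L2 M f" "L2 M g" shows "L2 M (\<lambda>x. f x + g x)"
proof -
  note [measurable] = L2_measurable[OF assms(1)] L2_measurable[OF assms(2)]
  have "integrable M (\<lambda>x. 2 * (norm (f x))\<^sup>2 + 2 * (norm (g x))\<^sup>2)"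
    using assms by (simp add: L2_def)
  moreover have "(norm (f x + g x))\<^sup>2 \<le> 2 * (norm (f x))\<^sup>2 + 2 * (norm (g x))\<^sup>2" for x
    by (rule norm_add_power2_le)
  ultimately show ?thesis by (intro L2_bound) auto
qed

lemma L2_scaleR: 
  fixes f :: "'a \<Rightarrow> 'b::euclidean_space"
  assumes "L2 M f" shows "L2 M (\<lambda>x. c *\<^sub>R f x)"
  using assms by (auto simp: L2_def power_mult_distrib)

lemma L2_zero: "L2 M (\<lambda>x. 0)"
  by (simp add: L2_def)

lemma L2_diff:
  fixes f g :: "'a \<Rightarrow> 'b::euclidean_space"
  assumes "L2 M f" "L2 M g" shows "L2 M (\<lambda>x. f x - g x)"
  using L2_add[OF assms(1) L2_scaleR[OF assms(2), of "-1"]] by simp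

lemma L2_sum:
  fixes f :: "'i \<Rightarrow> 'a \<Rightarrow> 'b::euclidean_space"
  assumes "\<And>i. i \<in> I \<Longrightarrow> L2 M (f i)" shows "L2 M (\<lambda>x. \<Sum>i\<in>I. f i x)"
  using assms by (induction I rule: infinite_finite_induct) (auto intro: L2_add L2_zero)

lemma L2_bounded_linear:
  assumes "bounded_linear T" "L2 M f" shows "L2 M (\<lambda>x. T (f x))"
proof -
  obtain K where K: "\<And>x. norm (T x) \<le> norm x * K" using assms(1) by (metis bounded_linear.bounded)
  have [measurable]: "T \<in> borel_measurable borel"
    using assms(1) by (intro borel_measurable_continuous_onI linear_continuous_on)
  note [measurable] = L2_measurable[OF assms(2)]
  have "integrable M (\<lambda>x. K\<^sup>2 * (norm (f x))\<^sup>2)" using assms(2) by (simp add: L2_def)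
  moreover have "(norm (T (f x)))\<^sup>2 \<le> K\<^sup>2 * (norm (f x))\<^sup>2" for x
    using power_mono[OF K[of "f x"], of 2] by (simp add: power_mult_distrib mult.commute)
  ultimately show ?thesis by (intro L2_bound[where h = "\<lambda>x. K\<^sup>2 * (norm (f x))\<^sup>2"]) auto
qed

lemma L2_fst: "L2 M f \<Longrightarrow> L2 M (\<lambda>x. fst (f x))"
  by (rule L2_bounded_linear[OF bounded_linear_fst])

lemma L2_snd: "L2 M f \<Longrightarrow> L2 M (\<lambda>x. snd (f x))"
  by (rule L2_bounded_linear[OF bounded_linear_snd])

lemma L2_norm2_integrable: "L2 M f \<Longrightarrow> integrable M (\<lambda>x. (norm (f x))\<^sup>2)"
  by (simp add: L2_def)

lemma norm_comb_power2:
  fixes a b :: "'a::real_inner"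
  shows "(norm (s *\<^sub>R a + t *\<^sub>R b))\<^sup>2 = s\<^sup>2 * (norm a)\<^sup>2 + 2 * s * t * (a \<bullet> b) + t\<^sup>2 * (norm b)\<^sup>2"
  unfolding power2_norm_eq_inner inner_add_left inner_add_right inner_scaleR_left inner_scaleR_right inner_commute[of b a]
  by (simp add: power2_eq_square algebra_simps)

text \<open>The integral of the squared norm of s f + t g is a nonnegative quadratic form in s and
  t. For \<open>?c > 0\<close> the choice s = \<open>?c\<close>, t = - \<open>?b\<close> gives the
  inequality after division by \<open>?c\<close>; for \<open>?c = 0\<close> the form is affine in t
  at s = 1, which forces \<open>?b = 0\<close>.\<close>

lemma L2_Cauchy_Schwarz:
  assumes "L2 M f" "L2 M g"
  shows "(\<integral>x. f x \<bullet> g x \<partial>M)\<^sup>2 \<le> (\<integral>x. (norm (f x))\<^sup>2 \<partial>M) * (\<integral>x. (norm (g x))\<^sup>2 \<partial>M)"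
proof -
  let ?a = "\<integral>x. (norm (f x))\<^sup>2 \<partial>M" and ?b = "\<integral>x. f x \<bullet> g x \<partial>M" and ?c = "\<integral>x. (norm (g x))\<^sup>2 \<partial>M"
  have q: "0 \<le> s\<^sup>2 * ?a + 2 * s * t * ?b + t\<^sup>2 * ?c" for s t
  proof -
    have "0 \<le> (\<integral>x. (norm (s *\<^sub>R f x + t *\<^sub>R g x))\<^sup>2 \<partial>M)" by simp
    also have "\<dots> = (\<integral>x. s\<^sup>2 * (norm (f x))\<^sup>2 + 2 * s * t * (f x \<bullet> g x) + t\<^sup>2 * (norm (g x))\<^sup>2 \<partial>M)"
      by (intro Bochner_Integration.integral_cong) 
         (simp_all add: norm_comb_power2)
    also have "\<dots> = s\<^sup>2 * ?a + 2 * s * t * ?b + t\<^sup>2 * ?c"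
      using assms L2_inner_integrable[OF assms] by (simp add: L2_def)
    finally show ?thesis .
  qed
  have c0: "?c \<ge> 0" "?a \<ge> 0" by simp_all
  show ?thesis
  proof (cases "?c = 0")
    case True
    have "?b = 0"
    proof (rule ccontr)
      assume "?b \<noteq> 0"
      have "0 \<le> ?a + 2 * t * ?b" for t using q[of 1 t] True by simp
      \<comment> \<open>This value of t makes the right-hand side equal to -1.\<close>
      from this[of "- (?a + 1) / (2 * ?b)"] show False using \<open>?b \<noteq> 0\<close> by (simp add: field_simps)
    qed
    then show ?thesis using True by simp
  next
    case False
    then have cp: "?c > 0" using c0 by linarith
    have "0 \<le> ?c\<^sup>2 * ?a + 2 * ?c * (- ?b) * ?b + ?b\<^sup>2 * ?c" using q[of ?c "- ?b"] by simp
    also have "\<dots> = ?c * (?a * ?c - ?b\<^sup>2)" by (simp add: power2_eq_square algebra_simps)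
    finally show ?thesis using cp by (simp add: zero_le_mult_iff)
  qed
qed

text \<open>Stands in for the triangle inequality without taking roots of integrals. Its factors 2
  are the reason why two approximations to within e / 4 are requested below to reach e.\<close>

lemma L2_triangle2:
  fixes f g h :: "'a \<Rightarrow> 'b::euclidean_space"
  assumes "L2 M f" "L2 M g" "L2 M h"
  shows "(\<integral>x. (norm (f x - h x))\<^sup>2 \<partial>M) \<le> 2 * (\<integral>x. (norm (f x - g x))\<^sup>2 \<partial>M) + 2 * (\<integral>x. (norm (g x - h x))\<^sup>2 \<partial>M)"
proof -
  have i: "integrable M (\<lambda>x. (norm (f x - g x))\<^sup>2)" "integrable M (\<lambda>x. (norm (g x - h x))\<^sup>2)" 
      "integrable M (\<lambda>x. (norm (f x - h x))\<^sup>2)"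
    by (intro L2_norm2_integrable L2_diff assms)+
  have "(\<integral>x. (norm (f x - h x))\<^sup>2 \<partial>M) \<le> (\<integral>x. 2 * (norm (f x - g x))\<^sup>2 + 2 * (norm (g x - h x))\<^sup>2 \<partial>M)"
  proof (rule integral_mono)
    fix x
    from norm_add_power2_le[of "f x - g x" "g x - h x"]
    show "(norm (f x - h x))\<^sup>2 \<le> 2 * (norm (f x - g x))\<^sup>2 + 2 * (norm (g x - h x))\<^sup>2" by simp
  qed (use i in simp_all)
  also have "\<dots> = 2 * (\<integral>x. (norm (f x - g x))\<^sup>2 \<partial>M) + 2 * (\<integral>x. (norm (g x - h x))\<^sup>2 \<partial>M)"
    using i by simp
  finally show ?thesis .
qed

text \<open>The form in which density is applied: a continuous functional that vanishes at
  approximants of \<open>g\<close> vanishes at \<open>g\<close>. This passes identities from C1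
  functions to the whole form domain.\<close>

lemma L2_inner_limit_zero:
  assumes "L2 M f" "L2 M g"
    and "\<And>e. e > 0 \<Longrightarrow> \<exists>h. L2 M h \<and> (\<integral>x. (norm (g x - h x))\<^sup>2 \<partial>M) < e \<and> (\<integral>x. f x \<bullet> h x \<partial>M) = 0"
  shows "(\<integral>x. f x \<bullet> g x \<partial>M) = 0"
proof (rule ccontr)
  let ?b = "\<integral>x. f x \<bullet> g x \<partial>M" and ?a = "\<integral>x. (norm (f x))\<^sup>2 \<partial>M"
  assume nz: "?b \<noteq> 0"
  \<comment> \<open>Small enough for \<open>?a * e\<close> to stay below the square of
    \<open>?b\<close>; the summand 1 covers \<open>?a = 0\<close>.\<close>
  define e where "e = ?b\<^sup>2 / (?a + 1)"
  have a0: "?a \<ge> 0" by simp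
  then have a1: "?a + 1 > 0" by linarith
  have e: "e > 0" unfolding e_def using nz a1 by (intro divide_pos_pos) auto
  obtain h where h: "L2 M h" "(\<integral>x. (norm (g x - h x))\<^sup>2 \<partial>M) < e" "(\<integral>x. f x \<bullet> h x \<partial>M) = 0"
    using assms(3)[OF e] by blast
  have "?b = (\<integral>x. f x \<bullet> (g x - h x) \<partial>M)"
    using h L2_inner_integrable[OF assms(1,2)] L2_inner_integrable[OF assms(1) h(1)] by (simp add: inner_diff_right)
  then have "?b\<^sup>2 \<le> ?a * (\<integral>x. (norm (g x - h x))\<^sup>2 \<partial>M)"
    using L2_Cauchy_Schwarz[OF assms(1) L2_diff[OF assms(2) h(1)]] by simp
  also have "\<dots> \<le> ?a * e" using a0 h(2) by (intro mult_left_mono) auto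
  also have "\<dots> < ?b\<^sup>2"
  proof -
    have "?a * e = ?b\<^sup>2 * (?a / (?a + 1))" by (simp add: e_def)
    also have "\<dots> < ?b\<^sup>2 * 1" using nz a1 by (intro mult_strict_left_mono) (auto simp: divide_less_eq_1_pos)
    finally show ?thesis by simp
  qed
  finally show False by simp
qed

text \<open>
  A function \<open>u\<close> and its weak gradient \<open>g\<close> are treated as one square integrable map \<open>z \<mapsto> (u z, g z)\<close>,
  whose \<open>L\<^sup>2\<close> norm is the norm of \<open>H\<^sup>1\<close>.
\<close>

abbreviation leb_on :: "(real \<times> real) set \<Rightarrow> (real \<times> real) measure" where
  "leb_on \<Omega> \<equiv> restrict_space lborel \<Omega>"

lemma leb_on_measurable_continuous:
  fixes f :: "real \<times> real \<Rightarrow> 'b::euclidean_space"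
  assumes "continuous_on UNIV f" 
  shows "f \<in> borel_measurable (leb_on \<Omega>)"
  using borel_measurable_continuous_onI[OF assms] by (intro measurable_restrict_space1) simp

lemma finite_measure_leb_on:
  assumes "bounded \<Omega>" "\<Omega> \<in> sets borel"
  shows "finite_measure (leb_on \<Omega>)"
proof (rule finite_measureI)
  have "emeasure (leb_on \<Omega>) (space (leb_on \<Omega>)) = emeasure lborel \<Omega>"
    using assms by (simp add: space_restrict_space emeasure_restrict_space)
  also have "\<dots> < \<infinity>" using emeasure_bounded_finite[OF assms(1)] .
  finally show "emeasure (leb_on \<Omega>) (space (leb_on \<Omega>)) \<noteq> \<infinity>" by simp
qed

lemma L2_bounded_continuous:
  fixes f :: "real \<times> real \<Rightarrow> 'b::euclidean_space"
  assumes "bounded \<Omega>" "\<Omega> \<in> sets borel" "f \<in> borel_measurable (leb_on \<Omega>)" "\<And>z. z \<in> \<Omega> \<Longrightarrow> norm (f z) \<le> B"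
  shows "L2 (leb_on \<Omega>) f"
proof -
  interpret finite_measure "leb_on \<Omega>" by (rule finite_measure_leb_on) fact+
  show ?thesis
  proof (rule L2_bound[where h = "\<lambda>_. B\<^sup>2"])
    fix x assume "x \<in> space (leb_on \<Omega>)"
    then have "norm (f x) \<le> B" using assms by (auto simp: space_restrict_space)
    then show "(norm (f x))\<^sup>2 \<le> B\<^sup>2" by (intro power_mono) auto
  qed (use assms in auto)
qed

lemma L2_continuous:
  fixes f :: "real \<times> real \<Rightarrow> 'b::euclidean_space"
  assumes "bounded \<Omega>" "\<Omega> \<in> sets borel" "continuous_on UNIV f"
  shows "L2 (leb_on \<Omega>) f"
proof -
  have "compact (f ` closure \<Omega>)"
    using assms by (intro compact_continuous_image continuous_on_subset[OF assms(3)]) (auto simp: compact_closure)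
  then obtain B where "\<And>y. y \<in> f ` closure \<Omega> \<Longrightarrow> norm y \<le> B"
    using compact_imp_bounded bounded_iff by metis
  then show ?thesis
    using closure_subset[of \<Omega>] by (intro L2_bounded_continuous[OF assms(1,2) leb_on_measurable_continuous[OF assms(3)], of B]) auto
qed

lemma C1_continuous: "has_C1_gradient v G \<Longrightarrow> continuous_on UNIV v"
  unfolding has_C1_gradient_def gderiv_def
  by (meson continuous_at_imp_continuous_on has_derivative_continuous)

lemma C1_pair_continuous: "has_C1_gradient v G \<Longrightarrow> continuous_on UNIV (\<lambda>z. (v z, G z))"
  using C1_continuous[of v G] by (auto simp: has_C1_gradient_def intro!: continuous_intros)

lemma core_pair_L2:
  assumes "bounded \<Omega>" "\<Omega> \<in> sets borel" "core_function \<Gamma> v G"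
  shows "L2 (leb_on \<Omega>) (\<lambda>z. (v z, G z))"
  using assms by (intro L2_continuous C1_pair_continuous) (auto simp: core_function_def)

lemma set_borel_measurable_leb_on:
  fixes f :: "real \<times> real \<Rightarrow> 'b::euclidean_space"
  assumes "\<Omega> \<in> sets borel"
  shows "set_borel_measurable lborel \<Omega> f \<longleftrightarrow> f \<in> borel_measurable (leb_on \<Omega>)"
  using assms by (simp add: set_borel_measurable_def borel_measurable_restrict_space_iff)

lemma set_integral_leb_on:
  fixes f :: "real \<times> real \<Rightarrow> 'b::euclidean_space"
  assumes "\<Omega> \<in> sets borel"
  shows "(LINT z:\<Omega>|lborel. f z) = integral\<^sup>L (leb_on \<Omega>) f"
  using assms by (simp add: set_lebesgue_integral_def integral_restrict_space)

text \<open>Trades sequences and extended integrals for an epsilon statement about Bochner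
  integrals. Square integrability comes for free: some approximant is at finite distance, and it is
  square integrable because it is continuous on the compact closure of
  \<open>\<Omega>\<close>.\<close>

lemma in_form_domain_iff_L2:
  assumes B: "bounded \<Omega>" "\<Omega> \<in> sets borel"
  shows "in_form_domain \<Omega> \<Gamma> u g \<longleftrightarrow> L2 (leb_on \<Omega>) (\<lambda>z. (u z, g z)) \<and>
    (\<forall>e>0. \<exists>v G. core_function \<Gamma> v G \<and> (\<integral>z. (norm ((u z, g z) - (v z, G z)))\<^sup>2 \<partial>leb_on \<Omega>) < e)"
    (is "?L \<longleftrightarrow> ?R")
proof -
  let ?n = "\<lambda>v G. \<integral>\<^sup>+z\<in>\<Omega>. ennreal ((u z - v z)\<^sup>2 + (norm (g z - G z))\<^sup>2) \<partial>lborel"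
  have n1: "?n v G = (\<integral>\<^sup>+z. ennreal ((norm ((u z, g z) - (v z, G z)))\<^sup>2) \<partial>leb_on \<Omega>)" for v G
    using B by (simp add: nn_integral_restrict_space norm_Pair)
  have n2: "?n v G = ennreal (\<integral>z. (norm ((u z, g z) - (v z, G z)))\<^sup>2 \<partial>leb_on \<Omega>)"
    if "L2 (leb_on \<Omega>) (\<lambda>z. (u z, g z))" "core_function \<Gamma> v G" for v G
    unfolding n1 
    by (intro nn_integral_eq_integral L2_norm2_integrable L2_diff that core_pair_L2[OF B that(2)]) auto
  show ?thesis
  proof
    assume L: ?L
    then obtain v G where c: "\<And>n::nat. core_function \<Gamma> (v n) (G n)" and lim: "(\<lambda>n. ?n (v n) (G n)) \<longlonglongrightarrow> 0"
      by (auto simp: in_form_domain_def)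
    have [measurable]: "u \<in> borel_measurable (leb_on \<Omega>)" "g \<in> borel_measurable (leb_on \<Omega>)"
      using L B by (auto simp: in_form_domain_def set_borel_measurable_leb_on)
    have "\<forall>\<^sub>F n in sequentially. ?n (v n) (G n) < 1" using lim by (rule order_tendstoD) simp
    then obtain n where n: "?n (v n) (G n) < 1" by (auto simp: eventually_sequentially)
    note cl = core_pair_L2[OF B c[of n]]
    have mv[measurable]: "(\<lambda>z. (v n z, G n z)) \<in> borel_measurable (leb_on \<Omega>)" by (rule L2_measurable[OF cl])
    have "integrable (leb_on \<Omega>) (\<lambda>z. (norm ((u z, g z) - (v n z, G n z)))\<^sup>2)"
    proof (rule integrableI_bounded)
      show "(\<integral>\<^sup>+z. ennreal (norm ((norm ((u z, g z) - (v n z, G n z)))\<^sup>2)) \<partial>leb_on \<Omega>) < \<infinity>"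
        using n unfolding n1 by (simp add: order_less_trans[OF _ ennreal_one_less_top])
      show "(\<lambda>z. (norm ((u z, g z) - (v n z, G n z)))\<^sup>2) \<in> borel_measurable (leb_on \<Omega>)"
      proof -
        have "(\<lambda>z. (u z, g z) - (v n z, G n z)) \<in> borel_measurable (leb_on \<Omega>)"
          by (rule borel_measurable_diff[OF borel_measurable_Pair mv]) simp_all
        from borel_measurable_power[OF measurable_compose[OF this borel_measurable_norm]] show ?thesis .
      qed
    qed
    then have "L2 (leb_on \<Omega>) (\<lambda>z. (u z, g z) - (v n z, G n z))"
      unfolding L2_def by (intro conjI borel_measurable_diff mv borel_measurable_Pair) simp_all
    from L2_add[OF this cl] have UL: "L2 (leb_on \<Omega>) (\<lambda>z. (u z, g z))" by simp
    show ?R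
    proof (intro conjI UL allI impI)
      fix e :: real assume "e > 0"
      then have "\<forall>\<^sub>F n in sequentially. ?n (v n) (G n) < ennreal e" using lim by (intro order_tendstoD) auto
      then obtain n where n: "?n (v n) (G n) < ennreal e" by (auto simp: eventually_sequentially)
      then have "(\<integral>z. (norm ((u z, g z) - (v n z, G n z)))\<^sup>2 \<partial>leb_on \<Omega>) < e"
        unfolding n2[OF UL c] by (simp add: ennreal_less_iff)
      then show "\<exists>v G. core_function \<Gamma> v G \<and> (\<integral>z. (norm ((u z, g z) - (v z, G z)))\<^sup>2 \<partial>leb_on \<Omega>) < e"
        using c by blast
    qed
  next
    assume R: ?R
    then have UL: "L2 (leb_on \<Omega>) (\<lambda>z. (u z, g z))" by simp
    have "\<forall>n::nat. \<exists>V. core_function \<Gamma> (fst V) (snd V) \<and>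
        (\<integral>z. (norm ((u z, g z) - (fst V z, snd V z)))\<^sup>2 \<partial>leb_on \<Omega>) < 1 / Suc n" (is "\<forall>n. \<exists>V. ?P n V")
    proof
      fix n
      obtain v G where "core_function \<Gamma> v G" "(\<integral>z. (norm ((u z, g z) - (v z, G z)))\<^sup>2 \<partial>leb_on \<Omega>) < 1 / Suc n"
        using R by (meson of_nat_0_less_iff zero_less_Suc zero_less_divide_1_iff)
      then show "\<exists>V. ?P n V" by (intro exI[of _ "(v, G)"]) simp
    qed
    from choice[OF this] obtain V where V: "\<forall>n. ?P n (V n)" by blast
    define v where "v n = fst (V n)" for n
    define G where "G n = snd (V n)" for n
    have vG: "\<And>n. core_function \<Gamma> (v n) (G n)"
      "\<And>n. (\<integral>z. (norm ((u z, g z) - (v n z, G n z)))\<^sup>2 \<partial>leb_on \<Omega>) < 1 / Suc n"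
      using V unfolding v_def G_def by blast+
    have "(\<lambda>n. \<integral>z. (norm ((u z, g z) - (v n z, G n z)))\<^sup>2 \<partial>leb_on \<Omega>) \<longlonglongrightarrow> 0"
      using vG(2) by (intro LIMSEQ_norm_0) simp
    then have "(\<lambda>n. ?n (v n) (G n)) \<longlonglongrightarrow> 0"
      unfolding n2[OF UL vG(1)] by (rule tendsto_ennrealI[where x = 0, simplified])
    moreover have "u \<in> borel_measurable (leb_on \<Omega>)" "g \<in> borel_measurable (leb_on \<Omega>)"
      using L2_measurable[OF L2_fst[OF UL]] L2_measurable[OF L2_snd[OF UL]] by simp_all
    ultimately show ?L
      unfolding in_form_domain_def set_borel_measurable_leb_on[OF B(2)] using vG(1) by blast
  qed
qed

definition form_domain :: "(real \<times> real) set \<Rightarrow> (real \<times> real) set \<Rightarrow> (real \<times> real \<Rightarrow> real \<times> (real \<times> real)) \<Rightarrow> bool" where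
  "form_domain \<Omega> \<Gamma> P \<longleftrightarrow> L2 (leb_on \<Omega>) P \<and>
    (\<forall>e>0. \<exists>v G. core_function \<Gamma> v G \<and> (\<integral>z. (norm (P z - (v z, G z)))\<^sup>2 \<partial>leb_on \<Omega>) < e)"

lemma form_domain_iff:
  assumes "bounded \<Omega>" "\<Omega> \<in> sets borel"
  shows "in_form_domain \<Omega> \<Gamma> u g \<longleftrightarrow> form_domain \<Omega> \<Gamma> (\<lambda>z. (u z, g z))"
  by (simp add: form_domain_def in_form_domain_iff_L2[OF assms])

lemma form_domain_L2: "form_domain \<Omega> \<Gamma> P \<Longrightarrow> L2 (leb_on \<Omega>) P"
  by (simp add: form_domain_def)

lemma form_domain_core:
  assumes "bounded \<Omega>" "\<Omega> \<in> sets borel" "core_function \<Gamma> v G"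
  shows "form_domain \<Omega> \<Gamma> (\<lambda>z. (v z, G z))"
  unfolding form_domain_def
proof (intro conjI allI impI core_pair_L2[OF assms])
  fix e :: real assume "e > 0"
  then show "\<exists>w H. core_function \<Gamma> w H \<and> (\<integral>z. (norm ((v z, G z) - (w z, H z)))\<^sup>2 \<partial>leb_on \<Omega>) < e"
    using assms(3) by (intro exI[of _ v] exI[of _ G]) simp
qed

lemma form_domain_mono: "form_domain \<Omega> \<Gamma> P \<Longrightarrow> \<Gamma>' \<subseteq> \<Gamma> \<Longrightarrow> form_domain \<Omega> \<Gamma>' P"
  unfolding form_domain_def core_function_def by (meson subsetD)

lemma form_domain_closed:
  assumes B: "bounded \<Omega>" "\<Omega> \<in> sets borel" and P: "L2 (leb_on \<Omega>) P"
    and ap: "\<And>e. e > 0 \<Longrightarrow> \<exists>Q. form_domain \<Omega> \<Gamma> Q \<and> (\<integral>z. (norm (P z - Q z))\<^sup>2 \<partial>leb_on \<Omega>) < e"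
  shows "form_domain \<Omega> \<Gamma> P"
  unfolding form_domain_def
proof (intro conjI P allI impI)
  fix e :: real assume "e > 0"
  then have e4: "e / 4 > 0" by simp
  obtain Q where Q: "form_domain \<Omega> \<Gamma> Q" "(\<integral>z. (norm (P z - Q z))\<^sup>2 \<partial>leb_on \<Omega>) < e / 4" using ap[OF e4] by blast
  obtain v G where v: "core_function \<Gamma> v G" "(\<integral>z. (norm (Q z - (v z, G z)))\<^sup>2 \<partial>leb_on \<Omega>) < e / 4"
    using Q(1) e4 unfolding form_domain_def by blast
  have "(\<integral>z. (norm (P z - (v z, G z)))\<^sup>2 \<partial>leb_on \<Omega>) < e"
    using L2_triangle2[OF P form_domain_L2[OF Q(1)] core_pair_L2[OF B v(1)]] Q(2) v(2) by linarith
  then show "\<exists>v G. core_function \<Gamma> v G \<and> (\<integral>z. (norm (P z - (v z, G z)))\<^sup>2 \<partial>leb_on \<Omega>) < e"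
    using v(1) by blast
qed

section \<open>Calculus of functions with continuous gradient\<close>

lemma C1_const: "has_C1_gradient (\<lambda>z. c) (\<lambda>z. 0)"
  by (auto simp: has_C1_gradient_def gderiv_def)

lemma C1_add:
  assumes "has_C1_gradient v G" "has_C1_gradient w H"
  shows "has_C1_gradient (\<lambda>z. v z + w z) (\<lambda>z. G z + H z)"
  using assms unfolding has_C1_gradient_def by (auto intro!: GDERIV_add continuous_intros)

lemma C1_D: "has_C1_gradient v G \<Longrightarrow> (v has_derivative (\<lambda>h. h \<bullet> G z)) (at z)"
  unfolding has_C1_gradient_def gderiv_def by blast

lemma C1_mult:
  assumes "has_C1_gradient v G" "has_C1_gradient w H"
  shows "has_C1_gradient (\<lambda>z. v z * w z) (\<lambda>z. w z *\<^sub>R G z + v z *\<^sub>R H z)"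
proof -
  have "GDERIV (\<lambda>z. v z * w z) z :> w z *\<^sub>R G z + v z *\<^sub>R H z" for z
  proof -
    have "(v has_derivative (\<lambda>h. h \<bullet> G z)) (at z)" "(w has_derivative (\<lambda>h. h \<bullet> H z)) (at z)"
      using assms by (auto intro: C1_D)
    from has_derivative_mult[OF this] show ?thesis
      by (simp add: gderiv_def inner_add_right mult.commute add.commute)
  qed
  moreover have "continuous_on UNIV (\<lambda>z. w z *\<^sub>R G z + v z *\<^sub>R H z)"
    using C1_continuous[OF assms(1)] C1_continuous[OF assms(2)] assms
    by (auto simp: has_C1_gradient_def intro!: continuous_intros)
  ultimately show ?thesis by (simp add: has_C1_gradient_def)
qed

lemma C1_cmult:
  assumes "has_C1_gradient v G"
  shows "has_C1_gradient (\<lambda>z. c * v z) (\<lambda>z. c *\<^sub>R G z)"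
  using C1_mult[OF C1_const[of c] assms] by simp

lemma C1_compose:
  assumes "has_C1_gradient v G" and f: "\<And>s. (f has_real_derivative f' s) (at s)" "continuous_on UNIV f'"
  shows "has_C1_gradient (\<lambda>z. f (v z)) (\<lambda>z. f' (v z) *\<^sub>R G z)"
proof -
  have "GDERIV (\<lambda>z. f (v z)) z :> f' (v z) *\<^sub>R G z" for z
    using assms(1) by (intro GDERIV_DERIV_compose[OF _ f(1)]) (unfold has_C1_gradient_def, blast)
  moreover have "continuous_on UNIV (\<lambda>z. f' (v z) *\<^sub>R G z)"
    using C1_continuous[OF assms(1)] assms(1) continuous_on_compose2[OF f(2) C1_continuous[OF assms(1)]]
    by (auto simp: has_C1_gradient_def intro!: continuous_intros)
  ultimately show ?thesis by (simp add: has_C1_gradient_def)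
qed

lemma C1_sum:
  assumes "\<And>i. i \<in> I \<Longrightarrow> has_C1_gradient (v i) (G i)"
  shows "has_C1_gradient (\<lambda>z. \<Sum>i\<in>I. v i z) (\<lambda>z. \<Sum>i\<in>I. G i z)"
  using assms by (induction I rule: infinite_finite_induct) (auto intro: C1_const C1_add)

lemma core_add:
  "core_function \<Gamma> v G \<Longrightarrow> core_function \<Gamma> w H \<Longrightarrow> core_function \<Gamma> (\<lambda>z. v z + w z) (\<lambda>z. G z + H z)"
  by (auto simp: core_function_def intro: C1_add)

lemma core_cmult:
  "core_function \<Gamma> v G \<Longrightarrow> core_function \<Gamma> (\<lambda>z. c * v z) (\<lambda>z. c *\<^sub>R G z)"
  by (auto simp: core_function_def intro: C1_cmult)

lemma form_domain_add:
  assumes B: "bounded \<Omega>" "\<Omega> \<in> sets borel" and P: "form_domain \<Omega> \<Gamma> P" and Q: "form_domain \<Omega> \<Gamma> Q"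
  shows "form_domain \<Omega> \<Gamma> (\<lambda>z. P z + Q z)"
  unfolding form_domain_def
proof (intro conjI allI impI L2_add form_domain_L2[OF P] form_domain_L2[OF Q])
  fix e :: real assume "e > 0"
  then have e4: "e / 4 > 0" by simp
  obtain v G where v: "core_function \<Gamma> v G" "(\<integral>z. (norm (P z - (v z, G z)))\<^sup>2 \<partial>leb_on \<Omega>) < e / 4"
    using P e4 unfolding form_domain_def by blast
  obtain w H where w: "core_function \<Gamma> w H" "(\<integral>z. (norm (Q z - (w z, H z)))\<^sup>2 \<partial>leb_on \<Omega>) < e / 4"
    using Q e4 unfolding form_domain_def by blast
  note L = form_domain_L2[OF P] form_domain_L2[OF Q] core_pair_L2[OF B v(1)] core_pair_L2[OF B w(1)]
  have "(\<integral>z. (norm (P z + Q z - ((v z, G z) + (w z, H z))))\<^sup>2 \<partial>leb_on \<Omega>) < e"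
    using L2_triangle2[OF L2_add[OF L(1,2)] L2_add[OF L(3,2)] L2_add[OF L(3,4)]] v(2) w(2)
    unfolding add_diff_cancel_right add_diff_cancel_left by linarith
  then have "(\<integral>z. (norm (P z + Q z - (v z + w z, G z + H z)))\<^sup>2 \<partial>leb_on \<Omega>) < e" by simp
  then show "\<exists>v G. core_function \<Gamma> v G \<and> (\<integral>z. (norm (P z + Q z - (v z, G z)))\<^sup>2 \<partial>leb_on \<Omega>) < e"
    using core_add[OF v(1) w(1)] by blast
qed

lemma form_domain_scaleR:
  assumes P: "form_domain \<Omega> \<Gamma> P"
  shows "form_domain \<Omega> \<Gamma> (\<lambda>z. c *\<^sub>R P z)"
  unfolding form_domain_def
proof (intro conjI allI impI L2_scaleR form_domain_L2[OF P])
  fix e :: real assume e: "e > 0"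
  \<comment> \<open>The summand 1 allows division when \<open>c = 0\<close>.\<close>
  have c1: "c\<^sup>2 + 1 > 0" by (simp add: add_nonneg_pos)
  obtain v G where v: "core_function \<Gamma> v G" "(\<integral>z. (norm (P z - (v z, G z)))\<^sup>2 \<partial>leb_on \<Omega>) < e / (c\<^sup>2 + 1)"
    using P divide_pos_pos[OF e c1] unfolding form_domain_def by blast
  have "(\<integral>z. (norm (c *\<^sub>R P z - (c * v z, c *\<^sub>R G z)))\<^sup>2 \<partial>leb_on \<Omega>) = (\<integral>z. c\<^sup>2 * (norm (P z - (v z, G z)))\<^sup>2 \<partial>leb_on \<Omega>)"
  proof (rule Bochner_Integration.integral_cong)
    fix z
    have "c *\<^sub>R P z - (c * v z, c *\<^sub>R G z) = c *\<^sub>R (P z - (v z, G z))" by (simp add: scaleR_right_diff_distrib)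
    then show "(norm (c *\<^sub>R P z - (c * v z, c *\<^sub>R G z)))\<^sup>2 = c\<^sup>2 * (norm (P z - (v z, G z)))\<^sup>2"
      by (simp add: power_mult_distrib)
  qed simp
  also have "\<dots> = c\<^sup>2 * (\<integral>z. (norm (P z - (v z, G z)))\<^sup>2 \<partial>leb_on \<Omega>)" by simp
  also have "\<dots> \<le> (c\<^sup>2 + 1) * (\<integral>z. (norm (P z - (v z, G z)))\<^sup>2 \<partial>leb_on \<Omega>)" 
    by (intro mult_right_mono) auto
  also have "\<dots> < (c\<^sup>2 + 1) * (e / (c\<^sup>2 + 1))" using c1 v(2) by (intro mult_strict_left_mono) auto
  also have "\<dots> = e" using c1 by simp
  finally show "\<exists>v G. core_function \<Gamma> v G \<and> (\<integral>z. (norm (c *\<^sub>R P z - (v z, G z)))\<^sup>2 \<partial>leb_on \<Omega>) < e"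
    using core_cmult[OF v(1), of c] by blast
qed

lemma form_domain_zero:
  assumes B: "bounded \<Omega>" "\<Omega> \<in> sets borel"
  shows "form_domain \<Omega> \<Gamma> (\<lambda>z. 0)"
  using form_domain_core[OF B, of \<Gamma> "\<lambda>z. 0" "\<lambda>z. 0"] C1_const[of 0] by (simp add: core_function_def flip: zero_prod_def)

lemma form_domain_sum:
  assumes B: "bounded \<Omega>" "\<Omega> \<in> sets borel" and P: "\<And>i. i \<in> I \<Longrightarrow> form_domain \<Omega> \<Gamma> (P i)"
  shows "form_domain \<Omega> \<Gamma> (\<lambda>z. \<Sum>i\<in>I. P i z)"
  using P by (induction I rule: infinite_finite_induct) (auto intro: form_domain_add[OF B] form_domain_zero[OF B])

section \<open>Restriction to a subset and extension by zero\<close>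

lemma integral_leb_on_indicator:
  fixes f :: "real \<times> real \<Rightarrow> 'b::euclidean_space"
  assumes "C \<subseteq> \<Omega>" "C \<in> sets borel" "\<Omega> \<in> sets borel"
  shows "(\<integral>z. (if z \<in> C then f z else 0) \<partial>leb_on \<Omega>) = (\<integral>z. f z \<partial>leb_on C)"
proof -
  have "(\<integral>z. (if z \<in> C then f z else 0) \<partial>leb_on \<Omega>) = (\<integral>z. indicator \<Omega> z *\<^sub>R (if z \<in> C then f z else 0) \<partial>lborel)"
    using assms by (simp add: integral_restrict_space)
  also have "\<dots> = (\<integral>z. indicator C z *\<^sub>R f z \<partial>lborel)"
    using assms by (intro Bochner_Integration.integral_cong) (auto simp: indicator_def)
  also have "\<dots> = (\<integral>z. f z \<partial>leb_on C)" using assms by (simp add: integral_restrict_space)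
  finally show ?thesis .
qed

lemma integrable_leb_on_indicator:
  fixes f :: "real \<times> real \<Rightarrow> 'b::euclidean_space"
  assumes "C \<subseteq> \<Omega>" "C \<in> sets borel" "\<Omega> \<in> sets borel"
  shows "integrable (leb_on \<Omega>) (\<lambda>z. if z \<in> C then f z else 0) \<longleftrightarrow> integrable (leb_on C) f"
proof -
  have "integrable (leb_on \<Omega>) (\<lambda>z. if z \<in> C then f z else 0) \<longleftrightarrow> integrable lborel (\<lambda>z. indicator \<Omega> z *\<^sub>R (if z \<in> C then f z else 0))"
    using assms by (simp add: integrable_restrict_space)
  also have "(\<lambda>z. indicator \<Omega> z *\<^sub>R (if z \<in> C then f z else 0)) = (\<lambda>z. indicator C z *\<^sub>R f z)"
    using assms by (auto simp: indicator_def fun_eq_iff)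
  also have "integrable lborel \<dots> \<longleftrightarrow> integrable (leb_on C) f" using assms by (simp add: integrable_restrict_space)
  finally show ?thesis .
qed

lemma measurable_leb_on_indicator:
  fixes f :: "real \<times> real \<Rightarrow> 'b::euclidean_space"
  assumes "C \<subseteq> \<Omega>" "C \<in> sets borel" "\<Omega> \<in> sets borel"
  shows "(\<lambda>z. if z \<in> C then f z else 0) \<in> borel_measurable (leb_on \<Omega>) \<longleftrightarrow> f \<in> borel_measurable (leb_on C)"
proof -
  have "(\<lambda>z. if z \<in> C then f z else 0) \<in> borel_measurable (leb_on \<Omega>) \<longleftrightarrow> (\<lambda>z. indicator \<Omega> z *\<^sub>R (if z \<in> C then f z else 0)) \<in> borel_measurable lborel"
    using assms by (simp add: borel_measurable_restrict_space_iff)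
  also have "(\<lambda>z. indicator \<Omega> z *\<^sub>R (if z \<in> C then f z else 0)) = (\<lambda>z. indicator C z *\<^sub>R f z)"
    using assms by (auto simp: indicator_def fun_eq_iff)
  also have "\<dots> \<in> borel_measurable lborel \<longleftrightarrow> f \<in> borel_measurable (leb_on C)" 
    using assms by (simp add: borel_measurable_restrict_space_iff)
  finally show ?thesis .
qed

lemma L2_indicator:
  fixes f :: "real \<times> real \<Rightarrow> 'b::euclidean_space"
  assumes "C \<subseteq> \<Omega>" "C \<in> sets borel" "\<Omega> \<in> sets borel"
  shows "L2 (leb_on \<Omega>) (\<lambda>z. if z \<in> C then f z else 0) \<longleftrightarrow> L2 (leb_on C) f"
proof -
  have "(\<lambda>z. (norm (if z \<in> C then f z else 0))\<^sup>2) = (\<lambda>z. if z \<in> C then (norm (f z))\<^sup>2 else 0)" by auto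
  then show ?thesis unfolding L2_def
    by (simp only: measurable_leb_on_indicator[OF assms] integrable_leb_on_indicator[OF assms])
qed

lemma L2_subset:
  fixes f :: "real \<times> real \<Rightarrow> 'b::euclidean_space"
  assumes "C \<subseteq> \<Omega>" "C \<in> sets borel" "\<Omega> \<in> sets borel" "L2 (leb_on \<Omega>) f"
  shows "L2 (leb_on C) f"
proof -
  have CM: "C \<in> sets (leb_on \<Omega>)" using assms by (auto simp: sets_restrict_space)
  have "L2 (leb_on \<Omega>) (\<lambda>z. if z \<in> C then f z else 0)"
  proof (rule L2_bound[where h = "\<lambda>z. (norm (f z))\<^sup>2"])
    show "(\<lambda>z. if z \<in> C then f z else 0) \<in> borel_measurable (leb_on \<Omega>)"
      using L2_measurable[OF assms(4)] CM by (intro measurable_If_set) (auto intro: sets.Int)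
  qed (use assms in \<open>auto simp: L2_def\<close>)
  then show ?thesis using L2_indicator[OF assms(1-3)] by blast
qed

lemma integral_leb_on_mono_set:
  assumes "C \<subseteq> \<Omega>" "C \<in> sets borel" "\<Omega> \<in> sets borel" "L2 (leb_on \<Omega>) f"
  shows "(\<integral>z. (norm (f z))\<^sup>2 \<partial>leb_on C) \<le> (\<integral>z. (norm (f z))\<^sup>2 \<partial>leb_on \<Omega>)"
proof -
  have "(\<integral>z. (norm (f z))\<^sup>2 \<partial>leb_on C) = (\<integral>z. (if z \<in> C then (norm (f z))\<^sup>2 else 0) \<partial>leb_on \<Omega>)"
    by (rule integral_leb_on_indicator[symmetric]) fact+
  also have "\<dots> \<le> (\<integral>z. (norm (f z))\<^sup>2 \<partial>leb_on \<Omega>)"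
    using L2_norm2_integrable[OF assms(4)] L2_norm2_integrable[OF L2_subset[OF assms]] integrable_leb_on_indicator[OF assms(1-3), of "\<lambda>z. (norm (f z))\<^sup>2"]
    by (intro integral_mono) auto
  finally show ?thesis .
qed

lemma form_domain_subset:
  assumes "bounded \<Omega>" "C \<subseteq> \<Omega>" "C \<in> sets borel" "\<Omega> \<in> sets borel" "form_domain \<Omega> \<Gamma> P"
  shows "form_domain C \<Gamma> P"
  unfolding form_domain_def
proof (intro conjI allI impI L2_subset[OF assms(2-4)] form_domain_L2[OF assms(5)])
  fix e :: real assume "e > 0"
  then obtain v G where v: "core_function \<Gamma> v G" "(\<integral>z. (norm (P z - (v z, G z)))\<^sup>2 \<partial>leb_on \<Omega>) < e"
    using assms(5) unfolding form_domain_def by blast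
  show "\<exists>v G. core_function \<Gamma> v G \<and> (\<integral>z. (norm (P z - (v z, G z)))\<^sup>2 \<partial>leb_on C) < e"
    using v integral_leb_on_mono_set[OF assms(2-4) L2_diff[OF form_domain_L2[OF assms(5)] core_pair_L2[OF assms(1,4) v(1)]]]
    by (intro exI[of _ v] exI[of _ G]) auto
qed

lemma form_domain_cong:
  assumes "\<And>z. z \<in> \<Omega> \<Longrightarrow> P z = Q z" "form_domain \<Omega> \<Gamma> P"
  shows "form_domain \<Omega> \<Gamma> Q"
proof -
  have sp: "space (leb_on \<Omega>) = \<Omega>" by (simp add: space_restrict_space)
  have 1: "Q \<in> borel_measurable (leb_on \<Omega>) \<longleftrightarrow> P \<in> borel_measurable (leb_on \<Omega>)"
    using assms(1) sp by (intro measurable_cong) auto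
  have 2: "integrable (leb_on \<Omega>) (\<lambda>z. (norm (Q z))\<^sup>2) \<longleftrightarrow> integrable (leb_on \<Omega>) (\<lambda>z. (norm (P z))\<^sup>2)"
    using assms(1) sp by (intro Bochner_Integration.integrable_cong) auto
  have 3: "(\<integral>z. (norm (Q z - (v z, G z)))\<^sup>2 \<partial>leb_on \<Omega>) = (\<integral>z. (norm (P z - (v z, G z)))\<^sup>2 \<partial>leb_on \<Omega>)" for v G
    using assms(1) sp by (intro Bochner_Integration.integral_cong) auto
  show ?thesis using assms(2) unfolding form_domain_def L2_def 1 2 3 .
qed

text \<open>\<open>twist \<mu> (u, g) \<bullet> (v, h)\<close> is the integrand of the Dirichlet form minus \<open>\<mu>\<close> times the \<open>L\<^sup>2\<close> product.\<close>

definition twist :: "real \<Rightarrow> real \<times> (real \<times> real) \<Rightarrow> real \<times> (real \<times> real)" where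
  "twist \<mu> p = (- \<mu> * fst p, snd p)"

lemma bounded_linear_twist: "bounded_linear (twist \<mu>)"
  unfolding twist_def
  by (intro bounded_linear_Pair bounded_linear_const_mult bounded_linear_fst bounded_linear_snd)

lemma twist_zero [simp]: "twist \<mu> 0 = 0"
  by (simp add: twist_def zero_prod_def)

lemma twist_inner: "twist \<mu> p \<bullet> q = snd p \<bullet> snd q - \<mu> * (fst p * fst q)"
  by (simp add: twist_def inner_prod_def)

text \<open>Test maps range over the whole form domain rather than over core functions, so that
  eigenfunctions and their pieces may themselves be inserted. Density of the core makes this
  equivalent, see \<open>weak_iff\<close>.\<close>

definition weak_pair :: "(real \<times> real) set \<Rightarrow> (real \<times> real) set \<Rightarrow> real \<Rightarrow> (real \<times> real \<Rightarrow> real \<times> (real \<times> real)) \<Rightarrow> bool" where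
  "weak_pair \<Omega> \<Gamma> \<mu> P \<longleftrightarrow> form_domain \<Omega> \<Gamma> P \<and> (\<forall>V. form_domain \<Omega> \<Gamma> V \<longrightarrow> (\<integral>z. twist \<mu> (P z) \<bullet> V z \<partial>leb_on \<Omega>) = 0)"

lemma weak_pair_core:
  assumes B: "bounded \<Omega>" "\<Omega> \<in> sets borel" and P: "form_domain \<Omega> \<Gamma> P"
    and c: "\<And>v G. core_function \<Gamma> v G \<Longrightarrow> (\<integral>z. twist \<mu> (P z) \<bullet> (v z, G z) \<partial>leb_on \<Omega>) = 0"
  shows "weak_pair \<Omega> \<Gamma> \<mu> P"
  unfolding weak_pair_def
proof (intro conjI P allI impI)
  fix V assume V: "form_domain \<Omega> \<Gamma> V"
  show "(\<integral>z. twist \<mu> (P z) \<bullet> V z \<partial>leb_on \<Omega>) = 0"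
  proof (rule L2_inner_limit_zero[OF L2_bounded_linear[OF bounded_linear_twist form_domain_L2[OF P]] form_domain_L2[OF V]])
    fix e :: real assume "e > 0"
    then obtain v G where v: "core_function \<Gamma> v G" "(\<integral>z. (norm (V z - (v z, G z)))\<^sup>2 \<partial>leb_on \<Omega>) < e"
      using V unfolding form_domain_def by blast
    show "\<exists>h. L2 (leb_on \<Omega>) h \<and> (\<integral>z. (norm (V z - h z))\<^sup>2 \<partial>leb_on \<Omega>) < e \<and> (\<integral>z. twist \<mu> (P z) \<bullet> h z \<partial>leb_on \<Omega>) = 0"
      using v(2) c[OF v(1)] core_pair_L2[OF B v(1)] by (intro exI[of _ "\<lambda>z. (v z, G z)"]) auto
  qed
qed

lemma weak_iff:
  assumes B: "bounded \<Omega>" "\<Omega> \<in> sets borel"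
  shows "weak_eigenfunction \<Omega> \<Gamma> \<mu> u \<longleftrightarrow> (\<exists>g. weak_pair \<Omega> \<Gamma> \<mu> (\<lambda>z. (u z, g z)))"
proof -
  have eq: "(\<integral>z. twist \<mu> (u z, g z) \<bullet> (v z, G z) \<partial>leb_on \<Omega>) = 
      (LINT z:\<Omega>|lborel. g z \<bullet> G z) - \<mu> * (LINT z:\<Omega>|lborel. u z * v z)"
    if form_domain: "form_domain \<Omega> \<Gamma> (\<lambda>z. (u z, g z))" and c: "core_function \<Gamma> v G" for g v G
  proof -
    note L = form_domain_L2[OF form_domain] core_pair_L2[OF B c]
    have i: "integrable (leb_on \<Omega>) (\<lambda>z. g z \<bullet> G z)" "integrable (leb_on \<Omega>) (\<lambda>z. u z * v z)"
      using L2_inner_integrable[OF L2_snd[OF L(1)] L2_snd[OF L(2)]] L2_inner_integrable[OF L2_fst[OF L(1)] L2_fst[OF L(2)]]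
      by simp_all
    show ?thesis
      unfolding set_integral_leb_on[OF B(2)] twist_inner fst_conv snd_conv using i by simp
  qed
  show ?thesis
  proof
    assume "weak_eigenfunction \<Omega> \<Gamma> \<mu> u"
    then obtain g where g: "form_domain \<Omega> \<Gamma> (\<lambda>z. (u z, g z))"
      "\<And>v G. core_function \<Gamma> v G \<Longrightarrow> (LINT z:\<Omega>|lborel. g z \<bullet> G z) = \<mu> * (LINT z:\<Omega>|lborel. u z * v z)"
      unfolding weak_eigenfunction_def form_domain_iff[OF B] by blast
    then have "weak_pair \<Omega> \<Gamma> \<mu> (\<lambda>z. (u z, g z))"
      by (intro weak_pair_core[OF B]) (simp_all add: eq[OF g(1)])
    then show "\<exists>g. weak_pair \<Omega> \<Gamma> \<mu> (\<lambda>z. (u z, g z))" by blast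
  next
    assume "\<exists>g. weak_pair \<Omega> \<Gamma> \<mu> (\<lambda>z. (u z, g z))"
    then obtain g where g: "form_domain \<Omega> \<Gamma> (\<lambda>z. (u z, g z))"
       "\<And>V. form_domain \<Omega> \<Gamma> V \<Longrightarrow> (\<integral>z. twist \<mu> (u z, g z) \<bullet> V z \<partial>leb_on \<Omega>) = 0"
      unfolding weak_pair_def by blast
    have "(LINT z:\<Omega>|lborel. g z \<bullet> G z) = \<mu> * (LINT z:\<Omega>|lborel. u z * v z)" if "core_function \<Gamma> v G" for v G
      using eq[OF g(1) that] g(2)[OF form_domain_core[OF B that]] by simp
    then show "weak_eigenfunction \<Omega> \<Gamma> \<mu> u"
      unfolding weak_eigenfunction_def form_domain_iff[OF B] using g(1) by blast
  qed
qed

section \<open>Extension by zero from a component\<close>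

definition pos2 :: "real \<Rightarrow> real" where "pos2 t = (max 0 t)\<^sup>2"
definition pos3 :: "real \<Rightarrow> real" where "pos3 t = (max 0 t) ^ 3"

text \<open>Written as half the sum of the square of t and t \<bar>t\<bar>, the function needs a
  difference quotient only for t \<bar>t\<bar> at 0.\<close>

lemma pos2_deriv: "(pos2 has_real_derivative 2 * max 0 t) (at t)"
proof -
  have "((\<lambda>t. t * \<bar>t\<bar>) has_real_derivative 2 * \<bar>t\<bar>) (at t)" for t :: real
  proof (cases "t = 0")
    case True
    have "((\<lambda>h. h * \<bar>h\<bar> / h) \<longlongrightarrow> 0) (at (0::real))"
    proof (rule Lim_transform_eventually)
      show "((\<lambda>h::real. \<bar>h\<bar>) \<longlongrightarrow> 0) (at 0)" by (auto intro!: tendsto_eq_intros)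
      show "\<forall>\<^sub>F h in at 0. \<bar>h\<bar> = h * \<bar>h\<bar> / (h::real)" by (auto simp: eventually_at intro!: exI[of _ 1])
    qed
    then show ?thesis using True by (simp add: DERIV_def)
  next
    case False
    show ?thesis
    proof (cases "t > 0")
      case True
      have "((\<lambda>t. t * t) has_real_derivative 2 * \<bar>t\<bar>) (at t)" using True by (auto intro!: derivative_eq_intros)
      then show ?thesis by (rule has_field_derivative_transform_within_open[of _ _ _ "{0<..}"]) (use True in auto)
    next
      case nt: False
      have "((\<lambda>t. - (t * t)) has_real_derivative 2 * \<bar>t\<bar>) (at t)" using nt False by (auto intro!: derivative_eq_intros)
      then show ?thesis by (rule has_field_derivative_transform_within_open[of _ _ _ "{..<0}"]) (use nt False in auto)
    qed
  qed
  note 1 = this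
  have "((\<lambda>t. (t\<^sup>2 + t * \<bar>t\<bar>) / 2) has_real_derivative (2 * t + 2 * \<bar>t\<bar>) / 2) (at t)"
  proof -
    have "((\<lambda>t. t\<^sup>2) has_real_derivative 2 * t) (at t)" by (auto intro!: derivative_eq_intros)
    from DERIV_cdivide[OF DERIV_add[OF this 1]] show ?thesis .
  qed
  moreover have "pos2 = (\<lambda>t. (t\<^sup>2 + t * \<bar>t\<bar>) / 2)" by (auto simp: pos2_def fun_eq_iff max_def power2_eq_square)
  moreover have "(2 * t + 2 * \<bar>t\<bar>) / 2 = 2 * max 0 t" by (auto simp: max_def)
  ultimately show ?thesis by simp
qed

lemma pos3_deriv: "(pos3 has_real_derivative 3 * (max 0 t)\<^sup>2) (at t)"
proof -
  have "((\<lambda>t. t * pos2 t) has_real_derivative 1 * pos2 t + 2 * max 0 t * t) (at t)"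
    by (rule DERIV_mult[OF DERIV_ident pos2_deriv])
  moreover have "pos3 = (\<lambda>t. t * pos2 t)" by (auto simp: pos3_def pos2_def fun_eq_iff max_def power2_eq_square power3_eq_cube)
  moreover have "1 * pos2 t + 2 * max 0 t * t = 3 * (max 0 t)\<^sup>2" by (auto simp: pos2_def max_def power2_eq_square)
  ultimately show ?thesis by simp
qed

text \<open>The cubic smoothstep, written with truncated powers so that its derivative needs no case distinction.\<close>

definition smoothstep :: "real \<Rightarrow> real" where
  "smoothstep t = 3 * pos2 t - 2 * pos3 t + 3 * pos2 (t - 1) + 2 * pos3 (t - 1)"

definition smoothstep' :: "real \<Rightarrow> real" where
  "smoothstep' t = 6 * max 0 t - 6 * (max 0 t)\<^sup>2 + 6 * max 0 (t - 1) + 6 * (max 0 (t - 1))\<^sup>2"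

lemma smoothstep_deriv: "(smoothstep has_real_derivative smoothstep' t) (at t)"
  unfolding smoothstep_def smoothstep'_def
  by (auto intro!: derivative_eq_intros DERIV_chain2[OF pos2_deriv] DERIV_chain2[OF pos3_deriv] pos2_deriv pos3_deriv)

lemma smoothstep'_continuous: "continuous_on UNIV smoothstep'"
  unfolding smoothstep'_def by (intro continuous_intros)

lemma smoothstep_le0: "t \<le> 0 \<Longrightarrow> smoothstep t = 0" "t \<le> 0 \<Longrightarrow> smoothstep' t = 0"
  by (simp_all add: smoothstep_def smoothstep'_def pos2_def pos3_def)

lemma smoothstep_ge1:
  assumes "t \<ge> 1"
  shows "smoothstep t = 1" "smoothstep' t = 0"
proof -
  from assms have m: "max 0 t = t" "max 0 (t - 1) = t - 1" by auto
  show "smoothstep t = 1" "smoothstep' t = 0"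
    unfolding smoothstep_def smoothstep'_def pos2_def pos3_def m by (simp_all add: power2_eq_square power3_eq_cube algebra_simps)
qed

lemma smoothstep_mid:
  assumes "0 \<le> t" "t \<le> 1"
  shows "smoothstep t = t\<^sup>2 * (3 - 2 * t)" "smoothstep' t = 6 * t * (1 - t)"
proof -
  from assms have m: "max 0 t = t" "max 0 (t - 1) = 0" by auto
  show "smoothstep t = t\<^sup>2 * (3 - 2 * t)" "smoothstep' t = 6 * t * (1 - t)"
    unfolding smoothstep_def smoothstep'_def pos2_def pos3_def m by (simp_all add: power2_eq_square power3_eq_cube algebra_simps)
qed

lemma smoothstep_range: "0 \<le> smoothstep t" "smoothstep t \<le> 1"
proof -
  consider "t \<le> 0" | "0 \<le> t" "t \<le> 1" | "t \<ge> 1" by linarith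
  then have "0 \<le> smoothstep t \<and> smoothstep t \<le> 1"
  proof cases
    case 2
    have "0 \<le> (1 - t)\<^sup>2 * (1 + 2 * t)" using 2 by simp
    then have "t\<^sup>2 * (3 - 2 * t) \<le> 1" by (simp add: algebra_simps power2_eq_square)
    moreover have "0 \<le> t\<^sup>2 * (3 - 2 * t)" using 2 by simp
    ultimately show ?thesis using smoothstep_mid[OF 2] by simp
  qed (auto simp: smoothstep_le0 smoothstep_ge1)
  then show "0 \<le> smoothstep t" "smoothstep t \<le> 1" by auto
qed

lemma smoothstep'_range: "0 \<le> smoothstep' t" "smoothstep' t \<le> 6"
proof -
  consider "t \<le> 0" | "0 \<le> t" "t \<le> 1" | "t \<ge> 1" by linarith
  then have "0 \<le> smoothstep' t \<and> smoothstep' t \<le> 6"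
  proof cases
    case 2
    have "t * (1 - t) \<le> 1 * 1" using 2 by (intro mult_mono) auto
    then show ?thesis using 2 smoothstep_mid[OF 2] by auto
  qed (auto simp: smoothstep_le0 smoothstep_ge1)
  then show "0 \<le> smoothstep' t" "smoothstep' t \<le> 6" by auto
qed

text \<open>Zero for \<bar>s\<bar> \<le> e and the identity for \<bar>s\<bar> \<ge> 2 e. Measuring s
  through its square instead of its absolute value keeps the function C1 at 0 and odd.\<close>

definition truncation :: "real \<Rightarrow> real \<Rightarrow> real" where
  "truncation e s = s * smoothstep (s\<^sup>2 / e\<^sup>2 - 1)"

definition truncation' :: "real \<Rightarrow> real \<Rightarrow> real" where
  "truncation' e s = smoothstep (s\<^sup>2 / e\<^sup>2 - 1) + s * (smoothstep' (s\<^sup>2 / e\<^sup>2 - 1) * (2 * s / e\<^sup>2))"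

lemma truncation_deriv: "(truncation e has_real_derivative truncation' e s) (at s)"
proof -
  have "((\<lambda>s. s\<^sup>2) has_real_derivative 2 * s) (at s)" by (auto intro!: derivative_eq_intros)
  from DERIV_diff[OF DERIV_cdivide[OF this, of "e\<^sup>2"] DERIV_const[of 1]]
  have "((\<lambda>s. s\<^sup>2 / e\<^sup>2 - 1) has_real_derivative 2 * s / e\<^sup>2) (at s)" by simp
  from DERIV_mult[OF DERIV_ident DERIV_chain2[OF smoothstep_deriv this]]
  show ?thesis unfolding truncation_def truncation'_def by (simp add: algebra_simps)
qed

lemma truncation'_continuous: "e > 0 \<Longrightarrow> continuous_on UNIV (truncation' e)"
  unfolding truncation'_def 
  by (intro continuous_intros continuous_on_compose2[OF smoothstep'_continuous] 
      continuous_on_compose2[OF DERIV_continuous_on[of UNIV smoothstep smoothstep']]) 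
     (auto intro: has_field_derivative_at_within smoothstep_deriv)

lemma truncation_small:
  assumes "e > 0" "\<bar>s\<bar> \<le> e"
  shows "truncation e s = 0" "truncation' e s = 0"
proof -
  have "s\<^sup>2 \<le> e\<^sup>2" using assms by (metis abs_le_square_iff abs_of_pos)
  then have "s\<^sup>2 / e\<^sup>2 - 1 \<le> 0" using assms(1) by (simp add: divide_le_eq_1)
  then show "truncation e s = 0" "truncation' e s = 0" by (simp_all add: truncation_def truncation'_def smoothstep_le0)
qed

lemma truncation_large:
  assumes "e > 0" "2 * e \<le> \<bar>s\<bar>"
  shows "truncation e s = s" "truncation' e s = 1"
proof -
  have "(2 * e)\<^sup>2 \<le> s\<^sup>2" using assms by (metis abs_le_square_iff abs_of_pos mult_pos_pos zero_less_numeral)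
  then have "4 * e\<^sup>2 \<le> s\<^sup>2" by (simp add: power_mult_distrib)
  then have "2 * e\<^sup>2 \<le> s\<^sup>2" using zero_le_power2[of e] by linarith
  then have "s\<^sup>2 / e\<^sup>2 - 1 \<ge> 1" using assms(1) by (simp add: le_divide_eq)
  then show "truncation e s = s" "truncation' e s = 1" by (simp_all add: truncation_def truncation'_def smoothstep_ge1)
qed

lemma truncation_bound: "\<bar>s - truncation e s\<bar> \<le> \<bar>s\<bar>"
proof -
  have "s - truncation e s = s * (1 - smoothstep (s\<^sup>2 / e\<^sup>2 - 1))" by (simp add: truncation_def algebra_simps)
  then have "\<bar>s - truncation e s\<bar> = \<bar>s\<bar> * \<bar>1 - smoothstep (s\<^sup>2 / e\<^sup>2 - 1)\<bar>" by (simp add: abs_mult)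
  also have "\<dots> \<le> \<bar>s\<bar> * 1" using smoothstep_range[of "s\<^sup>2 / e\<^sup>2 - 1"] by (intro mult_left_mono) auto
  finally show ?thesis by simp
qed

text \<open>The bound must not depend on \<open>e\<close>, since it serves for dominated convergence
  as \<open>e\<close> tends to 0. In terms of \<open>?t\<close> the derivative is a value of
  \<open>smoothstep\<close>, between 0 and 1, plus 2 (\<open>?t\<close> + 1) times
  \<open>smoothstep'\<close>; the latter vanishes once \<open>?t\<close> \<ge> 1, so the second term
  is at most 2 times 2 times 6 = 24.\<close>

lemma truncation'_bound:
  assumes "e > 0"
  shows "\<bar>1 - truncation' e s\<bar> \<le> 25"
proof -
  let ?t = "s\<^sup>2 / e\<^sup>2 - 1"
  have eq: "truncation' e s = smoothstep ?t + 2 * (?t + 1) * smoothstep' ?t"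
    by (simp add: truncation'_def power2_eq_square algebra_simps)
  have "0 \<le> 2 * (?t + 1) * smoothstep' ?t \<and> 2 * (?t + 1) * smoothstep' ?t \<le> 24"
  proof (cases "?t \<ge> 1")
    case True then show ?thesis using smoothstep_ge1(2)[OF True] by simp
  next
    case False
    have t0: "0 \<le> ?t + 1" by simp
    have t2: "?t + 1 \<le> 2" using False by linarith
    have "(?t + 1) * smoothstep' ?t \<le> 2 * 6" using smoothstep'_range[of ?t] t0 t2 by (intro mult_mono) auto
    moreover have "0 \<le> (?t + 1) * smoothstep' ?t" using smoothstep'_range[of ?t] t0 by (intro mult_nonneg_nonneg)
    ultimately show ?thesis by simp
  qed
  then show ?thesis unfolding eq using smoothstep_range[of ?t] by linarith
qed

text \<open>A zero with nonzero derivative is isolated among all zeros, hence is the only zero in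
  some interval with rational ends, and there are countably many such intervals.\<close>

lemma countable_regular_zeros:
  fixes f f' :: "real \<Rightarrow> real"
  assumes "\<And>x. (f has_real_derivative f' x) (at x)"
  shows "countable {x. f x = 0 \<and> f' x \<noteq> 0}"
proof -
  let ?Z = "{x. f x = 0 \<and> f' x \<noteq> 0}"
  have "\<exists>p q. p \<in> \<rat> \<and> q \<in> \<rat> \<and> p < x \<and> x < q \<and> (\<forall>y. p < y \<and> y < q \<and> f y = 0 \<longrightarrow> y = x)" if x: "x \<in> ?Z" for x
  proof -
    have "((\<lambda>y. (f y - f x) / (y - x)) \<longlongrightarrow> f' x) (at x)"
      using assms[of x] by (simp add: has_field_derivative_iff)
    then have "\<forall>\<^sub>F y in at x. (f y - f x) / (y - x) \<noteq> 0" using x by (intro tendsto_imp_eventually_ne) auto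
    then obtain d where d: "d > 0" "\<And>y. y \<noteq> x \<Longrightarrow> dist y x < d \<Longrightarrow> f y \<noteq> 0"
      using x by (auto simp: eventually_at)
    obtain p where p: "p \<in> \<rat>" "x - d < p" "p < x" using Rats_dense_in_real[of "x - d" x] d(1) by auto
    obtain q where q: "q \<in> \<rat>" "x < q" "q < x + d" using Rats_dense_in_real[of x "x + d"] d(1) by auto
    have "\<forall>y. p < y \<and> y < q \<and> f y = 0 \<longrightarrow> y = x"
    proof (intro allI impI)
      fix y assume y: "p < y \<and> y < q \<and> f y = 0"
      then have "dist y x < d" using p q by (simp add: dist_real_def abs_less_iff)
      then show "y = x" using d(2) y by blast
    qed
    then show ?thesis using p q by blast
  qed
  then have "\<forall>x\<in>?Z. \<exists>r. fst r \<in> \<rat> \<and> snd r \<in> \<rat> \<and> fst r < x \<and> x < snd r \<and> (\<forall>y. fst r < y \<and> y < snd r \<and> f y = 0 \<longrightarrow> y = x)"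
    by force
  from bchoice[OF this] obtain r where r: "\<And>x. x \<in> ?Z \<Longrightarrow> fst (r x) \<in> \<rat> \<and> snd (r x) \<in> \<rat> \<and> fst (r x) < x \<and> x < snd (r x) \<and> (\<forall>y. fst (r x) < y \<and> y < snd (r x) \<and> f y = 0 \<longrightarrow> y = x)"
    by blast
  have "inj_on r ?Z"
  proof (rule inj_onI)
    fix x y assume xy: "x \<in> ?Z" "y \<in> ?Z" "r x = r y"
    then show "x = y" using r[OF xy(1)] r[OF xy(2)] by auto
  qed
  moreover have "countable (r ` ?Z)"
  proof (rule countable_subset)
    show "r ` ?Z \<subseteq> \<rat> \<times> \<rat>"
    proof (rule image_subsetI)
      fix x assume "x \<in> ?Z"
      from r[OF this] show "r x \<in> \<rat> \<times> \<rat>" unfolding mem_Times_iff by blast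
    qed
  qed (simp add: countable_rat)
  ultimately show ?thesis using countable_image_inj_on by blast
qed

lemma C1_slice:
  assumes "has_C1_gradient v G"
  shows "((\<lambda>x. v (x, y)) has_real_derivative fst (G (x, y))) (at x)"
    and "((\<lambda>y. v (x, y)) has_real_derivative snd (G (x, y))) (at y)"
proof -
  have d: "(v has_derivative (\<lambda>h. h \<bullet> G (x, y))) (at (x, y))"
    using assms by (rule C1_D)
  have "((\<lambda>x. (x, y)) has_derivative (\<lambda>h. (h, 0))) (at x)" by (auto intro!: derivative_eq_intros)
  from has_derivative_compose[OF this d] show "((\<lambda>x. v (x, y)) has_real_derivative fst (G (x, y))) (at x)"
    by (simp add: has_field_derivative_def inner_prod_def mult_commute_abs)
  have "((\<lambda>y. (x, y)) has_derivative (\<lambda>h. (0, h))) (at y)" by (auto intro!: derivative_eq_intros)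
  from has_derivative_compose[OF this d] show "((\<lambda>y. v (x, y)) has_real_derivative snd (G (x, y))) (at y)"
    by (simp add: has_field_derivative_def inner_prod_def mult_commute_abs)
qed

lemma AE_lborel_countable:
  assumes "countable S"
  shows "AE x in (lborel :: real measure). x \<notin> S"
proof (rule AE_I')
  show "S \<in> null_sets lborel" using assms countable_imp_null_set_lborel by blast
qed auto

text \<open>On each line parallel to an axis, the zeros with nonzero partial derivative are
  countable, hence null; Fubini then treats each partial derivative. It lets truncations converge in
  H1 even if the zero set has positive measure.\<close>

lemma AE_gradient_zero:
  assumes C: "has_C1_gradient v G"
  shows "AE z in lborel. v z = 0 \<longrightarrow> G z = 0"
proof -
  have S1: "{z. v z = 0 \<longrightarrow> snd (G z) = 0} \<in> sets borel" "{z. v z = 0 \<longrightarrow> fst (G z) = 0} \<in> sets borel"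
  proof -
    have c: "continuous_on UNIV v" "continuous_on UNIV G" using C1_continuous[OF C] C by (auto simp: has_C1_gradient_def)
    have "closed {z. v z = 0}" "closed {z. snd (G z) = 0}" "closed {z. fst (G z) = 0}"
      by (intro closed_Collect_eq continuous_intros c)+
    then have "- {z. v z = 0} \<union> {z. snd (G z) = 0} \<in> sets borel" "- {z. v z = 0} \<union> {z. fst (G z) = 0} \<in> sets borel"
      by (auto intro!: sets.Un borel_comp borel_closed)
    moreover have "- {z. v z = 0} \<union> {z. snd (G z) = 0} = {z. v z = 0 \<longrightarrow> snd (G z) = 0}"
        "- {z. v z = 0} \<union> {z. fst (G z) = 0} = {z. v z = 0 \<longrightarrow> fst (G z) = 0}" by auto
    ultimately show "{z. v z = 0 \<longrightarrow> snd (G z) = 0} \<in> sets borel" "{z. v z = 0 \<longrightarrow> fst (G z) = 0} \<in> sets borel" by simp_all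
  qed
  have 1: "AE z in (lborel::real measure) \<Otimes>\<^sub>M (lborel::real measure). v z = 0 \<longrightarrow> snd (G z) = 0"
  proof (rule lborel_pair.AE_pair_measure)
    show "AE x in lborel. AE y in lborel. v (x, y) = 0 \<longrightarrow> snd (G (x, y)) = 0"
    proof (rule AE_I2)
      fix x
      show "AE y in lborel. v (x, y) = 0 \<longrightarrow> snd (G (x, y)) = 0"
        using AE_lborel_countable[OF countable_regular_zeros[OF C1_slice(2)[OF C, of x]]] by eventually_elim auto
    qed
  qed (use S1 in \<open>unfold lborel_prod, simp\<close>)
  have 2: "AE z in (lborel::real measure) \<Otimes>\<^sub>M (lborel::real measure). v z = 0 \<longrightarrow> fst (G z) = 0"
  proof (rule lborel_pair.AE_pair_measure)
    show "AE x in lborel. AE y in lborel. v (x, y) = 0 \<longrightarrow> fst (G (x, y)) = 0"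
    proof (subst lborel_pair.AE_commute)
      show "AE y in lborel. AE x in lborel. v (x, y) = 0 \<longrightarrow> fst (G (x, y)) = 0"
      proof (rule AE_I2)
        fix y
        show "AE x in lborel. v (x, y) = 0 \<longrightarrow> fst (G (x, y)) = 0"
          using AE_lborel_countable[OF countable_regular_zeros[OF C1_slice(1)[OF C, of y]]] by eventually_elim auto
      qed
    qed (use S1 in \<open>unfold lborel_prod, simp\<close>)
  qed (use S1 in \<open>unfold lborel_prod, simp\<close>)
  from 1 2 show ?thesis unfolding lborel_prod by eventually_elim (auto simp: prod_eq_iff)
qed

lemma real_polynomial_C1:
  fixes p :: "real \<times> real \<Rightarrow> real"
  assumes "real_polynomial_function p"
  shows "\<exists>G. has_C1_gradient p G"
  using assms
proof (induction rule: real_polynomial_function.induct)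
  case (linear f)
  have "f h = h \<bullet> (f (1, 0), f (0, 1))" for h
  proof -
    have "f h = f (fst h *\<^sub>R (1, 0) + snd h *\<^sub>R (0, 1))" by simp
    also have "\<dots> = fst h *\<^sub>R f (1, 0) + snd h *\<^sub>R f (0, 1)"
      using linear by (simp only: linear_add[OF bounded_linear.linear] linear_scale[OF bounded_linear.linear])
    finally show ?thesis by (simp add: inner_prod_def)
  qed
  then have eq: "(\<lambda>h. h \<bullet> (f (1, 0), f (0, 1))) = f" by (intro ext) (rule sym)
  have "(f has_derivative (\<lambda>h. h \<bullet> (f (1, 0), f (0, 1)))) (at z)" for z
    unfolding eq by (rule bounded_linear_imp_has_derivative[OF linear])
  then have "has_C1_gradient f (\<lambda>z. (f (1, 0), f (0, 1)))"
    unfolding has_C1_gradient_def gderiv_def by (simp add: continuous_on_const)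
  then show ?case by blast
next
  case (const c) show ?case using C1_const by blast
next
  case (add f g) then show ?case using C1_add by blast
next
  case (mult f g) then show ?case using C1_mult by blast
qed

text \<open>A polynomial within distance 1 of the function with value 2 on \<open>A\<close> and -1
  on \<open>B\<close> is at least 1 on \<open>A\<close> and at most 0 on \<open>B\<close>; there
  \<open>smoothstep\<close> is exactly 1 or 0 and its derivative vanishes.\<close>

lemma C1_separation:
  fixes A B :: "(real \<times> real) set"
  assumes "compact A" "compact B" "A \<inter> B = {}"
  shows "\<exists>c H. has_C1_gradient c H \<and> (\<forall>z\<in>A. c z = 1 \<and> H z = 0) \<and> (\<forall>z\<in>B. c z = 0 \<and> H z = 0)"
proof -
  have "continuous_on (A \<union> B) (\<lambda>z. if z \<in> A then 2 else - 1 :: real)"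
    using assms by (intro continuous_on_cases) (auto simp: compact_imp_closed)
  then obtain p where p: "real_polynomial_function p" "\<And>z. z \<in> A \<union> B \<Longrightarrow> \<bar>(if z \<in> A then 2 else - 1) - p z\<bar> < 1"
    using Stone_Weierstrass_real_polynomial_function[of "A \<union> B" "\<lambda>z. if z \<in> A then 2 else - 1" 1] assms(1,2)
    by (metis compact_Un zero_less_one)
  obtain G where G: "has_C1_gradient p G" using real_polynomial_C1[OF p(1)] by blast
  have C: "has_C1_gradient (\<lambda>z. smoothstep (p z)) (\<lambda>z. smoothstep' (p z) *\<^sub>R G z)"
    by (rule C1_compose[OF G smoothstep_deriv smoothstep'_continuous])
  have pA: "p z \<ge> 1" if "z \<in> A" for z using p(2)[of z] that by auto
  have pB: "p z \<le> 0" if "z \<in> B" for z using p(2)[of z] that assms(3) by (auto split: if_splits)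
  show ?thesis
    by (rule exI[of _ "\<lambda>z. smoothstep (p z)"], rule exI[of _ "\<lambda>z. smoothstep' (p z) *\<^sub>R G z"])
       (use C pA pB in \<open>auto simp: smoothstep_le0 smoothstep_ge1\<close>)
qed

text \<open>
  The approximants are \<open>c\<close> times a truncation of \<open>v\<close> that vanishes where \<open>\<bar>v\<bar> \<le> e\<close>; the cutoff \<open>c\<close> separates
  the part of the closure of \<open>C\<close> where \<open>\<bar>v\<bar> \<ge> e\<close> from the other components.
\<close>

lemma component_extension_core:
  assumes \<Omega>: "open \<Omega>" "convex \<Omega>" "bounded \<Omega>" and S: "closed S" and C: "C \<in> components (\<Omega> - S)"
    and v: "has_C1_gradient v G" "\<And>z. z \<in> S \<inter> frontier C \<Longrightarrow> v z = 0"
  shows "form_domain \<Omega> {z. v z = 0} (\<lambda>z. if z \<in> C then (v z, G z) else 0)"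
proof -
  have oC: "open C" using C \<Omega>(1) S by (meson open_Diff open_components)
  have CO: "C \<subseteq> \<Omega>" "C \<inter> S = {}" using in_components_subset[OF C] by auto
  have sets: "\<Omega> \<in> sets borel" "C \<in> sets borel" using \<Omega>(1) oC by auto
  let ?P = "\<lambda>z. (v z, G z)" and ?E = "\<lambda>z. if z \<in> C then (v z, G z) else 0"
  have L2C: "L2 (leb_on C) ?P" 
    using \<Omega>(3) CO(1) bounded_subset sets(2) C1_pair_continuous[OF v(1)] by (blast intro: L2_continuous)
  have L2E: "L2 (leb_on \<Omega>) ?E" using iffD2[OF L2_indicator[OF CO(1) sets(2,1), of ?P] L2C] .
  \<comment> \<open>Off \<open>S\<close>, a small ball meets the convex set \<open>\<Omega>\<close>
    in a connected set, which cannot touch both the component \<open>C\<close> and the rest of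
    \<open>\<Omega>\<close>. So a point adherent to both lies in \<open>S\<close>, on the frontier
    of \<open>C\<close>.\<close>
  have key: "v z = 0" if zc: "z \<in> closure C" "z \<in> closure (\<Omega> - C)" for z
  proof -
    have "z \<notin> C"
      using zc(2) open_Int_closure_eq_empty[OF oC, of "\<Omega> - C"] by blast
    then have fr: "z \<in> frontier C" using zc(1) oC by (simp add: frontier_def interior_open)
    have "z \<in> S"
    proof (rule ccontr)
      assume "z \<notin> S"
      then obtain r where r: "r > 0" "ball z r \<subseteq> - S" using S open_contains_ball[of "- S"] by (auto simp: open_Compl)
      have con: "connected (ball z r \<inter> \<Omega>)" using \<Omega>(2) by (intro convex_connected convex_Int) auto
      obtain a where a: "a \<in> C" "dist a z < r" using zc(1) r(1) unfolding closure_approachable by blast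
      obtain b where b: "b \<in> \<Omega> - C" "dist b z < r" using zc(2) r(1) unfolding closure_approachable by blast
      have "C \<inter> (ball z r \<inter> \<Omega>) \<noteq> {}" using a CO(1) by (auto simp: dist_commute)
      moreover have "ball z r \<inter> \<Omega> \<subseteq> \<Omega> - S" using r by auto
      ultimately have "ball z r \<inter> \<Omega> \<subseteq> C" using components_maximal[OF C con] by blast
      moreover have "b \<in> ball z r \<inter> \<Omega>" using b by (simp add: dist_commute)
      ultimately show False using b(1) by blast
    qed
    then show ?thesis using fr v(2) by blast
  qed
  define A where "A e = closure C \<inter> {z. e \<le> \<bar>v z\<bar>}" for e
  define B where "B e = closure (\<Omega> - C) \<inter> {z. e \<le> \<bar>v z\<bar>}" for e
  have cl: "closed {z. e \<le> \<bar>v z\<bar>}" for e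
    using C1_continuous[OF v(1)] by (intro closed_Collect_le continuous_intros)
  have cA: "compact (A e)" for e unfolding A_def using \<Omega>(3) CO(1) bounded_subset cl
    by (intro compact_Int_closed) (auto simp: compact_closure)
  have cB: "compact (B e)" for e unfolding B_def using \<Omega>(3) bounded_subset[of \<Omega> "\<Omega> - C"] cl
    by (intro compact_Int_closed) (auto simp: compact_closure)
  have dis: "A e \<inter> B e = {}" if "e > 0" for e using key that unfolding A_def B_def by force
  have approx: "\<exists>w H. core_function {z. v z = 0} w H \<and> 
      (\<forall>z\<in>\<Omega>. (w z, H z) = (if z \<in> C then (truncation e (v z), truncation' e (v z) *\<^sub>R G z) else 0))" if e: "e > 0" for e
  proof -
    obtain c K where c: "has_C1_gradient c K" "\<And>z. z \<in> A e \<Longrightarrow> c z = 1 \<and> K z = 0" "\<And>z. z \<in> B e \<Longrightarrow> c z = 0 \<and> K z = 0"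
      using C1_separation[OF cA cB dis[OF e]] by blast
    let ?w = "\<lambda>z. c z * truncation e (v z)" and ?H = "\<lambda>z. truncation e (v z) *\<^sub>R K z + c z *\<^sub>R (truncation' e (v z) *\<^sub>R G z)"
    have "has_C1_gradient ?w ?H"
      by (rule C1_mult[OF c(1) C1_compose[OF v(1) truncation_deriv truncation'_continuous[OF e]]])
    moreover have "?w z = 0" if "v z = 0" for z using that e by (simp add: truncation_small)
    ultimately have "core_function {z. v z = 0} ?w ?H" by (simp add: core_function_def)
    moreover have "(?w z, ?H z) = (if z \<in> C then (truncation e (v z), truncation' e (v z) *\<^sub>R G z) else 0)" if z: "z \<in> \<Omega>" for z
    proof (cases "\<bar>v z\<bar> \<le> e")
      case True
      then show ?thesis using truncation_small[OF e True] by (simp add: zero_prod_def)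
    next
      case False
      show ?thesis
      proof (cases "z \<in> C")
        case True
        then have "z \<in> A e" using False closure_subset[of C] by (auto simp: A_def)
        then show ?thesis using c(2) True by simp
      next
        case nC: False
        then have "z \<in> B e" using False z closure_subset[of "\<Omega> - C"] by (auto simp: B_def)
        then show ?thesis using c(3) nC by (simp add: zero_prod_def)
      qed
    qed
    ultimately show ?thesis by blast
  qed
  define D where "D n z = (norm (?P z - (truncation (1 / Suc n) (v z), truncation' (1 / Suc n) (v z) *\<^sub>R G z)))\<^sup>2" for n :: nat and z
  have Dint: "(\<lambda>n. \<integral>z. D n z \<partial>leb_on C) \<longlonglongrightarrow> (\<integral>z. 0 \<partial>leb_on C)"
  proof (rule integral_dominated_convergence)
    \<comment> \<open>625 is the square of the constant 25 in
      \<open>truncation'_bound\<close>.\<close>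
    show "integrable (leb_on C) (\<lambda>z. 625 * (norm (?P z))\<^sup>2)" using L2C by (simp add: L2_def)
    have cont: "continuous_on UNIV (D n)" for n
    proof -
      have "continuous_on UNIV (\<lambda>z. truncation (1 / Suc n) (v z))" 
        using C1_continuous[OF C1_compose[OF v(1) truncation_deriv truncation'_continuous[of "1 / Suc n"]]] by simp
      moreover have "continuous_on UNIV (\<lambda>z. truncation' (1 / Suc n) (v z))"
        by (intro continuous_on_compose2[OF truncation'_continuous C1_continuous[OF v(1)]]) auto
      ultimately show ?thesis unfolding D_def
        using C1_continuous[OF v(1)] v(1) by (intro continuous_intros) (auto simp: has_C1_gradient_def)
    qed
    show "D n \<in> borel_measurable (leb_on C)" for n by (rule leb_on_measurable_continuous[OF cont])
    show "AE z in leb_on C. norm (D n z) \<le> 625 * (norm (?P z))\<^sup>2" for n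
    proof (rule AE_I2)
      fix z
      have "(v z - truncation (1 / Suc n) (v z))\<^sup>2 \<le> (v z)\<^sup>2"
        using truncation_bound[of "v z" "1 / Suc n"] abs_le_square_iff by blast
      also have "\<dots> \<le> 625 * (v z)\<^sup>2" by simp
      finally have 1: "(v z - truncation (1 / Suc n) (v z))\<^sup>2 \<le> 625 * (v z)\<^sup>2" .
      have "G z - truncation' (1 / Suc n) (v z) *\<^sub>R G z = (1 - truncation' (1 / Suc n) (v z)) *\<^sub>R G z" by (simp add: algebra_simps)
      then have "norm (G z - truncation' (1 / Suc n) (v z) *\<^sub>R G z) \<le> 25 * norm (G z)"
        using truncation'_bound[of "1 / Suc n" "v z"] by (simp add: mult_right_mono)
      then have 2: "(norm (G z - truncation' (1 / Suc n) (v z) *\<^sub>R G z))\<^sup>2 \<le> 625 * (norm (G z))\<^sup>2"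
        using power_mono[of _ "25 * norm (G z)" 2] by (simp add: power_mult_distrib)
      show "norm (D n z) \<le> 625 * (norm (?P z))\<^sup>2" using 1 2 by (simp add: D_def norm_Pair)
    qed
    \<comment> \<open>Where v is nonzero the truncation is eventually the identity near that value;
      where v is 0 the gradient is 0 almost everywhere, so nothing is lost by cutting it
      off.\<close>
    show "AE z in leb_on C. (\<lambda>n. D n z) \<longlonglongrightarrow> 0"
    proof -
      have "AE z in leb_on C. v z = 0 \<longrightarrow> G z = 0" using AE_gradient_zero[OF v(1)] sets(2)
        by (subst AE_restrict_space_iff) auto
      then show ?thesis
      proof eventually_elim
        case (elim z)
        show ?case
        proof (cases "v z = 0")
          case True
          then show ?thesis using elim truncation_small[of _ "v z"] by (simp add: D_def)
        next
          case False
          then have "\<bar>v z\<bar> / 2 > 0" by simp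
          then obtain N where N: "1 / Suc N < \<bar>v z\<bar> / 2" using nat_approx_posE by blast
          have "D n z = 0" if "n \<ge> N" for n
          proof -
            have "1 / real (Suc n) \<le> 1 / Suc N" using that by (simp add: frac_le)
            then have "2 * (1 / real (Suc n)) \<le> \<bar>v z\<bar>" using N by linarith
            then show ?thesis using truncation_large[of "1 / Suc n" "v z"] by (simp add: D_def)
          qed
          then show ?thesis by (intro tendsto_eventually) (auto simp: eventually_sequentially)
        qed
      qed
    qed
  qed simp
  show ?thesis
    unfolding form_domain_def
  proof (intro conjI L2E allI impI)
    fix e :: real assume "e > 0"
    then have "\<forall>\<^sub>F n in sequentially. (\<integral>z. D n z \<partial>leb_on C) < e" using Dint by (intro order_tendstoD) auto
    then obtain n where n: "(\<integral>z. D n z \<partial>leb_on C) < e" by (auto simp: eventually_sequentially)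
    obtain w H where w: "core_function {z. v z = 0} w H" 
      "\<And>z. z \<in> \<Omega> \<Longrightarrow> (w z, H z) = (if z \<in> C then (truncation (1 / Suc n) (v z), truncation' (1 / Suc n) (v z) *\<^sub>R G z) else 0)"
      using approx[of "1 / Suc n"] by (auto simp del: of_nat_Suc)
    have "(\<integral>z. (norm (?E z - (w z, H z)))\<^sup>2 \<partial>leb_on \<Omega>) = (\<integral>z. (if z \<in> C then D n z else 0) \<partial>leb_on \<Omega>)"
      using w(2) by (intro Bochner_Integration.integral_cong) (auto simp: space_restrict_space D_def)
    also have "\<dots> = (\<integral>z. D n z \<partial>leb_on C)" by (rule integral_leb_on_indicator[OF CO(1) sets(2,1)])
    finally show "\<exists>w H. core_function {z. v z = 0} w H \<and> (\<integral>z. (norm (?E z - (w z, H z)))\<^sup>2 \<partial>leb_on \<Omega>) < e"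
      using w(1) n by (intro exI[of _ w] exI[of _ H] conjI) simp_all
  qed
qed

text \<open>Extension by zero preserves L2 distances and the form domain of \<open>\<Omega>\<close>
  is closed, so core functions suffice. Vanishing is demanded only on the part of the frontier of
  \<open>C\<close> in \<open>S\<close>; the remainder lies on the boundary of
  \<open>\<Omega>\<close>, where the Neumann condition leaves functions free.\<close>

lemma component_extension:
  assumes \<Omega>: "open \<Omega>" "convex \<Omega>" "bounded \<Omega>" and S: "closed S" and C: "C \<in> components (\<Omega> - S)"
    and P: "form_domain C (S \<inter> frontier C) P"
  shows "form_domain \<Omega> {} (\<lambda>z. if z \<in> C then P z else 0)"
proof -
  have oC: "open C" using C \<Omega>(1) S by (meson open_Diff open_components)
  have CO: "C \<subseteq> \<Omega>" using in_components_subset[OF C] by auto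
  have sets: "\<Omega> \<in> sets borel" "C \<in> sets borel" using \<Omega>(1) oC by auto
  show ?thesis
  proof (rule form_domain_closed[OF \<Omega>(3) sets(1)])
    show "L2 (leb_on \<Omega>) (\<lambda>z. if z \<in> C then P z else 0)"
      using iffD2[OF L2_indicator[OF CO sets(2,1), of P] form_domain_L2[OF P]] .
    fix e :: real assume "e > 0"
    then obtain v G where v: "core_function (S \<inter> frontier C) v G" "(\<integral>z. (norm (P z - (v z, G z)))\<^sup>2 \<partial>leb_on C) < e"
      using P unfolding form_domain_def by blast
    have "form_domain \<Omega> {z. v z = 0} (\<lambda>z. if z \<in> C then (v z, G z) else 0)"
      using v(1) by (intro component_extension_core[OF \<Omega> S C]) (auto simp: core_function_def)
    then have "form_domain \<Omega> {} (\<lambda>z. if z \<in> C then (v z, G z) else 0)" by (rule form_domain_mono) simp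
    moreover have "(\<integral>z. (norm ((if z \<in> C then P z else 0) - (if z \<in> C then (v z, G z) else 0)))\<^sup>2 \<partial>leb_on \<Omega>) 
        = (\<integral>z. (if z \<in> C then (norm (P z - (v z, G z)))\<^sup>2 else 0) \<partial>leb_on \<Omega>)"
      by (intro Bochner_Integration.integral_cong) auto
    ultimately show "\<exists>Q. form_domain \<Omega> {} Q \<and> (\<integral>z. (norm ((if z \<in> C then P z else 0) - Q z))\<^sup>2 \<partial>leb_on \<Omega>) < e"
      using v(2) by (intro exI[of _ "\<lambda>z. if z \<in> C then (v z, G z) else 0"]) (simp add: integral_leb_on_indicator[OF CO sets(2,1)])
  qed
qed

section \<open>Unique continuation\<close>

lemma integrable_continuous_bounded_support:
  fixes f :: "real \<times> real \<Rightarrow> 'b::euclidean_space"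
  assumes "continuous_on UNIV f" "\<And>z. z \<notin> cbox (-R, -R) (R, R) \<Longrightarrow> f z = 0"
  shows "integrable lborel f"
proof -
  have "integrable lborel (\<lambda>x. indicator (cbox (-R, -R) (R, R)) x *\<^sub>R f x)"
    by (rule borel_integrable_compact) (auto intro: continuous_on_subset[OF assms(1)])
  also have "(\<lambda>x. indicator (cbox (-R, -R) (R, R)) x *\<^sub>R f x) = f"
    using assms(2) by (auto simp: fun_eq_iff indicator_def)
  finally show ?thesis .
qed

lemma integral_derivative_zero_1d:
  fixes f f' :: "real \<Rightarrow> real"
  assumes d: "\<And>x. (f has_real_derivative f' x) (at x)" and c: "continuous_on UNIV f'" 
    and z: "\<And>x. \<bar>x\<bar> > R \<Longrightarrow> f x = 0 \<and> f' x = 0"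
  shows "(\<integral>x. f' x \<partial>lborel) = 0"
proof -
  \<comment> \<open>The sign of \<open>R\<close> is arbitrary; this endpoint is positive and lies
    strictly outside the support.\<close>
  let ?S = "\<bar>R\<bar> + 1"
  have "(\<integral>x. f' x * indicator {- ?S..?S} x \<partial>lborel) = f ?S - f (- ?S)"
    by (rule integral_FTC_Icc_real) (use d c in \<open>auto simp: continuous_on_eq_continuous_at\<close>)
  moreover have "(\<lambda>x. f' x * indicator {- ?S..?S} x) = f'"
  proof
    fix x show "f' x * indicator {- ?S..?S} x = f' x"
    proof (cases "\<bar>x\<bar> \<le> \<bar>R\<bar>")
      case True
      then have "x \<in> {- ?S..?S}" by (simp add: abs_le_iff)
      then show ?thesis by simp
    next
      case False
      then have "\<bar>x\<bar> > R" by linarith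
      then show ?thesis using z by simp
    qed
  qed
  moreover have "f ?S = 0" "f (- ?S) = 0" using z[of ?S] z[of "- ?S"] by auto
  ultimately show ?thesis by simp
qed

text \<open>Integration by parts without boundary terms: along each line the derivative of a
  function with bounded support integrates to 0, and Fubini integrates over the lines.\<close>

lemma integral_partial_zero:
  fixes f fx fy :: "real \<times> real \<Rightarrow> real"
  assumes zf: "\<And>z. z \<notin> cbox (-R, -R) (R, R) \<Longrightarrow> f z = 0"
  shows "(\<And>x y. ((\<lambda>x. f (x, y)) has_real_derivative fx (x, y)) (at x)) \<Longrightarrow> continuous_on UNIV fx \<Longrightarrow>
      (\<And>z. z \<notin> cbox (-R, -R) (R, R) \<Longrightarrow> fx z = 0) \<Longrightarrow> integral\<^sup>L lborel fx = 0"
    and "(\<And>x y. ((\<lambda>y. f (x, y)) has_real_derivative fy (x, y)) (at y)) \<Longrightarrow> continuous_on UNIV fy \<Longrightarrow>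
      (\<And>z. z \<notin> cbox (-R, -R) (R, R) \<Longrightarrow> fy z = 0) \<Longrightarrow> integral\<^sup>L lborel fy = 0"
proof -
  assume d: "\<And>x y. ((\<lambda>x. f (x, y)) has_real_derivative fx (x, y)) (at x)" and c: "continuous_on UNIV fx"
    and z: "\<And>z. z \<notin> cbox (-R, -R) (R, R) \<Longrightarrow> fx z = 0"
  have i: "integrable (lborel \<Otimes>\<^sub>M lborel) fx"
    unfolding lborel_prod by (rule integrable_continuous_bounded_support[OF c z])
  have "(\<integral>x. fx (x, y) \<partial>lborel) = 0" for y
  proof (rule integral_derivative_zero_1d[of "\<lambda>x. f (x, y)" _ R])
    show "continuous_on UNIV (\<lambda>x. fx (x, y))" by (rule continuous_on_compose2[OF c]) (auto intro!: continuous_intros)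
    fix x :: real assume "\<bar>x\<bar> > R"
    then have "(x, y) \<notin> cbox (-R, -R) (R, R)" by (auto simp: cbox_Pair_eq)
    then show "f (x, y) = 0 \<and> fx (x, y) = 0" using z zf by blast
  qed (rule d)
  then show "integral\<^sup>L lborel fx = 0"
    using lborel_pair.integral_snd[of "\<lambda>x y. fx (x, y)"] i by (simp add: lborel_prod)
next
  assume d: "\<And>x y. ((\<lambda>y. f (x, y)) has_real_derivative fy (x, y)) (at y)" and c: "continuous_on UNIV fy"
    and z: "\<And>z. z \<notin> cbox (-R, -R) (R, R) \<Longrightarrow> fy z = 0"
  have i: "integrable (lborel \<Otimes>\<^sub>M lborel) fy"
    unfolding lborel_prod by (rule integrable_continuous_bounded_support[OF c z])
  have "(\<integral>y. fy (x, y) \<partial>lborel) = 0" for x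
  proof (rule integral_derivative_zero_1d[of "\<lambda>y. f (x, y)" _ R])
    show "continuous_on UNIV (\<lambda>y. fy (x, y))" by (rule continuous_on_compose2[OF c]) (auto intro!: continuous_intros)
    fix y :: real assume "\<bar>y\<bar> > R"
    then have "(x, y) \<notin> cbox (-R, -R) (R, R)" by (auto simp: cbox_Pair_eq)
    then show "f (x, y) = 0 \<and> fy (x, y) = 0" using z zf by blast
  qed (rule d)
  then show "integral\<^sup>L lborel fy = 0"
    using lborel_pair.integral_fst[of "\<lambda>x y. fy (x, y)"] i by (simp add: lborel_prod)
qed

lemma integral_leb_on_support:
  fixes f :: "real \<times> real \<Rightarrow> 'b::euclidean_space"
  assumes "\<Omega> \<in> sets borel" "\<And>z. z \<notin> \<Omega> \<Longrightarrow> f z = 0"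
  shows "integral\<^sup>L (leb_on \<Omega>) f = integral\<^sup>L lborel f"
proof -
  have "integral\<^sup>L (leb_on \<Omega>) f = (\<integral>z. indicator \<Omega> z *\<^sub>R f z \<partial>lborel)"
    using assms(1) by (simp add: integral_restrict_space)
  also have "(\<lambda>z. indicator \<Omega> z *\<^sub>R f z) = f" using assms(2) by (auto simp: fun_eq_iff indicator_def)
  finally show ?thesis .
qed

text \<open>Moves both derivatives onto the test function: (p, q) is the gradient of
  \<open>\<psi>\<close> and px + qy its Laplacian. The weak gradient \<open>g\<close> is removed by
  integrating by parts with the C1 approximants of u; no boundary term arises because
  \<open>\<psi>\<close> and its derivatives vanish off \<open>K\<close>.\<close>

lemma very_weak_solution:
  assumes \<Omega>: "open \<Omega>" "bounded \<Omega>" "\<Gamma> \<inter> \<Omega> = {}" and w: "weak_pair \<Omega> \<Gamma> \<mu> (\<lambda>z. (u z, g z))"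
    and psi: "has_C1_gradient \<psi> (\<lambda>z. (p z, q z))" 
    and px: "\<And>x y. ((\<lambda>x. p (x, y)) has_real_derivative px (x, y)) (at x)" "continuous_on UNIV px"
    and qy: "\<And>x y. ((\<lambda>y. q (x, y)) has_real_derivative qy (x, y)) (at y)" "continuous_on UNIV qy"
    and K: "K \<subseteq> \<Omega>" "\<And>z. z \<notin> K \<Longrightarrow> \<psi> z = 0 \<and> p z = 0 \<and> q z = 0 \<and> px z = 0 \<and> qy z = 0"
  shows "(\<integral>z. u z * (px z + qy z + \<mu> * \<psi> z) \<partial>leb_on \<Omega>) = 0"
proof -
  have sets: "\<Omega> \<in> sets borel" using \<Omega>(1) by auto
  have form_domain: "form_domain \<Omega> \<Gamma> (\<lambda>z. (u z, g z))" using w by (simp add: weak_pair_def)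
  note L = form_domain_L2[OF form_domain]
  have cpq: "continuous_on UNIV (\<lambda>z. (p z, q z))" using psi by (simp add: has_C1_gradient_def)
  have cp: "continuous_on UNIV p" and cq: "continuous_on UNIV q"
    using continuous_on_fst[OF cpq] continuous_on_snd[OF cpq] by simp_all
  have cpsi: "continuous_on UNIV \<psi>" by (rule C1_continuous[OF psi])
  obtain R where R: "\<Omega> \<subseteq> cbox (-R, -R) (R, R)"
  proof -
    obtain B where B: "\<And>z. z \<in> \<Omega> \<Longrightarrow> norm z \<le> B" using \<Omega>(2) unfolding bounded_iff by blast
    have "\<Omega> \<subseteq> cbox (-B, -B) (B, B)"
    proof
      fix z assume "z \<in> \<Omega>"
      then have "norm (fst z) \<le> B" "norm (snd z) \<le> B" using B[of z] norm_fst_le[of "fst z" "snd z"] norm_snd_le[of "snd z" "fst z"] by simp_all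
      then show "z \<in> cbox (-B, -B) (B, B)" by (cases z) (auto simp: cbox_Pair_eq)
    qed
    then show thesis by (rule that)
  qed
  have outR: "z \<notin> K" if "z \<notin> cbox (-R, -R) (R, R)" for z using that K(1) R by blast
  \<comment> \<open>The Laplacian of \<open>\<psi>\<close> paired with its gradient. The inner
    product of \<open>?W\<close> with (v, G) is the divergence of v times the gradient of
    \<open>\<psi>\<close>.\<close>
  let ?W = "\<lambda>z. (px z + qy z, (p z, q z))"
  have cW: "continuous_on UNIV ?W" by (intro continuous_intros px qy cp cq)
  have LW: "L2 (leb_on \<Omega>) ?W" by (rule L2_continuous[OF \<Omega>(2) sets cW])
  have "(\<integral>z. ?W z \<bullet> (u z, g z) \<partial>leb_on \<Omega>) = 0"
  proof (rule L2_inner_limit_zero[OF LW L])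
    fix e :: real assume "e > 0"
    then obtain v G where v: "core_function \<Gamma> v G" "(\<integral>z. (norm ((u z, g z) - (v z, G z)))\<^sup>2 \<partial>leb_on \<Omega>) < e"
      using form_domain unfolding form_domain_def by blast
    have C: "has_C1_gradient v G" using v(1) by (simp add: core_function_def)
    have cv: "continuous_on UNIV v" "continuous_on UNIV G" using C1_continuous[OF C] C by (auto simp: has_C1_gradient_def)
    have zR: "p z = 0" "q z = 0" "px z = 0" "qy z = 0" if "z \<notin> cbox (-R, -R) (R, R)" for z
      using K(2)[OF outR[OF that]] by simp_all
    have c1: "continuous_on UNIV (\<lambda>z. fst (G z) * p z + px z * v z)" 
      and c2: "continuous_on UNIV (\<lambda>z. snd (G z) * q z + qy z * v z)"
      by (intro continuous_intros cv cp cq px(2) qy(2))+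
    have 1: "integral\<^sup>L lborel (\<lambda>z. fst (G z) * p z + px z * v z) = 0"
    proof (rule integral_partial_zero(1)[where f = "\<lambda>z. v z * p z" and R = R])
      show "((\<lambda>x. v (x, y) * p (x, y)) has_real_derivative fst (G (x, y)) * p (x, y) + px (x, y) * v (x, y)) (at x)" for x y
        by (rule DERIV_mult[OF C1_slice(1)[OF C] px(1)])
    qed (use c1 zR in simp_all)
    have 2: "integral\<^sup>L lborel (\<lambda>z. snd (G z) * q z + qy z * v z) = 0"
    proof (rule integral_partial_zero(2)[where f = "\<lambda>z. v z * q z" and R = R])
      show "((\<lambda>y. v (x, y) * q (x, y)) has_real_derivative snd (G (x, y)) * q (x, y) + qy (x, y) * v (x, y)) (at y)" for x y
        by (rule DERIV_mult[OF C1_slice(2)[OF C] qy(1)])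
    qed (use c2 zR in simp_all)
    have i: "integrable lborel (\<lambda>z. fst (G z) * p z + px z * v z)" "integrable lborel (\<lambda>z. snd (G z) * q z + qy z * v z)"
      using zR by (intro integrable_continuous_bounded_support[of _ R] c1 c2; simp)+
    have "(\<integral>z. ?W z \<bullet> (v z, G z) \<partial>leb_on \<Omega>) = integral\<^sup>L lborel (\<lambda>z. ?W z \<bullet> (v z, G z))"
    proof (rule integral_leb_on_support[OF sets])
      fix z assume "z \<notin> \<Omega>"
      then have "z \<notin> K" using K(1) by blast
      from K(2)[OF this] show "?W z \<bullet> (v z, G z) = 0" by (simp add: inner_prod_def)
    qed
    also have "\<dots> = integral\<^sup>L lborel (\<lambda>z. (fst (G z) * p z + px z * v z) + (snd (G z) * q z + qy z * v z))"
      by (intro Bochner_Integration.integral_cong) (auto simp: inner_prod_def algebra_simps)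
    also have "\<dots> = 0" using 1 2 i by simp
    finally show "\<exists>h. L2 (leb_on \<Omega>) h \<and> (\<integral>z. (norm ((u z, g z) - h z))\<^sup>2 \<partial>leb_on \<Omega>) < e \<and> (\<integral>z. ?W z \<bullet> h z \<partial>leb_on \<Omega>) = 0"
      using v(2) core_pair_L2[OF \<Omega>(2) sets v(1)] by (intro exI[of _ "\<lambda>z. (v z, G z)"]) auto
  qed
  moreover have "(\<integral>z. twist \<mu> (u z, g z) \<bullet> (\<psi> z, (p z, q z)) \<partial>leb_on \<Omega>) = 0"
  proof -
    have "core_function \<Gamma> \<psi> (\<lambda>z. (p z, q z))" unfolding core_function_def
      using psi K \<Omega>(3) by blast
    then show ?thesis using w form_domain_core[OF \<Omega>(2) sets] unfolding weak_pair_def by blast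
  qed
  moreover have "integrable (leb_on \<Omega>) (\<lambda>z. ?W z \<bullet> (u z, g z))" by (rule L2_inner_integrable[OF LW L])
  moreover have "integrable (leb_on \<Omega>) (\<lambda>z. twist \<mu> (u z, g z) \<bullet> (\<psi> z, (p z, q z)))"
    by (rule L2_inner_integrable[OF L2_bounded_linear[OF bounded_linear_twist L] L2_continuous[OF \<Omega>(2) sets C1_pair_continuous[OF psi]]])
  ultimately have "(\<integral>z. ?W z \<bullet> (u z, g z) - twist \<mu> (u z, g z) \<bullet> (\<psi> z, (p z, q z)) \<partial>leb_on \<Omega>) = 0" by simp
  moreover have "(\<lambda>z. ?W z \<bullet> (u z, g z) - twist \<mu> (u z, g z) \<bullet> (\<psi> z, (p z, q z))) = (\<lambda>z. u z * (px z + qy z + \<mu> * \<psi> z))"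
    by (rule ext) (simp add: twist_def inner_prod_def algebra_simps)
  ultimately show ?thesis by simp
qed

text \<open>The homogeneous harmonic polynomials of degree n about p0. A complex coefficient covers
  real and imaginary parts at once, and the family is closed under derivatives: both partial
  derivatives lower n, and the one in y also multiplies c by the imaginary unit.\<close>

definition harmonic_poly :: "real \<times> real \<Rightarrow> complex \<Rightarrow> nat \<Rightarrow> real \<times> real \<Rightarrow> real" where
  "harmonic_poly p0 c n z = Re (c * Complex (fst z - fst p0) (snd z - snd p0) ^ n)"

lemma harmonic_poly_C1: "has_C1_gradient (harmonic_poly p0 c n) (\<lambda>z. (n * harmonic_poly p0 c (n - 1) z, n * harmonic_poly p0 (\<i> * c) (n - 1) z))"
proof -
  let ?w = "\<lambda>z :: real \<times> real. Complex (fst z - fst p0) (snd z - snd p0)"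
  have w: "(?w has_derivative (\<lambda>h. Complex (fst h) (snd h))) (at z)" for z
  proof -
    have "bounded_linear (\<lambda>h :: real \<times> real. Complex (fst h) (snd h))"
    proof -
      have "(\<lambda>h :: real \<times> real. Complex (fst h) (snd h)) = (\<lambda>h. fst h *\<^sub>R 1 + snd h *\<^sub>R \<i>)"
        by (auto simp: fun_eq_iff complex_eq_iff)
      then show ?thesis by (auto intro!: bounded_linear_add bounded_linear_scaleR_const bounded_linear_fst bounded_linear_snd)
    qed
    then have "((\<lambda>z. Complex (fst z) (snd z) - Complex (fst p0) (snd p0)) has_derivative (\<lambda>h. Complex (fst h) (snd h) - 0)) (at z)"
      by (intro has_derivative_diff bounded_linear_imp_has_derivative has_derivative_const)
    moreover have "(\<lambda>z. Complex (fst z) (snd z) - Complex (fst p0) (snd p0)) = ?w" by (auto simp: complex_eq_iff)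
    ultimately show ?thesis by simp
  qed
  have cw: "continuous_on UNIV ?w" using w by (meson continuous_at_imp_continuous_on has_derivative_continuous)
  have ch: "continuous_on UNIV (harmonic_poly p0 c n)" for c n
    unfolding harmonic_poly_def using cw by (intro continuous_intros)
  have "GDERIV (harmonic_poly p0 c n) z :> (n * harmonic_poly p0 c (n - 1) z, n * harmonic_poly p0 (\<i> * c) (n - 1) z)" for z
  proof -
    have "((\<lambda>z. ?w z ^ n) has_derivative (\<lambda>h. of_nat n * Complex (fst h) (snd h) * ?w z ^ (n - 1))) (at z)"
      by (rule has_derivative_power[OF w])
    from bounded_linear.has_derivative[OF bounded_linear_Re has_derivative_mult_right[OF this, of c]]
    have "(harmonic_poly p0 c n has_derivative (\<lambda>h. Re (c * (of_nat n * Complex (fst h) (snd h) * ?w z ^ (n - 1))))) (at z)"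
      unfolding harmonic_poly_def by simp
    moreover have "Re (c * (of_nat n * Complex (fst h) (snd h) * ?w z ^ (n - 1))) = h \<bullet> (n * harmonic_poly p0 c (n - 1) z, n * harmonic_poly p0 (\<i> * c) (n - 1) z)" for h
    proof -
      have "c * (of_nat n * Complex (fst h) (snd h) * ?w z ^ (n - 1)) = 
          of_real (real n * fst h) * (c * ?w z ^ (n - 1)) + of_real (real n * snd h) * (\<i> * c * ?w z ^ (n - 1))"
        by (simp add: Complex_eq algebra_simps)
      then show ?thesis unfolding harmonic_poly_def inner_prod_def by (simp add: algebra_simps)
    qed
    ultimately show ?thesis by (simp add: gderiv_def)
  qed
  moreover have "continuous_on UNIV (\<lambda>z. (n * harmonic_poly p0 c (n - 1) z, n * harmonic_poly p0 (\<i> * c) (n - 1) z))"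
    by (intro continuous_intros ch)
  ultimately show ?thesis by (simp add: has_C1_gradient_def)
qed

lemma harmonic_poly_continuous: "continuous_on UNIV (harmonic_poly p0 c n)"
  by (rule C1_continuous[OF harmonic_poly_C1])

text \<open>Euler's identity for homogeneous functions of degree n.\<close>

lemma harmonic_poly_euler:
  fixes n :: nat
  shows "(fst z - fst p0) * (n * harmonic_poly p0 c (n - 1) z) + (snd z - snd p0) * (n * harmonic_poly p0 (\<i> * c) (n - 1) z) = n * harmonic_poly p0 c n z"
proof (cases n)
  case (Suc m)
  have "c * Complex (fst z - fst p0) (snd z - snd p0) ^ n = of_real (fst z - fst p0) * (c * Complex (fst z - fst p0) (snd z - snd p0) ^ m)
     + of_real (snd z - snd p0) * (\<i> * c * Complex (fst z - fst p0) (snd z - snd p0) ^ m)"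
  proof -
    have "c * (Complex a b * W) = of_real a * (c * W) + of_real b * (\<i> * c * W)" for a b W
      by (simp add: Complex_eq algebra_simps)
    then show ?thesis unfolding Suc power_Suc .
  qed
  moreover have Re_re: "Re (of_real a * w) = a * Re w" for a w by simp
  ultimately have "harmonic_poly p0 c n z = (fst z - fst p0) * harmonic_poly p0 c m z + (snd z - snd p0) * harmonic_poly p0 (\<i> * c) m z"
    unfolding harmonic_poly_def by (simp only: plus_complex.sel Re_re)
  note eq = this
  have "(fst z - fst p0) * (n * harmonic_poly p0 c m z) + (snd z - snd p0) * (n * harmonic_poly p0 (\<i> * c) m z) =
      n * ((fst z - fst p0) * harmonic_poly p0 c m z + (snd z - snd p0) * harmonic_poly p0 (\<i> * c) m z)" by (simp add: algebra_simps)
  also have "\<dots> = n * harmonic_poly p0 c n z" unfolding eq ..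
  finally show ?thesis using Suc by simp
qed simp

text \<open>This is harmonicity: differentiating twice in y produces the factor of the imaginary
  unit twice, so the second derivatives in x and y are opposite.\<close>

lemma harmonic_poly_neg: "harmonic_poly p0 (\<i> * (\<i> * c)) n z = - harmonic_poly p0 c n z"
  by (simp add: harmonic_poly_def mult.assoc[symmetric])

definition sq_radius :: "real \<times> real \<Rightarrow> real \<times> real \<Rightarrow> real" where
  "sq_radius p0 z = (fst z - fst p0)\<^sup>2 + (snd z - snd p0)\<^sup>2"

lemma sq_radius_C1: "has_C1_gradient (sq_radius p0) (\<lambda>z. (2 * (fst z - fst p0), 2 * (snd z - snd p0)))"
proof -
  have "GDERIV (sq_radius p0) z :> (2 * (fst z - fst p0), 2 * (snd z - snd p0))" for z
    unfolding gderiv_def sq_radius_def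
    by (auto intro!: derivative_eq_intros simp: inner_prod_def fun_eq_iff algebra_simps)
  then show ?thesis by (auto simp: has_C1_gradient_def intro!: continuous_intros)
qed

lemma sq_radius_dist: "sq_radius p0 z = (dist p0 z)\<^sup>2"
  by (simp add: sq_radius_def dist_prod_def dist_real_def power2_commute[of "fst p0"] power2_commute[of "snd p0"])

text \<open>
  The radial test functions: \<open>\<Delta>(F(r\<^sup>2) h) = h (4 t F'' + 4 (n + 1) F')\<close> at \<open>t = r\<^sup>2\<close> for a homogeneous
  harmonic polynomial \<open>h\<close> of degree \<open>n\<close>.
\<close>

lemma radial_test:
  assumes \<Omega>: "open \<Omega>" "bounded \<Omega>" "\<Gamma> \<inter> \<Omega> = {}" and w: "weak_pair \<Omega> \<Gamma> \<mu> (\<lambda>z. (u z, g z))"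
    and F: "\<And>t. (F has_real_derivative F1 t) (at t)" "\<And>t. (F1 has_real_derivative F2 t) (at t)" "continuous_on UNIV F2"
    and T: "R > 0" "cball p0 R \<subseteq> \<Omega>" "\<And>t. t \<ge> R\<^sup>2 \<Longrightarrow> F t = 0 \<and> F1 t = 0 \<and> F2 t = 0"
  shows "(\<integral>z. u z * (harmonic_poly p0 c n z * (4 * sq_radius p0 z * F2 (sq_radius p0 z) + (4 * real n + 4) * F1 (sq_radius p0 z) + \<mu> * F (sq_radius p0 z))) \<partial>leb_on \<Omega>) = 0"
proof -
  let ?h = "harmonic_poly p0 c n" and ?hx = "\<lambda>z. n * harmonic_poly p0 c (n - 1) z" and ?hy = "\<lambda>z. n * harmonic_poly p0 (\<i> * c) (n - 1) z"
  let ?hxx = "\<lambda>z. n * (real (n - 1) * harmonic_poly p0 c (n - 1 - 1) z)" and ?r = "sq_radius p0"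
  let ?x = "\<lambda>z :: real \<times> real. fst z - fst p0" and ?y = "\<lambda>z :: real \<times> real. snd z - snd p0"
  have cF: "continuous_on UNIV F" "continuous_on UNIV F1"
    using DERIV_isCont[OF F(1)] DERIV_isCont[OF F(2)] by (simp_all add: continuous_at_imp_continuous_on)
  have cr: "continuous_on UNIV ?r" by (rule C1_continuous[OF sq_radius_C1])
  have cc: "continuous_on UNIV (\<lambda>z. F (?r z))" "continuous_on UNIV (\<lambda>z. F1 (?r z))" "continuous_on UNIV (\<lambda>z. F2 (?r z))"
    using continuous_on_compose2[OF cF(1) cr] continuous_on_compose2[OF cF(2) cr] continuous_on_compose2[OF F(3) cr] by simp_all
  define \<psi> where "\<psi> z = F (?r z) * ?h z" for z
  define p where "p z = 2 * ?x z * F1 (?r z) * ?h z + F (?r z) * ?hx z" for z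
  define q where "q z = 2 * ?y z * F1 (?r z) * ?h z + F (?r z) * ?hy z" for z
  define px where "px z = (2 * F1 (?r z) + 4 * (?x z)\<^sup>2 * F2 (?r z)) * ?h z + 4 * ?x z * F1 (?r z) * ?hx z + F (?r z) * ?hxx z" for z
  define qy where "qy z = (2 * F1 (?r z) + 4 * (?y z)\<^sup>2 * F2 (?r z)) * ?h z + 4 * ?y z * F1 (?r z) * ?hy z - F (?r z) * ?hxx z" for z
  have C: "has_C1_gradient \<psi> (\<lambda>z. (p z, q z))"
  proof -
    have "has_C1_gradient \<psi> (\<lambda>z. ?h z *\<^sub>R (F1 (?r z) *\<^sub>R (2 * ?x z, 2 * ?y z)) + F (?r z) *\<^sub>R (?hx z, ?hy z))"
      unfolding \<psi>_def by (rule C1_mult[OF C1_compose[OF sq_radius_C1 F(1) cF(2)] harmonic_poly_C1])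
    moreover have "(\<lambda>z. ?h z *\<^sub>R (F1 (?r z) *\<^sub>R (2 * ?x z, 2 * ?y z)) + F (?r z) *\<^sub>R (?hx z, ?hy z)) = (\<lambda>z. (p z, q z))"
      by (auto simp: p_def q_def fun_eq_iff)
    ultimately show ?thesis by simp
  qed
  have dF: "((\<lambda>x. F (?r (x, y))) has_real_derivative F1 (?r (x, y)) * (2 * (x - fst p0))) (at x)"
      "((\<lambda>x. F1 (?r (x, y))) has_real_derivative F2 (?r (x, y)) * (2 * (x - fst p0))) (at x)"
      "((\<lambda>y. F (?r (x, y))) has_real_derivative F1 (?r (x, y)) * (2 * (y - snd p0))) (at y)"
      "((\<lambda>y. F1 (?r (x, y))) has_real_derivative F2 (?r (x, y)) * (2 * (y - snd p0))) (at y)" for x y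
    subgoal using DERIV_chain2[OF F(1) C1_slice(1)[OF sq_radius_C1[of p0]]] by simp
    subgoal using DERIV_chain2[OF F(2) C1_slice(1)[OF sq_radius_C1[of p0]]] by simp
    subgoal using DERIV_chain2[OF F(1) C1_slice(2)[OF sq_radius_C1[of p0]]] by simp
    subgoal using DERIV_chain2[OF F(2) C1_slice(2)[OF sq_radius_C1[of p0]]] by simp
    done
  have dh: "((\<lambda>x. harmonic_poly p0 c n (x, y)) has_real_derivative n * harmonic_poly p0 c (n - 1) (x, y)) (at x)"
     "((\<lambda>y. harmonic_poly p0 c n (x, y)) has_real_derivative n * harmonic_poly p0 (\<i> * c) (n - 1) (x, y)) (at y)" for c n x y
    using C1_slice(1)[OF harmonic_poly_C1[of p0 c n]] C1_slice(2)[OF harmonic_poly_C1[of p0 c n]] by simp_all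
  have dpx: "((\<lambda>x. p (x, y)) has_real_derivative px (x, y)) (at x)" for x y
  proof -
    have "((\<lambda>x. 2 * (x - fst p0)) has_real_derivative 2) (at x)" by (auto intro!: derivative_eq_intros)
    from DERIV_add[OF DERIV_mult[OF DERIV_mult[OF this dF(2)] dh(1)] DERIV_mult[OF dF(1) DERIV_cmult[OF dh(1)[of c "n - 1"]]]]
    show ?thesis unfolding p_def px_def fst_conv snd_conv
      by (rule DERIV_cong) (simp add: power2_eq_square algebra_simps)
  qed
  have dqy: "((\<lambda>y. q (x, y)) has_real_derivative qy (x, y)) (at y)" for x y
  proof -
    have "((\<lambda>y. 2 * (y - snd p0)) has_real_derivative 2) (at y)" by (auto intro!: derivative_eq_intros)
    from DERIV_add[OF DERIV_mult[OF DERIV_mult[OF this dF(4)] dh(2)] DERIV_mult[OF dF(3) DERIV_cmult[OF dh(2)[of "\<i> * c" "n - 1"]]]]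
    show ?thesis unfolding q_def qy_def fst_conv snd_conv harmonic_poly_neg
      by (rule DERIV_cong) (simp add: power2_eq_square algebra_simps)
  qed
  have "(\<integral>z. u z * (px z + qy z + \<mu> * \<psi> z) \<partial>leb_on \<Omega>) = 0"
  proof (rule very_weak_solution[OF \<Omega> w C dpx _ dqy _ T(2)])
    show "continuous_on UNIV px" "continuous_on UNIV qy"
      unfolding px_def qy_def by (intro continuous_intros cc harmonic_poly_continuous)+
    fix z assume "z \<notin> cball p0 R"
    then have "R \<le> dist p0 z" by simp
    then have "R\<^sup>2 \<le> ?r z" using T(1) by (simp add: sq_radius_dist power_mono)
    from T(3)[OF this] show "\<psi> z = 0 \<and> p z = 0 \<and> q z = 0 \<and> px z = 0 \<and> qy z = 0"
      by (simp add: \<psi>_def p_def q_def px_def qy_def)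
  qed
  moreover have "px z + qy z + \<mu> * \<psi> z = ?h z * (4 * ?r z * F2 (?r z) + (4 * real n + 4) * F1 (?r z) + \<mu> * F (?r z))" for z
  proof -
    \<comment> \<open>The second derivatives of h cancel by harmonicity. In the next step Euler's
      identity replaces the radial derivative of h by n h, which adds 4 n to the coefficient of
      \<open>F1\<close>.\<close>
    have "px z + qy z = 4 * F1 (?r z) * ?h z + 4 * ((?x z)\<^sup>2 + (?y z)\<^sup>2) * F2 (?r z) * ?h z + 4 * F1 (?r z) * (?x z * ?hx z + ?y z * ?hy z)"
      by (simp add: px_def qy_def algebra_simps)
    also have "\<dots> = ?h z * (4 * ?r z * F2 (?r z) + (4 * real n + 4) * F1 (?r z))"
      unfolding harmonic_poly_euler by (simp add: sq_radius_def algebra_simps)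
    finally show ?thesis by (simp add: \<psi>_def algebra_simps)
  qed
  ultimately show ?thesis by (simp only:)
qed

lemma antiderivative_UNIV:
  fixes f :: "real \<Rightarrow> real"
  assumes "continuous_on UNIV f"
  shows "\<exists>F. (\<forall>t. (F has_real_derivative f t) (at t)) \<and> F c = 0"
proof -
  have "\<exists>F. \<forall>x::real. (-\<infinity>::ereal) < x \<longrightarrow> x < (\<infinity>::ereal) \<longrightarrow> (F has_vector_derivative f x) (at x)"
    by (rule einterval_antiderivative) (use assms in \<open>auto simp: continuous_on_eq_continuous_at\<close>)
  then obtain F where F: "\<And>x. (F has_real_derivative f x) (at x)"
    by (auto simp: has_real_derivative_iff_has_vector_derivative)
  have "((\<lambda>t. F t - F c) has_real_derivative f t) (at t)" for t
    using DERIV_diff[OF F[of t] DERIV_const[of "F c"]] by simp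
  then show ?thesis by (intro exI[of _ "\<lambda>t. F t - F c"]) simp
qed

lemma antiderivative_vanishes:
  fixes F f :: "real \<Rightarrow> real"
  assumes "\<And>t. (F has_real_derivative f t) (at t)" "F T = 0" "\<And>t. t \<ge> T \<Longrightarrow> f t = 0" "t \<ge> T"
  shows "F t = 0"
proof -
  have "F t = F T"
  proof (rule DERIV_isconst2[where a = T and b = "t + 1"])
    show "continuous_on {T..t + 1} F"
      using DERIV_isCont[OF assms(1)] by (intro continuous_at_imp_continuous_on) auto
    show "(F has_real_derivative 0) (at x)" if "T < x" "x < t + 1" for x using assms(1)[of x] assms(3)[of x] that by simp
  qed (use assms(4) in auto)
  then show ?thesis using assms(2) by simp
qed

text \<open>The functions C / k exp (- k s) + F s and C / k exp (- k s) - F s are nonincreasing on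
  [t, T] and nonnegative at T. Each integration thus gains a factor 1 / k, which is the source of
  the contraction below.\<close>

lemma antiderivative_exp_bound:
  fixes F f :: "real \<Rightarrow> real"
  assumes d: "\<And>t. (F has_real_derivative f t) (at t)" and FT: "F T = 0" and k: "k > 0"
    and b: "\<And>s. 0 \<le> s \<Longrightarrow> s \<le> T \<Longrightarrow> \<bar>f s\<bar> \<le> C * exp (- k * s)" and t: "0 \<le> t" "t \<le> T"
  shows "\<bar>F t\<bar> \<le> C / k * exp (- k * t)"
proof -
  have C: "C \<ge> 0"
  proof -
    have "0 \<le> C * exp (- k * t)" using b[OF t] by linarith
    then show ?thesis by (simp add: zero_le_mult_iff)
  qed
  have dk: "((\<lambda>s. C / k * exp (- k * s)) has_real_derivative - C * exp (- k * s)) (at s)" for s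
    using k by (auto intro!: derivative_eq_intros)
  have pos: "0 \<le> C / k * exp (- k * T)" using C k by simp
  have "F t + C / k * exp (- k * t) \<ge> F T + C / k * exp (- k * T)"
  proof (rule DERIV_nonpos_imp_nonincreasing[OF t(2)])
    fix s assume s: "t \<le> s" "s \<le> T"
    have "f s + - C * exp (- k * s) \<le> 0" using b[of s] s t by linarith
    then show "\<exists>y. ((\<lambda>s. F s + C / k * exp (- k * s)) has_real_derivative y) (at s) \<and> y \<le> 0"
      using DERIV_add[OF d dk] by blast
  qed
  moreover have "- F t + C / k * exp (- k * t) \<ge> - F T + C / k * exp (- k * T)"
  proof (rule DERIV_nonpos_imp_nonincreasing[OF t(2)])
    fix s assume s: "t \<le> s" "s \<le> T"
    have "- f s + - C * exp (- k * s) \<le> 0" using b[of s] s t by linarith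
    then show "\<exists>y. ((\<lambda>s. - F s + C / k * exp (- k * s)) has_real_derivative y) (at s) \<and> y \<le> 0"
      using DERIV_add[OF DERIV_minus[OF d] dk] by blast
  qed
  ultimately show ?thesis using pos FT by linarith
qed

lemma integrable_mult_bounded:
  fixes f g :: "'a \<Rightarrow> real"
  assumes "integrable M f" "g \<in> borel_measurable M" "\<And>x. x \<in> space M \<Longrightarrow> \<bar>g x\<bar> \<le> B"
  shows "integrable M (\<lambda>x. f x * g x)"
proof (rule Bochner_Integration.integrable_bound)
  show "integrable M (\<lambda>x. B * f x)" using assms(1) by simp
  show "(\<lambda>x. f x * g x) \<in> borel_measurable M" using assms by measurable
  show "AE x in M. norm (f x * g x) \<le> norm (B * f x)"
  proof (rule AE_I2)
    fix x assume "x \<in> space M"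
    from assms(3)[OF this] have "\<bar>g x\<bar> \<le> \<bar>B\<bar>" by linarith
    then show "norm (f x * g x) \<le> norm (B * f x)" by (simp add: abs_mult mult.commute[of "\<bar>B\<bar>"] mult_left_mono)
  qed
qed

text \<open>
  Solving \<open>4 t F'' = Q\<close> backwards from \<open>t = R\<^sup>2\<close> replaces \<open>Q\<close> by a Volterra integral operator applied to \<open>Q\<close>, a contraction
  in a sup norm with exponential weight; iteration makes the moment vanish.  As \<open>u\<close> vanishes near \<open>p0\<close>, the division
  by \<open>t\<close> is harmless.
\<close>

lemma radial_moment_zero:
  assumes \<Omega>: "open \<Omega>" "bounded \<Omega>" "\<Gamma> \<inter> \<Omega> = {}" and w: "weak_pair \<Omega> \<Gamma> \<mu> (\<lambda>z. (u z, g z))"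
    and R: "R > 0" "cball p0 R \<subseteq> \<Omega>" and r0: "r0 > 0" "\<And>z. z \<in> ball p0 r0 \<Longrightarrow> u z = 0"
    and Q: "continuous_on UNIV Q" "\<And>t. t \<ge> R\<^sup>2 \<Longrightarrow> Q t = 0"
  shows "(\<integral>z. u z * (harmonic_poly p0 c n z * Q (sq_radius p0 z)) \<partial>leb_on \<Omega>) = 0"
proof -
  have sets: "\<Omega> \<in> sets borel" using \<Omega>(1) by auto
  let ?h = "harmonic_poly p0 c n" and ?r = "sq_radius p0"
  define T where "T = R\<^sup>2"
  define t0 where "t0 = r0\<^sup>2"
  define A where "A Q = (\<integral>z. u z * (?h z * Q (?r z)) \<partial>leb_on \<Omega>)" for Q
  define M where "M = (\<integral>z. \<bar>u z * ?h z\<bar> \<partial>leb_on \<Omega>)"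
  \<comment> \<open>The weight is so strong that one iteration multiplies the bound for Q by at most
    1 / 2. The summand 1 makes k \<ge> 1, so that the double antiderivative obeys the same bound as
    the single one.\<close>
  define k where "k = 1 + (4 * real n + 4 + \<bar>\<mu>\<bar>) / (2 * t0)"
  have t0: "t0 > 0" using r0(1) by (simp add: t0_def)
  have k1: "k \<ge> 1" unfolding k_def using t0 by simp
  have kk: "(4 * real n + 4 + \<bar>\<mu>\<bar>) / (4 * t0 * k) \<le> 1 / 2"
  proof -
    have "4 * real n + 4 + \<bar>\<mu>\<bar> = (k - 1) * (2 * t0)" unfolding k_def using t0 by simp
    also have "\<dots> \<le> k * (2 * t0)" using t0 by (intro mult_right_mono) auto
    finally have "4 * real n + 4 + \<bar>\<mu>\<bar> \<le> 1 / 2 * (4 * t0 * k)" by (simp add: mult.commute)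
    then show ?thesis using t0 k1 by (subst pos_divide_le_eq) auto
  qed
  have Lu: "L2 (leb_on \<Omega>) u" using L2_fst[OF form_domain_L2[of \<Omega> \<Gamma>]] w unfolding weak_pair_def by fastforce
  have cr: "continuous_on UNIV ?r" by (rule C1_continuous[OF sq_radius_C1])
  have Lh: "L2 (leb_on \<Omega>) ?h" by (rule L2_continuous[OF \<Omega>(2) sets harmonic_poly_continuous])
  have iuh: "integrable (leb_on \<Omega>) (\<lambda>z. u z * ?h z)" using L2_inner_integrable[OF Lu Lh] by simp
  have r_nn: "?r z \<ge> 0" for z by (simp add: sq_radius_def)
  have M0: "M \<ge> 0" by (simp add: M_def)
  \<comment> \<open>Each iteration replaces Q by another function with the same moment and half the
    weighted bound; hence the induction runs over all Q and B. Letting j tend to infinity leaves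
    0.\<close>
  have claim: "\<bar>A Q\<bar> \<le> M * B / 2 ^ j" if "continuous_on UNIV Q" "\<And>t. t \<ge> T \<Longrightarrow> Q t = 0" 
    "\<And>t. 0 \<le> t \<Longrightarrow> t \<le> T \<Longrightarrow> \<bar>Q t\<bar> \<le> B * exp (- k * t)" for Q B j
    using that
  proof (induction j arbitrary: Q B)
    case (0 Q B)
    have T0: "T \<ge> 0" by (simp add: T_def)
    have B0: "B \<ge> 0" using 0(3)[of 0] T0 by simp
    have QB: "\<bar>Q (?r z)\<bar> \<le> B" for z
    proof (cases "?r z \<le> T")
      case True
      have "\<bar>Q (?r z)\<bar> \<le> B * exp (- k * ?r z)" using 0(3)[OF r_nn True] .
      also have "\<dots> \<le> B * 1" using B0 k1 r_nn[of z] by (intro mult_left_mono) auto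
      finally show ?thesis by simp
    qed (use 0(2) B0 in auto)
    have mQ: "(\<lambda>z. Q (?r z)) \<in> borel_measurable (leb_on \<Omega>)"
      by (rule leb_on_measurable_continuous) (use continuous_on_compose2[OF 0(1) cr] in simp)
    have i: "integrable (leb_on \<Omega>) (\<lambda>z. u z * ?h z * Q (?r z))"
      by (rule integrable_mult_bounded[OF iuh mQ QB])
    have "\<bar>A Q\<bar> = \<bar>\<integral>z. u z * ?h z * Q (?r z) \<partial>leb_on \<Omega>\<bar>" by (simp add: A_def mult.assoc)
    also have "\<dots> \<le> (\<integral>z. \<bar>u z * ?h z * Q (?r z)\<bar> \<partial>leb_on \<Omega>)" by (rule integral_abs_bound)
    also have "\<dots> \<le> (\<integral>z. B * \<bar>u z * ?h z\<bar> \<partial>leb_on \<Omega>)"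
    proof (rule integral_mono)
      show "\<bar>u z * ?h z * Q (?r z)\<bar> \<le> B * \<bar>u z * ?h z\<bar>" for z
        using QB[of z] by (simp add: abs_mult mult.commute[of B] mult_left_mono)
    qed (use i iuh in auto)
    also have "\<dots> = M * B" by (simp add: M_def)
    finally show ?case by simp
  next
    case (Suc j Q B)
    \<comment> \<open>The maximum keeps F2 continuous at 0. The intended equation 4 t F2 = Q holds
      for t \<ge> t0, which is the range of the squared radius on the set where u is
      nonzero.\<close>
    define F2 where "F2 t = Q t / (4 * max t t0)" for t
    have cF2: "continuous_on UNIV F2"
      unfolding F2_def using Suc.prems(1) t0 by (intro continuous_intros) (auto simp: max_def)
    obtain F1 where F1: "\<And>t. (F1 has_real_derivative F2 t) (at t)" "F1 T = 0" using antiderivative_UNIV[OF cF2] by blast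
    have cF1: "continuous_on UNIV F1" using DERIV_isCont[OF F1(1)] by (simp add: continuous_at_imp_continuous_on)
    obtain F where F: "\<And>t. (F has_real_derivative F1 t) (at t)" "F T = 0" using antiderivative_UNIV[OF cF1] by blast
    have cF: "continuous_on UNIV F" using DERIV_isCont[OF F(1)] by (simp add: continuous_at_imp_continuous_on)
    have z2: "F2 t = 0" if "t \<ge> T" for t using Suc.prems(2)[OF that] by (simp add: F2_def)
    have z1: "F1 t = 0" if "t \<ge> T" for t using antiderivative_vanishes[OF F1 z2 that] .
    have z0: "F t = 0" if "t \<ge> T" for t using antiderivative_vanishes[OF F z1 that] .
    \<comment> \<open>The error of solving only the leading term: for t \<ge> t0 the radial operator
      applied to F is Q - Q', and its moment is 0, so Q and Q' have equal moments.\<close>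
    define Q' where "Q' t = - ((4 * real n + 4) * F1 t + \<mu> * F t)" for t
    have b2: "\<bar>F2 t\<bar> \<le> B / (4 * t0) * exp (- k * t)" if "0 \<le> t" "t \<le> T" for t
    proof -
      have "\<bar>F2 t\<bar> = \<bar>Q t\<bar> / (4 * max t t0)" using t0 by (simp add: F2_def abs_mult)
      also have "\<dots> \<le> \<bar>Q t\<bar> / (4 * t0)" using t0 by (intro divide_left_mono) auto
      also have "\<dots> \<le> B * exp (- k * t) / (4 * t0)" using Suc.prems(3)[OF that] t0 by (intro divide_right_mono) auto
      finally show ?thesis by simp
    qed
    have b1: "\<bar>F1 t\<bar> \<le> B / (4 * t0) / k * exp (- k * t)" if "0 \<le> t" "t \<le> T" for t
      by (rule antiderivative_exp_bound[OF F1 _ b2 that]) (use k1 in auto)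
    have b0: "\<bar>F t\<bar> \<le> B / (4 * t0) / k * exp (- k * t)" if t: "0 \<le> t" "t \<le> T" for t
    proof -
      have "\<bar>F t\<bar> \<le> B / (4 * t0) / k / k * exp (- k * t)"
        by (rule antiderivative_exp_bound[OF F _ b1 t]) (use k1 in auto)
      also have "\<dots> \<le> B / (4 * t0) / k * exp (- k * t)"
      proof (rule mult_right_mono)
        have "0 \<le> B / (4 * t0) / k * exp (- k * t)" using b1[OF t] by linarith
        then have "0 \<le> B / (4 * t0) / k" 
          using mult_neg_pos[of "B / (4 * t0) / k" "exp (- k * t)"] exp_gt_zero[of "- k * t"] by (meson leD leI)
        then have "B / (4 * t0) / k / k \<le> B / (4 * t0) / k / 1" using k1 by (intro divide_left_mono) auto
        then show "B / (4 * t0) / k / k \<le> B / (4 * t0) / k" by simp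
      qed simp
      finally show ?thesis .
    qed
    have bQ: "\<bar>Q' t\<bar> \<le> B / 2 * exp (- k * t)" if t: "0 \<le> t" "t \<le> T" for t
    proof -
      let ?e = "B / (4 * t0) / k * exp (- k * t)"
      have "0 \<le> B * exp (- k * t)" using Suc.prems(3)[OF t] by linarith
      have "\<bar>Q' t\<bar> \<le> (4 * real n + 4) * \<bar>F1 t\<bar> + \<bar>\<mu>\<bar> * \<bar>F t\<bar>"
      proof -
        have "\<bar>Q' t\<bar> \<le> \<bar>(4 * real n + 4) * F1 t\<bar> + \<bar>\<mu> * F t\<bar>" unfolding Q'_def abs_minus_cancel by (rule abs_triangle_ineq)
        then show ?thesis by (simp add: abs_mult)
      qed
      also have "\<dots> \<le> (4 * real n + 4) * ?e + \<bar>\<mu>\<bar> * ?e" using b1[OF t] b0[OF t] by (intro add_mono mult_left_mono) auto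
      also have "\<dots> = (4 * real n + 4 + \<bar>\<mu>\<bar>) * ?e" by (simp only: distrib_right)
      also have "\<dots> = (4 * real n + 4 + \<bar>\<mu>\<bar>) / (4 * t0 * k) * (B * exp (- k * t))"
      proof -
        have "N * (B / (4 * t0) / k * E) = N / (4 * t0 * k) * (B * E)" for N E :: real by simp
        then show ?thesis .
      qed
      also have "\<dots> \<le> 1 / 2 * (B * exp (- k * t))" by (rule mult_right_mono[OF kk]) fact
      finally show ?thesis by simp
    qed
    have cQ': "continuous_on UNIV Q'" unfolding Q'_def by (intro continuous_intros cF cF1)
    have "\<bar>A Q'\<bar> \<le> M * (B / 2) / 2 ^ j"
      by (rule Suc.IH[OF cQ' _ bQ]) (simp add: Q'_def z1 z0)
    moreover have "A Q = A Q'"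
    proof -
      have bounded: "\<exists>B. \<forall>z\<in>\<Omega>. \<bar>f (?r z)\<bar> \<le> B" if "continuous_on UNIV f" for f :: "real \<Rightarrow> real"
      proof -
        have "compact ((\<lambda>z. f (?r z)) ` closure \<Omega>)"
          using \<Omega>(2) continuous_on_subset[OF continuous_on_compose2[OF that cr]]
          by (intro compact_continuous_image) (auto simp: compact_closure)
        from compact_imp_bounded[OF this] obtain B where B: "\<And>y. y \<in> (\<lambda>z. f (?r z)) ` closure \<Omega> \<Longrightarrow> norm y \<le> B"
          unfolding bounded_iff by blast
        have "\<bar>f (?r z)\<bar> \<le> B" if "z \<in> \<Omega>" for z
        proof -
          have "z \<in> closure \<Omega>" using that closure_subset by blast
          then have "norm (f (?r z)) \<le> B" by (intro B imageI)
          then show ?thesis by simp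
        qed
        then show ?thesis by blast
      qed
      have int: "integrable (leb_on \<Omega>) (\<lambda>z. u z * (?h z * f (?r z)))" if f: "continuous_on UNIV f" for f :: "real \<Rightarrow> real"
      proof -
        obtain B' where "\<And>z. z \<in> \<Omega> \<Longrightarrow> \<bar>f (?r z)\<bar> \<le> B'" using bounded[OF f] by blast
        then have "integrable (leb_on \<Omega>) (\<lambda>z. u z * ?h z * f (?r z))"
          using continuous_on_compose2[OF f cr]
          by (intro integrable_mult_bounded[OF iuh leb_on_measurable_continuous, of _ B']) (auto simp: space_restrict_space)
        then show ?thesis by (simp add: mult.assoc)
      qed
      have "A Q - A Q' = (\<integral>z. u z * (?h z * Q (?r z)) - u z * (?h z * Q' (?r z)) \<partial>leb_on \<Omega>)"
        unfolding A_def using int[OF Suc.prems(1)] int[OF cQ'] by simp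
      also have "\<dots> = (\<integral>z. u z * (harmonic_poly p0 c n z * (4 * sq_radius p0 z * F2 (sq_radius p0 z) + (4 * real n + 4) * F1 (sq_radius p0 z) + \<mu> * F (sq_radius p0 z))) \<partial>leb_on \<Omega>)"
      proof (rule Bochner_Integration.integral_cong)
        fix z
        show "u z * (?h z * Q (?r z)) - u z * (?h z * Q' (?r z)) = 
           u z * (harmonic_poly p0 c n z * (4 * sq_radius p0 z * F2 (sq_radius p0 z) + (4 * real n + 4) * F1 (sq_radius p0 z) + \<mu> * F (sq_radius p0 z)))"
        proof (cases "u z = 0")
          case False
          then have "r0 \<le> dist p0 z" using r0(2)[of z] by (auto simp: not_less[symmetric])
          then have "t0 \<le> ?r z" unfolding t0_def sq_radius_dist using r0(1) by (simp add: power_mono)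
          then have "4 * ?r z * F2 (?r z) = Q (?r z)" using t0 by (simp add: F2_def)
          then show ?thesis by (simp add: Q'_def algebra_simps)
        qed simp
      qed simp
      also have "\<dots> = 0"
        by (rule radial_test[OF \<Omega> w F(1) F1(1) cF2 R]) (use z2 z1 z0 in \<open>auto simp: T_def\<close>)
      finally show ?thesis by simp
    qed
    ultimately show ?case by simp
  qed
  have "compact (Q ` {0..T})" using continuous_on_subset[OF Q(1)] by (intro compact_continuous_image) auto
  from compact_imp_bounded[OF this] obtain D where D: "\<And>y. y \<in> Q ` {0..T} \<Longrightarrow> norm y \<le> D"
    unfolding bounded_iff by blast
  define B where "B = \<bar>D\<bar> * exp (k * T)"
  have "\<bar>Q t\<bar> \<le> B * exp (- k * t)" if "0 \<le> t" "t \<le> T" for t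
  proof -
    have "Q t \<in> Q ` {0..T}" using that by auto
    from D[OF this] have "\<bar>Q t\<bar> \<le> \<bar>D\<bar> * 1" by simp
    also have "\<dots> \<le> \<bar>D\<bar> * exp (k * T - k * t)" using k1 that by (intro mult_left_mono) (auto simp: mult_left_mono)
    also have "\<dots> = B * exp (- k * t)" by (simp add: B_def exp_diff exp_minus field_simps)
    finally show ?thesis .
  qed
  then have all: "\<bar>A Q\<bar> \<le> M * B / 2 ^ j" for j using claim[OF Q(1)] Q(2) unfolding T_def by blast
  have "(\<lambda>j. M * B * (1 / 2) ^ j) \<longlonglongrightarrow> M * B * 0" by (intro tendsto_mult_left LIMSEQ_realpow_zero) auto
  moreover have "(\<lambda>j. M * B * (1 / 2) ^ j) = (\<lambda>j. M * B / 2 ^ j)" by (simp add: power_one_over)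
  ultimately have lim: "(\<lambda>j. M * B / 2 ^ j) \<longlonglongrightarrow> 0" by simp
  have "\<bar>A Q\<bar> \<le> 0" by (rule LIMSEQ_le_const[OF lim]) (use all in blast)
  then show ?thesis by (simp add: A_def)
qed

text \<open>
  With \<open>w = x + i y - p0\<close>, the monomial \<open>w\<^sup>a (cnj w)\<^sup>b\<close> is a power of \<open>r\<^sup>2\<close> times a power of \<open>w\<close> or \<open>cnj w\<close>, so that
  its moments are radial moments against a homogeneous harmonic polynomial.
\<close>

inductive wpoly :: "real \<times> real \<Rightarrow> (real \<times> real \<Rightarrow> complex) \<Rightarrow> bool" for p0 where
  mono: "wpoly p0 (\<lambda>z. c * Complex (fst z - fst p0) (snd z - snd p0) ^ a * cnj (Complex (fst z - fst p0) (snd z - snd p0)) ^ b)"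
| add: "wpoly p0 f \<Longrightarrow> wpoly p0 g \<Longrightarrow> wpoly p0 (\<lambda>z. f z + g z)"

lemma wpoly_mult:
  assumes "wpoly p0 f" "wpoly p0 g"
  shows "wpoly p0 (\<lambda>z. f z * g z)"
  using assms
proof (induction rule: wpoly.induct)
  case (mono c a b)
  from mono.prems show ?case
  proof (induction rule: wpoly.induct)
    case (mono d a' b')
    have "(\<lambda>z. c * Complex (fst z - fst p0) (snd z - snd p0) ^ a * cnj (Complex (fst z - fst p0) (snd z - snd p0)) ^ b * 
       (d * Complex (fst z - fst p0) (snd z - snd p0) ^ a' * cnj (Complex (fst z - fst p0) (snd z - snd p0)) ^ b')) =
       (\<lambda>z. (c * d) * Complex (fst z - fst p0) (snd z - snd p0) ^ (a + a') * cnj (Complex (fst z - fst p0) (snd z - snd p0)) ^ (b + b'))"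
      by (rule ext) (simp only: power_add ac_simps)
    then show ?case using wpoly.mono by simp
  next
    case (add f g)
    then show ?case unfolding distrib_left by (intro wpoly.add)
  qed
next
  case (add f1 f2)
  then show ?case unfolding distrib_right by (intro wpoly.add) auto
qed

lemma wpoly_const: "wpoly p0 (\<lambda>z. c)"
  using wpoly.mono[of p0 c 0 0] by simp

lemma wpoly_real_polynomial:
  fixes p :: "real \<times> real \<Rightarrow> real"
  assumes "real_polynomial_function p"
  shows "wpoly p0 (\<lambda>z. of_real (p z))"
  using assms
proof (induction rule: real_polynomial_function.induct)
  case (linear f)
  let ?w = "\<lambda>z :: real \<times> real. Complex (fst z - fst p0) (snd z - snd p0)"
  have f: "f h = fst h * f (1, 0) + snd h * f (0, 1)" for h
  proof -
    have "f h = f (fst h *\<^sub>R (1, 0) + snd h *\<^sub>R (0, 1))" by simp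
    also have "\<dots> = fst h *\<^sub>R f (1, 0) + snd h *\<^sub>R f (0, 1)"
      using linear by (simp only: linear_add[OF bounded_linear.linear] linear_scale[OF bounded_linear.linear])
    finally show ?thesis by simp
  qed
  \<comment> \<open>With this coefficient, twice the real part of c w is the linear part of f in
    coordinates centred at p0.\<close>
  let ?c = "Complex (f (1, 0) / 2) (- f (0, 1) / 2)"
  have "wpoly p0 (\<lambda>z. (?c * ?w z ^ 1 * cnj (?w z) ^ 0 + cnj ?c * ?w z ^ 0 * cnj (?w z) ^ 1) + of_real (f p0))"
    by (intro wpoly.intros wpoly_const)
  moreover have "(?c * ?w z ^ 1 * cnj (?w z) ^ 0 + cnj ?c * ?w z ^ 0 * cnj (?w z) ^ 1) + of_real (f p0) = of_real (f z)" for z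
    unfolding f[of z] f[of p0] by (simp add: complex_eq_iff field_simps)
  ultimately show ?case by simp
next
  case (const c) show ?case by (rule wpoly_const)
next
  case (add f g) then show ?case using wpoly.add by fastforce
next
  case (mult f g) then show ?case using wpoly_mult by fastforce
qed

lemma wpoly_continuous: "wpoly p0 f \<Longrightarrow> continuous_on UNIV f"
  by (induction rule: wpoly.induct)
     (auto intro!: continuous_intros continuous_on_Complex simp: continuous_on_cnj)

text \<open>The weight is radial, positive inside the ball and zero outside, so it can be absorbed
  into the radial factor Q together with the common power of w and its conjugate.\<close>

lemma wpoly_moment_zero:
  assumes \<Omega>: "open \<Omega>" "bounded \<Omega>" "\<Gamma> \<inter> \<Omega> = {}" and w: "weak_pair \<Omega> \<Gamma> \<mu> (\<lambda>z. (u z, g z))"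
    and R: "R > 0" "cball p0 R \<subseteq> \<Omega>" and r0: "r0 > 0" "\<And>z. z \<in> ball p0 r0 \<Longrightarrow> u z = 0"
    and f: "wpoly p0 f"
  shows "(\<integral>z. u z * (Re (f z) * max 0 (R\<^sup>2 - sq_radius p0 z)) \<partial>leb_on \<Omega>) = 0"
  using f
proof (induction rule: wpoly.induct)
  case (mono c a b)
  let ?w = "\<lambda>z :: real \<times> real. Complex (fst z - fst p0) (snd z - snd p0)"
  have ww: "?w z * cnj (?w z) = of_real (sq_radius p0 z)" for z
    by (simp add: complex_eq_iff sq_radius_def power2_eq_square algebra_simps)
  define d where "d = min a b"
  define Q where "Q t = t ^ d * max 0 (R\<^sup>2 - t)" for t
  have Q: "continuous_on UNIV Q" "\<And>t. t \<ge> R\<^sup>2 \<Longrightarrow> Q t = 0" unfolding Q_def by (auto intro!: continuous_intros)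
  show ?case
  proof (cases "b \<le> a")
    case True
    have "Re (c * ?w z ^ a * cnj (?w z) ^ b) * max 0 (R\<^sup>2 - sq_radius p0 z) = harmonic_poly p0 c (a - b) z * Q (sq_radius p0 z)" for z
    proof -
      have "c * ?w z ^ a * cnj (?w z) ^ b = c * ?w z ^ (a - b) * (?w z * cnj (?w z)) ^ b"
        using True by (simp add: power_mult_distrib mult.assoc flip: power_add)
      also have "\<dots> = of_real (sq_radius p0 z ^ b) * (c * ?w z ^ (a - b))" unfolding ww by simp
      finally have re: "Re (c * ?w z ^ a * cnj (?w z) ^ b) = sq_radius p0 z ^ b * harmonic_poly p0 c (a - b) z"
        by (simp only: harmonic_poly_def Re_complex_of_real complex_scaleR[symmetric] scaleR_conv_of_real[symmetric] scaleR_complex.sel)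
      show ?thesis unfolding re using True by (simp add: Q_def d_def min_absorb2)
    qed
    then show ?thesis using radial_moment_zero[OF \<Omega> w R r0 Q, of c "a - b"] by simp
  next
    case False
    have "Re (c * ?w z ^ a * cnj (?w z) ^ b) * max 0 (R\<^sup>2 - sq_radius p0 z) = harmonic_poly p0 (cnj c) (b - a) z * Q (sq_radius p0 z)" for z
    proof -
      \<comment> \<open>Conjugation leaves the real part unchanged and makes the exponent of w the
        larger one.\<close>
      have "cnj (c * ?w z ^ a * cnj (?w z) ^ b) = cnj c * ?w z ^ (b - a) * (?w z * cnj (?w z)) ^ a"
        using False by (simp add: power_mult_distrib mult.assoc mult.left_commute flip: power_add)
      also have "\<dots> = of_real (sq_radius p0 z ^ a) * (cnj c * ?w z ^ (b - a))" unfolding ww by simp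
      finally have "Re (cnj (c * ?w z ^ a * cnj (?w z) ^ b)) = sq_radius p0 z ^ a * harmonic_poly p0 (cnj c) (b - a) z"
        by (simp only: harmonic_poly_def Re_complex_of_real complex_scaleR[symmetric] scaleR_conv_of_real[symmetric] scaleR_complex.sel)
      then have re: "Re (c * ?w z ^ a * cnj (?w z) ^ b) = sq_radius p0 z ^ a * harmonic_poly p0 (cnj c) (b - a) z" by (simp only: cnj.sel(1))
      show ?thesis unfolding re using False by (simp add: Q_def d_def min_absorb1)
    qed
    then show ?thesis using radial_moment_zero[OF \<Omega> w R r0 Q, of "cnj c" "b - a"] by simp
  qed
next
  case (add f1 f2)
  have sets: "\<Omega> \<in> sets borel" using \<Omega>(1) by auto
  have Lu: "L2 (leb_on \<Omega>) u" using L2_fst[OF form_domain_L2[of \<Omega> \<Gamma>]] w unfolding weak_pair_def by fastforce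
  have i: "integrable (leb_on \<Omega>) (\<lambda>z. u z * (Re (f z) * max 0 (R\<^sup>2 - sq_radius p0 z)))" if "wpoly p0 f" for f
  proof -
    have "continuous_on UNIV (\<lambda>z. Re (f z) * max 0 (R\<^sup>2 - sq_radius p0 z))"
      by (intro continuous_intros wpoly_continuous[OF that] C1_continuous[OF sq_radius_C1])
    from L2_inner_integrable[OF Lu L2_continuous[OF \<Omega>(2) sets this]] show ?thesis by simp
  qed
  show ?case using add.IH i[OF add.hyps(1)] i[OF add.hyps(2)] by (simp add: distrib_left distrib_right)
qed

text \<open>The points of \<open>W\<close> where f is nonzero form an open null set, and such a set
  is empty.\<close>

lemma AE_zero_continuous:
  fixes f :: "real \<times> real \<Rightarrow> real"
  assumes "open W" "continuous_on W f" "AE z in lborel. z \<in> W \<longrightarrow> f z = 0" "z \<in> W"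
  shows "f z = 0"
proof (rule ccontr)
  assume nz: "f z \<noteq> 0"
  let ?V = "W \<inter> f -` (- {0})"
  have oV: "open ?V" using continuous_open_preimage[OF assms(2,1), of "- {0}"] by (simp add: open_Compl)
  have "AE z in lborel. z \<notin> ?V" using assms(3) by eventually_elim auto
  then have "?V \<in> null_sets lborel" using oV by (intro iffD2[OF AE_iff_null_sets]) auto
  then have "negligible ?V" by (simp add: negligible_iff_null_sets null_sets_completionI)
  then have "?V = {}" using open_not_negligible[OF oV] by blast
  then show False using nz assms(4) by auto
qed

text \<open>Polynomials approximate u uniformly on the closed ball and have vanishing weighted
  moments against u, so the weighted integral of the square of u is 0. The radius r0 of the known
  zero disc may be arbitrarily small compared with R; this is what makes zeros spread.\<close>

lemma solution_vanishes_on_ball: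
  assumes \<Omega>: "open \<Omega>" "bounded \<Omega>" "\<Gamma> \<inter> \<Omega> = {}" and w: "weak_pair \<Omega> \<Gamma> \<mu> (\<lambda>z. (u z, g z))"
    and cu: "continuous_on \<Omega> u"
    and R: "R > 0" "cball p0 R \<subseteq> \<Omega>" and r0: "r0 > 0" "\<And>z. z \<in> ball p0 r0 \<Longrightarrow> u z = 0"
    and z: "z \<in> ball p0 R"
  shows "u z = 0"
proof -
  let ?k = "\<lambda>z. max 0 (R\<^sup>2 - sq_radius p0 z)"
  have sets: "\<Omega> \<in> sets borel" using \<Omega>(1) by auto
  have Lu: "L2 (leb_on \<Omega>) u" using L2_fst[OF form_domain_L2[of \<Omega> \<Gamma>]] w unfolding weak_pair_def by fastforce
  have ck: "continuous_on UNIV ?k" by (intro continuous_intros C1_continuous[OF sq_radius_C1])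
  have Lk: "L2 (leb_on \<Omega>) ?k" by (rule L2_continuous[OF \<Omega>(2) sets ck])
  have kz: "?k z = 0" if "z \<notin> cball p0 R" for z
  proof -
    have "R\<^sup>2 \<le> (dist p0 z)\<^sup>2" using that R(1) by (intro power_mono) auto
    then show ?thesis by (simp add: sq_radius_dist)
  qed
  have mu: "u \<in> borel_measurable (leb_on \<Omega>)" by (rule L2_measurable[OF Lu])
  have iuk: "integrable (leb_on \<Omega>) (\<lambda>z. u z * ?k z)" using L2_inner_integrable[OF Lu Lk] by simp
  have "compact (u ` cball p0 R)" using cu R(2) by (intro compact_continuous_image continuous_on_subset[OF cu]) auto
  from compact_imp_bounded[OF this] obtain D where D: "\<And>y. y \<in> u ` cball p0 R \<Longrightarrow> norm y \<le> D"
    unfolding bounded_iff by blast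
  have iuuk: "integrable (leb_on \<Omega>) (\<lambda>z. u z * (u z * ?k z))"
  proof -
    \<comment> \<open>A bound for u is known on the closed ball only, so one factor is cut off
      there; the weight vanishes elsewhere anyway.\<close>
    define v where "v z = (if z \<in> cball p0 R then u z else 0)" for z
    have "cball p0 R \<inter> \<Omega> \<in> sets (leb_on \<Omega>)" using sets by (auto simp: sets_restrict_space)
    then have "v \<in> borel_measurable (leb_on \<Omega>)" unfolding v_def using R(2)
      by (intro measurable_If_set mu) (auto simp: space_restrict_space)
    moreover have "\<bar>v z\<bar> \<le> \<bar>D\<bar>" for z using D[of "u z"] by (auto simp: v_def)
    ultimately have "integrable (leb_on \<Omega>) (\<lambda>z. u z * ?k z * v z)" by (intro integrable_mult_bounded[OF iuk])
    moreover have "(\<lambda>z. u z * ?k z * v z) = (\<lambda>z. u z * (u z * ?k z))" using kz by (auto simp: v_def fun_eq_iff)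
    ultimately show ?thesis by simp
  qed
  let ?M = "\<integral>z. \<bar>u z * ?k z\<bar> \<partial>leb_on \<Omega>"
  have le: "(\<integral>z. u z * (u z * ?k z) \<partial>leb_on \<Omega>) \<le> e * ?M" if e: "e > 0" for e
  proof -
    obtain p where p: "real_polynomial_function p" "\<And>z. z \<in> cball p0 R \<Longrightarrow> \<bar>u z - p z\<bar> < e"
      using Stone_Weierstrass_real_polynomial_function[of "cball p0 R" u e] continuous_on_subset[OF cu R(2)] e by auto
    have "wpoly p0 (\<lambda>z. of_real (p z))" by (rule wpoly_real_polynomial[OF p(1)])
    from wpoly_moment_zero[OF \<Omega> w R r0 this] have 0: "(\<integral>z. u z * (p z * ?k z) \<partial>leb_on \<Omega>) = 0" by simp
    have cp: "continuous_on UNIV p" using real_polynomial_C1[OF p(1)] C1_continuous by blast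
    have ip: "integrable (leb_on \<Omega>) (\<lambda>z. u z * (p z * ?k z))"
      using L2_inner_integrable[OF Lu L2_continuous[OF \<Omega>(2) sets continuous_on_mult[OF cp ck]]] by simp
    have "(\<integral>z. u z * (u z * ?k z) \<partial>leb_on \<Omega>) = (\<integral>z. u z * (u z * ?k z) - u z * (p z * ?k z) \<partial>leb_on \<Omega>)"
      using 0 ip iuuk by simp
    also have "\<dots> \<le> (\<integral>z. e * \<bar>u z * ?k z\<bar> \<partial>leb_on \<Omega>)"
    proof (rule integral_mono)
      show "integrable (leb_on \<Omega>) (\<lambda>z. u z * (u z * ?k z) - u z * (p z * ?k z))" using ip iuuk by simp
      show "integrable (leb_on \<Omega>) (\<lambda>z. e * \<bar>u z * ?k z\<bar>)" using iuk by simp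
      fix z
      show "u z * (u z * ?k z) - u z * (p z * ?k z) \<le> e * \<bar>u z * ?k z\<bar>"
      proof (cases "z \<in> cball p0 R")
        case True
        have "u z * (u z * ?k z) - u z * (p z * ?k z) = (u z - p z) * (u z * ?k z)" by (simp add: algebra_simps)
        also have "\<dots> \<le> \<bar>u z - p z\<bar> * \<bar>u z * ?k z\<bar>" by (metis abs_ge_self abs_mult)
        also have "\<dots> \<le> e * \<bar>u z * ?k z\<bar>" using p(2)[OF True] by (intro mult_right_mono) auto
        finally show ?thesis .
      qed (simp add: kz)
    qed
    also have "\<dots> = e * ?M" by simp
    finally show ?thesis .
  qed
  have M0: "?M \<ge> 0" by simp
  then have M1: "?M + 1 > 0" by linarith
  have nn: "0 \<le> u z * (u z * ?k z)" for z by (simp add: mult.assoc[symmetric])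
  have "(\<integral>z. u z * (u z * ?k z) \<partial>leb_on \<Omega>) \<le> 0 + e" if "e > 0" for e
  proof -
    have "(\<integral>z. u z * (u z * ?k z) \<partial>leb_on \<Omega>) \<le> e / (?M + 1) * ?M" using that M1 by (intro le divide_pos_pos)
    also have "\<dots> \<le> e" 
    proof -
      have "e / (?M + 1) * ?M \<le> e / (?M + 1) * (?M + 1)" using that M1 by (intro mult_left_mono) auto
      also have "\<dots> = e" using M1 by simp
      finally show ?thesis .
    qed
    finally show ?thesis by simp
  qed
  then have "(\<integral>z. u z * (u z * ?k z) \<partial>leb_on \<Omega>) \<le> 0" by (rule field_le_epsilon)
  moreover have "0 \<le> (\<integral>z. u z * (u z * ?k z) \<partial>leb_on \<Omega>)" using nn by (intro integral_nonneg_AE) auto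
  ultimately have "AE z in leb_on \<Omega>. u z * (u z * ?k z) = 0"
    using integral_nonneg_eq_0_iff_AE[OF iuuk] nn by auto
  then have "AE z in lborel. z \<in> \<Omega> \<longrightarrow> u z * (u z * ?k z) = 0" using sets by (subst (asm) AE_restrict_space_iff) auto
  then have ae: "AE z in lborel. z \<in> ball p0 R \<longrightarrow> u z * (u z * ?k z) = 0"
    by eventually_elim (use R(2) ball_subset_cball in blast)
  have "u z * (u z * ?k z) = 0"
  proof (rule AE_zero_continuous[OF open_ball _ ae z])
    have "continuous_on (ball p0 R) u" using R(2) ball_subset_cball by (intro continuous_on_subset[OF cu]) blast
    then show "continuous_on (ball p0 R) (\<lambda>z. u z * (u z * ?k z))"
      by (intro continuous_intros continuous_on_subset[OF ck] continuous_on_subset[OF C1_continuous[OF sq_radius_C1]]) auto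
  qed
  moreover have "?k z > 0"
  proof -
    have "(dist p0 z)\<^sup>2 < R\<^sup>2" using z by (intro power_strict_mono) auto
    then show ?thesis by (simp add: sq_radius_dist)
  qed
  ultimately show ?thesis by (metis less_irrefl mult_eq_0_iff)
qed

text \<open>The interior of the zero set is also relatively closed in \<open>\<Omega>\<close>: near
  a limit point of it, a ball about a point p0 of that interior swallows the limit point, and u
  vanishes on the whole ball.\<close>

theorem unique_continuation:
  assumes \<Omega>: "open \<Omega>" "bounded \<Omega>" "\<Gamma> \<inter> \<Omega> = {}" "connected \<Omega>" and u: "u \<in> eigenspace \<Omega> \<Gamma> \<mu>"
    and W: "open W" "W \<noteq> {}" "W \<subseteq> \<Omega>" "\<And>z. z \<in> W \<Longrightarrow> u z = 0"
  shows "u = 0"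
proof -
  have sets: "\<Omega> \<in> sets borel" using \<Omega>(1) by auto
  have cu: "continuous_on \<Omega> u" and off: "\<And>z. z \<notin> \<Omega> \<Longrightarrow> u z = 0" using u by (auto simp: eigenspace_def)
  obtain g where w: "weak_pair \<Omega> \<Gamma> \<mu> (\<lambda>z. (u z, g z))"
    using u unfolding eigenspace_def weak_iff[OF \<Omega>(2) sets] by blast
  define Z where "Z = interior {z \<in> \<Omega>. u z = 0}"
  have oZ: "open Z" by (simp add: Z_def)
  have ZO: "Z \<subseteq> \<Omega>" using interior_subset[of "{z \<in> \<Omega>. u z = 0}"] by (auto simp: Z_def)
  have Zu: "u z = 0" if "z \<in> Z" for z using interior_subset[of "{z \<in> \<Omega>. u z = 0}"] that by (auto simp: Z_def)
  have "W \<subseteq> Z" unfolding Z_def using W by (intro interior_maximal) auto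
  then have Zne: "Z \<noteq> {}" using W(2) by auto
  have "\<Omega> - Z = \<Omega> - closure Z"
  proof -
    have "z \<in> Z" if z: "z \<in> \<Omega>" "z \<in> closure Z" for z
    proof -
      obtain r where r: "r > 0" "ball z r \<subseteq> \<Omega>" using \<Omega>(1) z(1) open_contains_ball by blast
      \<comment> \<open>The ball of radius R about a point at distance less than R from z contains z
        and stays within 2 R < r of it.\<close>
      define R where "R = r / 3"
      have R: "R > 0" using r(1) by (simp add: R_def)
      obtain p0 where p0: "p0 \<in> Z" "dist p0 z < R" using z(2) R unfolding closure_approachable by blast
      obtain r0 where r0: "r0 > 0" "ball p0 r0 \<subseteq> Z" using oZ p0(1) open_contains_ball by blast
      have sub: "cball p0 R \<subseteq> \<Omega>"
      proof
        fix y assume "y \<in> cball p0 R"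
        then have "dist z y < r" using p0(2) R dist_triangle[of z y p0] by (simp add: R_def dist_commute)
        then show "y \<in> \<Omega>" using r(2) by auto
      qed
      have "u y = 0" if "y \<in> ball p0 R" for y
        by (rule solution_vanishes_on_ball[OF \<Omega>(1-3) w cu R sub r0(1) _ that]) (use r0(2) Zu in blast)
      then have "ball p0 R \<subseteq> {z \<in> \<Omega>. u z = 0}" using sub by auto
      then have "ball p0 R \<subseteq> Z" unfolding Z_def by (intro interior_maximal) auto
      then show "z \<in> Z" using p0(2) by auto
    qed
    then show ?thesis using closure_subset[of Z] by auto
  qed
  then have "open (\<Omega> - Z)" using \<Omega>(1) by (simp add: open_Diff)
  then have "\<Omega> - Z = {}"
    using connectedD[OF \<Omega>(4) oZ, of "\<Omega> - Z"] Zne ZO by auto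
  then have "u z = 0" for z using Zu off by blast
  then show ?thesis by (simp add: fun_eq_iff)
qed

section \<open>Cosine modes on the triangle\<close>

definition phi :: "nat \<Rightarrow> nat \<Rightarrow> real \<times> real \<Rightarrow> real" where
  "phi m n z = cos (m * fst z) * cos (n * snd z) + cos (m * snd z) * cos (n * fst z)"

definition grad_phi :: "nat \<Rightarrow> nat \<Rightarrow> real \<times> real \<Rightarrow> real \<times> real" where
  "grad_phi m n z = (- (m * (sin (m * fst z) * cos (n * snd z))) - n * (cos (m * snd z) * sin (n * fst z)),
     - (n * (cos (m * fst z) * sin (n * snd z))) - m * (sin (m * snd z) * cos (n * fst z)))"

lemma phi_C1: "has_C1_gradient (phi m n) (grad_phi m n)"
proof -
  have "GDERIV (phi m n) z :> grad_phi m n z" for z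
    unfolding gderiv_def phi_def grad_phi_def
    by (auto intro!: derivative_eq_intros simp: inner_prod_def fun_eq_iff algebra_simps)
  then show ?thesis unfolding has_C1_gradient_def grad_phi_def by (auto intro!: continuous_intros)
qed

lemma phi_continuous: "continuous_on UNIV (phi m n)"
  by (rule C1_continuous[OF phi_C1])

abbreviation open_triangle :: "(real \<times> real) set" where
  "open_triangle \<equiv> {z. 0 < snd z \<and> snd z < fst z \<and> fst z < pi}"

lemma interior_iso_triangle: "interior iso_triangle = open_triangle"
proof -
  have eq: "iso_triangle = {z. inner (0, -1) z \<le> 0} \<inter> {z. inner (-1, 1) z \<le> 0} \<inter> {z. inner (1, 0) z \<le> pi}"
    by (auto simp: iso_triangle_def inner_prod_def)
  have "interior iso_triangle = {z. inner (0, -1) z < 0} \<inter> {z. inner (-1, 1) z < 0} \<inter> {z. inner (1, 0) z < pi}"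
    unfolding eq interior_Int by (simp add: interior_halfspace_le zero_prod_def)
  also have "\<dots> = open_triangle" by (auto simp: inner_prod_def)
  finally show ?thesis .
qed

lemma open_triangle_open: "open open_triangle"
  unfolding interior_iso_triangle[symmetric] by simp

lemma open_triangle_bounded: "bounded open_triangle"
proof -
  have "open_triangle \<subseteq> cbox (0, 0) (pi, pi)" by (auto simp: cbox_Pair_eq)
  then show ?thesis using bounded_cbox bounded_subset by blast
qed

lemma open_triangle_convex: "convex open_triangle"
proof -
  have eq: "open_triangle = {z. inner (0, -1) z < 0} \<inter> {z. inner (-1, 1) z < 0} \<inter> {z. inner (1, 0) z < pi}"
    by (auto simp: inner_prod_def)
  show ?thesis unfolding eq by (intro convex_Int convex_halfspace_lt)
qed

lemma open_triangle_sets: "open_triangle \<in> sets borel"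
  using open_triangle_open by auto

lemma integrable_leb_on_continuous:
  fixes f :: "real \<times> real \<Rightarrow> real"
  assumes "bounded \<Omega>" "\<Omega> \<in> sets borel" "continuous_on UNIV f"
  shows "integrable (leb_on \<Omega>) f"
  using L2_inner_integrable[OF L2_continuous[OF assms] L2_continuous[OF assms(1,2), of "\<lambda>_. 1"]] by simp

lemma integral_FTC_open:
  fixes F f :: "real \<Rightarrow> real"
  assumes "a \<le> b" "\<And>x. (F has_real_derivative f x) (at x)" "continuous_on UNIV f"
  shows "(\<integral>x. indicator {a<..<b} x * f x \<partial>lborel) = F b - F a"
proof -
  have "(LBINT x=a..b. f x) = F b - F a"
    by (rule interval_integral_FTC_finite)
       (use assms(2) continuous_on_subset[OF assms(3)] in \<open>auto intro: has_vector_derivative_at_within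
         simp: has_real_derivative_iff_has_vector_derivative\<close>)
  then show ?thesis using assms(1) by (simp add: interval_lebesgue_integral_def set_lebesgue_integral_def)
qed

text \<open>The divergence theorem for a field without flux through the three sides; on the
  hypotenuse the normal is proportional to (1, -1), hence the condition X = Y there. The two
  iterated integrals reduce to opposite integrals along the diagonal.\<close>

lemma open_triangle_divergence:
  fixes X Y Xx Yy :: "real \<times> real \<Rightarrow> real"
  assumes X: "\<And>x y. ((\<lambda>x. X (x, y)) has_real_derivative Xx (x, y)) (at x)" "continuous_on UNIV Xx"
    and Y: "\<And>x y. ((\<lambda>y. Y (x, y)) has_real_derivative Yy (x, y)) (at y)" "continuous_on UNIV Yy"
    and bd: "\<And>y. X (pi, y) = 0" "\<And>x. Y (x, 0) = 0" "\<And>t. X (t, t) = Y (t, t)"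
  shows "(\<integral>z. Xx z + Yy z \<partial>leb_on open_triangle) = 0"
proof -
  have ind: "indicator open_triangle (x, y) = (indicator {0<..<pi} y * indicator {y<..<pi} x :: real)"
     "indicator open_triangle (x, y) = (indicator {0<..<pi} x * indicator {0<..<x} y :: real)" for x y :: real
    by (auto simp: indicator_def)
  have ic: "integrable (lborel \<Otimes>\<^sub>M lborel) (\<lambda>(x, y). indicator open_triangle (x, y) * f (x, y))" if "continuous_on UNIV f" for f :: "real \<times> real \<Rightarrow> real"
    using integrable_leb_on_continuous[OF open_triangle_bounded open_triangle_sets that] open_triangle_sets
    by (simp add: integrable_restrict_space lborel_prod case_prod_unfold)
  have il: "(\<integral>z. f z \<partial>leb_on open_triangle) = (\<integral>z. indicator open_triangle z * f z \<partial>lborel)" for f :: "real \<times> real \<Rightarrow> real"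
    using open_triangle_sets by (simp add: integral_restrict_space)
  have "(\<integral>z. Xx z \<partial>leb_on open_triangle) = (\<integral>y. (\<integral>x. indicator open_triangle (x, y) * Xx (x, y) \<partial>lborel) \<partial>lborel)"
    using lborel_pair.integral_snd[OF ic[OF X(2)]] unfolding il lborel_prod by (simp add: case_prod_unfold)
  also have "\<dots> = (\<integral>y. indicator {0<..<pi} y * - X (y, y) \<partial>lborel)"
  proof (rule Bochner_Integration.integral_cong)
    fix y :: real
    show "(\<integral>x. indicator open_triangle (x, y) * Xx (x, y) \<partial>lborel) = indicator {0<..<pi} y * - X (y, y)"
    proof (cases "y \<in> {0<..<pi}")
      case True
      have "(\<integral>x. indicator {y<..<pi} x * Xx (x, y) \<partial>lborel) = X (pi, y) - X (y, y)"
        by (rule integral_FTC_open[where F = "\<lambda>x. X (x, y)"])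
           (use True X(1) in \<open>auto intro!: continuous_on_compose2[OF X(2)] continuous_intros\<close>)
      then show ?thesis using True bd(1) unfolding ind(1) by simp
    next
      case False
      then show ?thesis unfolding ind(1) by (simp del: greaterThanLessThan_iff)
    qed
  qed simp
  also have "\<dots> = - (\<integral>y. indicator {0<..<pi} y * X (y, y) \<partial>lborel)" by simp
  finally have 1: "(\<integral>z. Xx z \<partial>leb_on open_triangle) = - (\<integral>y. indicator {0<..<pi} y * X (y, y) \<partial>lborel)" .
  have "(\<integral>z. Yy z \<partial>leb_on open_triangle) = (\<integral>x. (\<integral>y. indicator open_triangle (x, y) * Yy (x, y) \<partial>lborel) \<partial>lborel)"
    using lborel_pair.integral_fst[OF ic[OF Y(2)]] unfolding il lborel_prod by (simp add: case_prod_unfold)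
  also have "\<dots> = (\<integral>x. indicator {0<..<pi} x * Y (x, x) \<partial>lborel)"
  proof (rule Bochner_Integration.integral_cong)
    fix x :: real
    show "(\<integral>y. indicator open_triangle (x, y) * Yy (x, y) \<partial>lborel) = indicator {0<..<pi} x * Y (x, x)"
    proof (cases "x \<in> {0<..<pi}")
      case True
      have "(\<integral>y. indicator {0<..<x} y * Yy (x, y) \<partial>lborel) = Y (x, x) - Y (x, 0)"
        by (rule integral_FTC_open[where F = "\<lambda>y. Y (x, y)"])
           (use True Y(1) in \<open>auto intro!: continuous_on_compose2[OF Y(2)] continuous_intros\<close>)
      then show ?thesis using True bd(2) unfolding ind(2) by simp
    next
      case False
      then show ?thesis unfolding ind(2) by (simp del: greaterThanLessThan_iff)
    qed
  qed simp
  finally have 2: "(\<integral>z. Yy z \<partial>leb_on open_triangle) = (\<integral>x. indicator {0<..<pi} x * X (x, x) \<partial>lborel)" using bd(3) by simp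
  show ?thesis
    using 1 2 integrable_leb_on_continuous[OF open_triangle_bounded open_triangle_sets X(2)] integrable_leb_on_continuous[OF open_triangle_bounded open_triangle_sets Y(2)] by simp
qed

lemma sin_nat_pi [simp]: "sin (real n * pi) = 0"
  by (simp add: mult.commute)

text \<open>Green's formula: the modes have vanishing normal derivative on all three sides (on the
  diagonal by symmetry in x and y), and their Laplacian \<open>pxx\<close> + \<open>pyy\<close> is
  minus the eigenvalue times the mode.\<close>

lemma phi_weak_pair: "weak_pair open_triangle {} (real (m\<^sup>2 + n\<^sup>2)) (\<lambda>z. (phi m n z, grad_phi m n z))"
proof (rule weak_pair_core[OF open_triangle_bounded open_triangle_sets form_domain_core[OF open_triangle_bounded open_triangle_sets]])
  show "core_function {} (phi m n) (grad_phi m n)" using phi_C1 by (simp add: core_function_def)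
  fix v G assume "core_function {} v G"
  then have C: "has_C1_gradient v G" by (simp add: core_function_def)
  have cv: "continuous_on UNIV v" "continuous_on UNIV G" using C1_continuous[OF C] C by (auto simp: has_C1_gradient_def)
  have cg: "continuous_on UNIV (grad_phi m n)" using phi_C1 by (simp add: has_C1_gradient_def)
  define pxx where "pxx z = - (real m)\<^sup>2 * (cos (m * fst z) * cos (n * snd z)) - (real n)\<^sup>2 * (cos (m * snd z) * cos (n * fst z))" for z :: "real \<times> real"
  define pyy where "pyy z = - (real n)\<^sup>2 * (cos (m * fst z) * cos (n * snd z)) - (real m)\<^sup>2 * (cos (m * snd z) * cos (n * fst z))" for z :: "real \<times> real"
  have "(\<integral>z. (fst (G z) * fst (grad_phi m n z) + pxx z * v z) + (snd (G z) * snd (grad_phi m n z) + pyy z * v z) \<partial>leb_on open_triangle) = 0"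
  proof (rule open_triangle_divergence[where X = "\<lambda>z. v z * fst (grad_phi m n z)" and Y = "\<lambda>z. v z * snd (grad_phi m n z)"])
    show "((\<lambda>x. v (x, y) * fst (grad_phi m n (x, y))) has_real_derivative fst (G (x, y)) * fst (grad_phi m n (x, y)) + pxx (x, y) * v (x, y)) (at x)" for x y
    proof -
      have "((\<lambda>x. fst (grad_phi m n (x, y))) has_real_derivative pxx (x, y)) (at x)"
        unfolding grad_phi_def pxx_def by (auto intro!: derivative_eq_intros simp: power2_eq_square algebra_simps)
      from DERIV_mult[OF C1_slice(1)[OF C] this] show ?thesis .
    qed
    show "((\<lambda>y. v (x, y) * snd (grad_phi m n (x, y))) has_real_derivative snd (G (x, y)) * snd (grad_phi m n (x, y)) + pyy (x, y) * v (x, y)) (at y)" for x y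
    proof -
      have "((\<lambda>y. snd (grad_phi m n (x, y))) has_real_derivative pyy (x, y)) (at y)"
        unfolding grad_phi_def pyy_def by (auto intro!: derivative_eq_intros simp: power2_eq_square algebra_simps)
      from DERIV_mult[OF C1_slice(2)[OF C] this] show ?thesis .
    qed
    show "continuous_on UNIV (\<lambda>z. fst (G z) * fst (grad_phi m n z) + pxx z * v z)" 
      unfolding pxx_def by (intro continuous_intros cv cg)
    show "continuous_on UNIV (\<lambda>z. snd (G z) * snd (grad_phi m n z) + pyy z * v z)"
      unfolding pyy_def by (intro continuous_intros cv cg)
  qed (simp_all add: grad_phi_def)
  moreover have "(fst (G z) * fst (grad_phi m n z) + pxx z * v z) + (snd (G z) * snd (grad_phi m n z) + pyy z * v z)
     = twist (real (m\<^sup>2 + n\<^sup>2)) (phi m n z, grad_phi m n z) \<bullet> (v z, G z)" for z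
  proof -
    have "pxx z + pyy z = - real (m\<^sup>2 + n\<^sup>2) * phi m n z"
      by (simp add: pxx_def pyy_def phi_def algebra_simps)
    then have "pxx z * v z + pyy z * v z = - real (m\<^sup>2 + n\<^sup>2) * phi m n z * v z" by (simp only: distrib_right[symmetric])
    then show ?thesis by (simp add: twist_def inner_prod_def mult.commute[of "fst (G z)"] mult.commute[of "snd (G z)"])
  qed
  ultimately show "(\<integral>z. twist (real (m\<^sup>2 + n\<^sup>2)) (phi m n z, grad_phi m n z) \<bullet> (v z, G z) \<partial>leb_on open_triangle) = 0" by simp
qed

lemma integral_cos_cos:
  fixes a b :: nat
  assumes "a \<noteq> b"
  shows "(\<integral>x. indicator {0<..<pi} x * (cos (a * x) * cos (b * x)) \<partial>lborel) = 0"
proof -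
  let ?d = "real a - real b" and ?s = "real a + real b"
  have nz: "?d \<noteq> 0" "?s \<noteq> 0" using assms by auto
  let ?F = "\<lambda>x. (sin (?d * x) / ?d + sin (?s * x) / ?s) / 2"
  have "(?F has_real_derivative (cos (?d * x) + cos (?s * x)) / 2) (at x)" for x
    using nz by (auto intro!: derivative_eq_intros)
  moreover have "(cos (?d * x) + cos (?s * x)) / 2 = cos (a * x) * cos (b * x)" for x :: real
    by (simp add: cos_times_cos left_diff_distrib distrib_right)
  ultimately have d: "(?F has_real_derivative cos (a * x) * cos (b * x)) (at x)" for x :: real by simp
  have "(\<integral>x. indicator {0<..<pi} x * (cos (a * x) * cos (b * x)) \<partial>lborel) = ?F pi - ?F 0"
    by (rule integral_FTC_open[OF _ d]) (auto intro!: continuous_intros)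
  also have "\<dots> = 0" by (simp add: left_diff_distrib distrib_right sin_diff sin_add)
  finally show ?thesis .
qed

lemma integral_square_product:
  fixes f g :: "real \<Rightarrow> real"
  assumes f: "continuous_on UNIV f" and g: "continuous_on UNIV g"
  shows "(\<integral>z. indicator ({0<..<pi} \<times> {0<..<pi}) z * (f (fst z) * g (snd z)) \<partial>lborel) =
     (\<integral>x. indicator {0<..<pi} x * f x \<partial>lborel) * (\<integral>x. indicator {0<..<pi} x * g x \<partial>lborel)"
proof -
  have c: "continuous_on UNIV (\<lambda>z. f (fst z) * g (snd z))"
    by (intro continuous_intros continuous_on_compose2[OF f] continuous_on_compose2[OF g]) auto
  have S: "{0<..<pi} \<times> {0<..<pi} \<in> sets borel" by (intro borel_open open_Times) auto
  have bS: "bounded ({0<..<pi} \<times> {0<..<pi})" by (intro bounded_Times) auto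
  have i: "integrable (lborel \<Otimes>\<^sub>M lborel) (\<lambda>(x, y). indicator ({0<..<pi} \<times> {0<..<pi}) (x, y) * (f x * g y))"
    using integrable_leb_on_continuous[OF bS S c] S
    by (simp add: integrable_restrict_space lborel_prod case_prod_unfold)
  have "(\<integral>z. indicator ({0<..<pi} \<times> {0<..<pi}) z * (f (fst z) * g (snd z)) \<partial>lborel) =
      (\<integral>x. (\<integral>y. indicator ({0<..<pi} \<times> {0<..<pi}) (x, y) * (f x * g y) \<partial>lborel) \<partial>lborel)"
    using lborel_pair.integral_fst[OF i] unfolding lborel_prod by (simp add: case_prod_unfold)
  also have "\<dots> = (\<integral>x. (\<integral>y. (indicator {0<..<pi} x * f x) * (indicator {0<..<pi} y * g y) \<partial>lborel) \<partial>lborel)"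
    by (simp add: indicator_times algebra_simps)
  also have "\<dots> = (\<integral>x. indicator {0<..<pi} x * f x \<partial>lborel) * (\<integral>x. indicator {0<..<pi} x * g x \<partial>lborel)"
    by simp
  finally show ?thesis .
qed

text \<open>The square is, up to the null diagonal, the triangle and its mirror image. This reduces
  integrals over the triangle to products of one-dimensional ones.\<close>

lemma integral_triangle_symmetric:
  fixes f :: "real \<times> real \<Rightarrow> real"
  assumes c: "continuous_on UNIV f" and sym: "\<And>x y. f (x, y) = f (y, x)"
  shows "(\<integral>z. indicator ({0<..<pi} \<times> {0<..<pi}) z * f z \<partial>lborel) = 2 * (\<integral>z. f z \<partial>leb_on open_triangle)"
proof -
  define T' where "T' = {z :: real \<times> real. 0 < fst z \<and> fst z < snd z \<and> snd z < pi}"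
  have [measurable]: "f \<in> borel_measurable borel" using borel_measurable_continuous_onI[OF c] .
  have i1: "integrable lborel (\<lambda>z. indicator open_triangle z * f z)"
    using integrable_leb_on_continuous[OF open_triangle_bounded open_triangle_sets c] open_triangle_sets by (simp add: integrable_restrict_space)
  have sw: "indicator T' (x, y) = (indicator open_triangle (y, x) :: real)" for x y by (auto simp: T'_def indicator_def)
  have "(\<lambda>(x, y). indicator open_triangle (y, x) * f (y, x)) = (\<lambda>z. indicator T' z * f z)"
    using sw sym by (auto simp: fun_eq_iff)
  moreover have "integrable (lborel \<Otimes>\<^sub>M lborel) (\<lambda>(x, y). indicator open_triangle (y, x) * f (y, x))"
    by (rule lborel_pair.integrable_product_swap) (use i1 in \<open>simp add: lborel_prod\<close>)
  moreover have "(\<integral>(x, y). indicator open_triangle (y, x) * f (y, x) \<partial>(lborel \<Otimes>\<^sub>M lborel)) = integral\<^sup>L (lborel \<Otimes>\<^sub>M lborel) (\<lambda>z. indicator open_triangle z * f z)"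
    by (rule lborel_pair.integral_product_swap) (use i1 in \<open>simp only: lborel_prod borel_measurable_integrable\<close>)
  ultimately have i2: "integrable lborel (\<lambda>z. indicator T' z * f z)" 
    and eq: "(\<integral>z. indicator T' z * f z \<partial>lborel) = (\<integral>z. indicator open_triangle z * f z \<partial>lborel)" 
    unfolding lborel_prod by simp_all
  \<comment> \<open>The function fst z - snd z has a gradient without zeros, so
    \<open>AE_gradient_zero\<close> says that the diagonal is null.\<close>
  have dC: "has_C1_gradient (\<lambda>z. fst z - snd z) (\<lambda>z. (1, - 1))"
    unfolding has_C1_gradient_def gderiv_def
    by (auto intro!: derivative_eq_intros continuous_intros simp: inner_prod_def fun_eq_iff)
  have "(\<integral>z. indicator ({0<..<pi} \<times> {0<..<pi}) z * f z \<partial>lborel) = (\<integral>z. indicator open_triangle z * f z + indicator T' z * f z \<partial>lborel)"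
  proof (rule integral_cong_AE)
    have S: "{0<..<pi} \<times> {0<..<pi} \<in> sets borel" by (intro borel_open open_Times) auto
    show "(\<lambda>z. indicator ({0<..<pi} \<times> {0<..<pi}) z * f z) \<in> borel_measurable lborel"
      using S by (intro borel_measurable_times borel_measurable_indicator) auto
    show "(\<lambda>z. indicator open_triangle z * f z + indicator T' z * f z) \<in> borel_measurable lborel"
      using i1 i2 by (intro borel_measurable_add borel_measurable_integrable)
    show "AE z in lborel. indicator ({0<..<pi} \<times> {0<..<pi}) z * f z = indicator open_triangle z * f z + indicator T' z * f z"
      using AE_gradient_zero[OF dC]
    proof eventually_elim
      case (elim z)
      then have "fst z \<noteq> snd z" by (auto simp: zero_prod_def)
      then show ?case by (cases z) (auto simp: indicator_def T'_def)
    qed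
  qed
  also have "\<dots> = 2 * (\<integral>z. indicator open_triangle z * f z \<partial>lborel)" using i1 i2 eq by simp
  finally show ?thesis using open_triangle_sets by (simp add: integral_restrict_space)
qed

text \<open>Over the square the product splits into four products of one-dimensional cosine
  integrals, each with a factor of two distinct frequencies. The swapped coincidence m = l, n = k is
  excluded by the ordering of the indices, which would make the pairs equal.\<close>

lemma phi_orthogonal:
  assumes "n \<le> m" "l \<le> k" "(m, n) \<noteq> (k, l)"
  shows "(\<integral>z. phi m n z * phi k l z \<partial>leb_on open_triangle) = 0"
proof -
  let ?c = "\<lambda>a b. \<integral>x. indicator {0<..<pi} x * (cos (real a * x) * cos (real b * x)) \<partial>lborel"
  let ?S = "{0<..<pi} \<times> {0<..<pi}"
  let ?t = "\<lambda>a b c d z. indicator ?S z * ((cos (real a * fst z) * cos (real b * fst z)) * (cos (real c * snd z) * cos (real d * snd z)))"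
  have prod: "(\<integral>z. ?t a b c d z \<partial>lborel) = ?c a b * ?c c d" for a b c d
    by (rule integral_square_product) (auto intro!: continuous_intros)
  have it: "integrable lborel (?t a b c d)" for a b c d
  proof -
    have S: "?S \<in> sets borel" by (intro borel_open open_Times) auto
    have bS: "bounded ?S" by (intro bounded_Times) auto
    have "continuous_on UNIV (\<lambda>z. (cos (real a * fst z) * cos (real b * fst z)) * (cos (real c * snd z) * cos (real d * snd z)))"
      by (intro continuous_intros)
    from integrable_leb_on_continuous[OF bS S this] show ?thesis using S by (simp add: integrable_restrict_space)
  qed
  have "2 * (\<integral>z. phi m n z * phi k l z \<partial>leb_on open_triangle) = (\<integral>z. indicator ?S z * (phi m n z * phi k l z) \<partial>lborel)"
    by (rule integral_triangle_symmetric[symmetric]) (auto intro!: continuous_intros phi_continuous simp: phi_def algebra_simps)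
  also have "\<dots> = (\<integral>z. ?t m k n l z + ?t m l n k z + ?t n k m l z + ?t n l m k z \<partial>lborel)"
    by (intro Bochner_Integration.integral_cong) (auto simp: phi_def algebra_simps)
  also have "\<dots> = ?c m k * ?c n l + ?c m l * ?c n k + ?c n k * ?c m l + ?c n l * ?c m k"
    using it prod by simp
  also have "\<dots> = 0"
  proof -
    have 1: "?c m k * ?c n l = 0" "?c n l * ?c m k = 0"
      using assms(3) integral_cos_cos[of m k] integral_cos_cos[of n l] by (cases "m = k"; cases "n = l"; simp)+
    have "\<not> (m = l \<and> n = k)" using assms by auto
    then have 2: "?c m l * ?c n k = 0" "?c n k * ?c m l = 0"
      using integral_cos_cos[of m l] integral_cos_cos[of n k] by (cases "m = l"; cases "n = k"; simp)+
    show ?thesis using 1 2 by linarith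
  qed
  finally show ?thesis by simp
qed

text \<open>Every mode has the value 2 at the corner (0, 0), hence is nonzero at the nearby interior
  points (2 e, e).\<close>

lemma phi_norm_pos: "(\<integral>z. (phi m n z)\<^sup>2 \<partial>leb_on open_triangle) > 0"
proof (rule ccontr)
  have c: "continuous_on UNIV (\<lambda>z. (phi m n z)\<^sup>2)" by (intro continuous_intros phi_continuous)
  have i: "integrable (leb_on open_triangle) (\<lambda>z. (phi m n z)\<^sup>2)" by (rule integrable_leb_on_continuous[OF open_triangle_bounded open_triangle_sets c])
  assume "\<not> 0 < (\<integral>z. (phi m n z)\<^sup>2 \<partial>leb_on open_triangle)"
  then have "(\<integral>z. (phi m n z)\<^sup>2 \<partial>leb_on open_triangle) = 0" by (intro antisym) auto
  then have "AE z in leb_on open_triangle. (phi m n z)\<^sup>2 = 0" using integral_nonneg_eq_0_iff_AE[OF i] by auto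
  then have "AE z in lborel. z \<in> open_triangle \<longrightarrow> phi m n z = 0" using open_triangle_sets by (subst (asm) AE_restrict_space_iff) auto
  then have z: "phi m n z = 0" if "z \<in> open_triangle" for z
    using AE_zero_continuous[OF open_triangle_open continuous_on_subset[OF phi_continuous]] that by blast
  have "open {z. phi m n z \<noteq> 0}" by (intro open_Collect_neq phi_continuous continuous_intros)
  moreover have "(0, 0) \<in> {z. phi m n z \<noteq> 0}" by (simp add: phi_def)
  ultimately obtain r where r: "r > 0" "ball (0, 0) r \<subseteq> {z. phi m n z \<noteq> 0}" using open_contains_ball by blast
  define e where "e = min (r / 4) 1"
  have e: "e > 0" "e \<le> 1" "e \<le> r / 4" using r(1) by (auto simp: e_def)
  have "norm (2 * e, e) \<le> norm (2 * e) + norm e" by (rule norm_Pair_le)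
  then have "norm (2 * e, e) < r" using e r(1) by simp
  then have "(2 * e, e) \<in> ball 0 r" by (simp only: mem_ball_0)
  then have "(2 * e, e) \<in> ball (0, 0) r" unfolding zero_prod_def .
  moreover have "(2 * e, e) \<in> open_triangle" using e pi_gt3 by auto
  ultimately show False using z r(2) by blast
qed

section \<open>Completeness of the modes and the variational principle\<close>

definition modes_upto :: "nat \<Rightarrow> (nat \<times> nat) set" where
  "modes_upto N = {p. snd p \<le> fst p \<and> fst p \<le> N}"

lemma finite_modes_upto [simp]: "finite (modes_upto N)"
proof -
  have "modes_upto N \<subseteq> {..N} \<times> {..N}" by (auto simp: modes_upto_def)
  then show ?thesis by (rule finite_subset) simp
qed

lemma modes_upto_mono: "N \<le> N' \<Longrightarrow> modes_upto N \<subseteq> modes_upto N'"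
  by (auto simp: modes_upto_def)

abbreviation mode :: "nat \<times> nat \<Rightarrow> real \<times> real \<Rightarrow> real" where
  "mode p \<equiv> phi (fst p) (snd p)"

abbreviation grad_mode :: "nat \<times> nat \<Rightarrow> real \<times> real \<Rightarrow> real \<times> real" where
  "grad_mode p \<equiv> grad_phi (fst p) (snd p)"

definition mode_eigenvalue :: "nat \<times> nat \<Rightarrow> real" where
  "mode_eigenvalue p = real ((fst p)\<^sup>2 + (snd p)\<^sup>2)"

definition mode_norm2 :: "nat \<times> nat \<Rightarrow> real" where
  "mode_norm2 p = (\<integral>z. (mode p z)\<^sup>2 \<partial>leb_on open_triangle)"

lemma mode_norm2_pos: "mode_norm2 p > 0"
  by (simp add: mode_norm2_def phi_norm_pos)

section \<open>Uniform density of the span of the modes\<close>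

lemma phi_swap: "phi n m = phi m n"
  by (auto simp: phi_def fun_eq_iff)

lemma cos_mult_nat:
  fixes a b :: nat
  shows "cos (real a * t) * cos (real b * t) = (cos (real ((a - b) + (b - a)) * t) + cos (real (a + b) * t)) / 2"
proof (cases "b \<le> a")
  case True
  then show ?thesis by (simp add: cos_times_cos of_nat_diff left_diff_distrib distrib_right)
next
  case False
  then have "cos (real ((a - b) + (b - a)) * t) = cos (real a * t - real b * t)"
    using cos_minus[of "real a * t - real b * t"] by (simp add: of_nat_diff left_diff_distrib)
  then show ?thesis by (simp add: cos_times_cos distrib_right)
qed

text \<open>The product formula for cosines, symmetrised. It makes the span of the modes an algebra,
  as Stone-Weierstrass demands. With truncated subtraction, d a b is the distance of a and
  b.\<close>

lemma phi_mult:
  fixes m n k l :: nat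
  defines "d \<equiv> \<lambda>a b :: nat. (a - b) + (b - a)"
  shows "phi m n z * phi k l z = 1 / 4 * phi (d m k) (d n l) z + 1 / 4 * phi (d m k) (n + l) z + 1 / 4 * phi (m + k) (d n l) z
    + 1 / 4 * phi (m + k) (n + l) z + 1 / 4 * phi (d m l) (d n k) z + 1 / 4 * phi (d m l) (n + k) z + 1 / 4 * phi (m + l) (d n k) z
    + 1 / 4 * phi (m + l) (n + k) z"
proof -
  define P where "P a b t = cos (real a * t) * cos (real b * t)" for a b :: nat and t
  have P: "P a b t = (cos (real (d a b) * t) + cos (real (a + b) * t)) / 2" for a b t
    unfolding P_def d_def by (rule cos_mult_nat)
  have "phi m n z * phi k l z = P m k (fst z) * P n l (snd z) + P m l (fst z) * P n k (snd z)
     + P m l (snd z) * P n k (fst z) + P m k (snd z) * P n l (fst z)"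
    by (simp add: phi_def P_def algebra_simps)
  then show ?thesis unfolding P phi_def by (simp add: field_simps)
qed

inductive mode_span :: "(real \<times> real \<Rightarrow> real) \<Rightarrow> bool" where
  mono: "mode_span (\<lambda>z. c * phi m n z)"
| add: "mode_span f \<Longrightarrow> mode_span g \<Longrightarrow> mode_span (\<lambda>z. f z + g z)"

lemma mode_span_cmult: "mode_span f \<Longrightarrow> mode_span (\<lambda>z. c * f z)"
proof (induction rule: mode_span.induct)
  case (mono d m n)
  have eq: "(\<lambda>z. c * (d * phi m n z)) = (\<lambda>z. (c * d) * phi m n z)" by (rule ext) simp
  show ?case unfolding eq by (rule mode_span.mono)
next
  case (add f g)
  show ?case unfolding distrib_left by (rule mode_span.add[OF add.IH])
qed

lemma mode_span_mult:
  assumes "mode_span f" "mode_span g" shows "mode_span (\<lambda>z. f z * g z)"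
  using assms
proof (induction rule: mode_span.induct)
  case (mono c m n)
  from mono.prems show ?case
  proof (induction rule: mode_span.induct)
    case (mono c' k l)
    have "mode_span (\<lambda>z. (c * c') * (phi m n z * phi k l z))"
      unfolding phi_mult by (rule mode_span_cmult) (intro mode_span.intros)
    moreover have "(\<lambda>z. (c * c') * (phi m n z * phi k l z)) = (\<lambda>z. c * phi m n z * (c' * phi k l z))"
      by (rule ext) simp
    ultimately show ?case by simp
  next
    case (add f g)
    show ?case unfolding distrib_left by (rule mode_span.add[OF add.IH])
  qed
next
  case (add f1 f2)
  show ?case unfolding distrib_right by (rule mode_span.add[OF add.IH(1)[OF add.prems] add.IH(2)[OF add.prems]])
qed

lemma mode_span_continuous: "mode_span f \<Longrightarrow> continuous_on UNIV f"
proof (induction rule: mode_span.induct)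
  case (mono c m n) show ?case by (rule continuous_on_mult[OF continuous_on_const phi_continuous])
next
  case (add f g) then show ?case by (intro continuous_on_add)
qed

lemma modes_upto_extend:
  assumes "N \<le> N'"
  shows "(\<Sum>p\<in>modes_upto N. c p * mode p z) = (\<Sum>p\<in>modes_upto N'. (if p \<in> modes_upto N then c p else 0) * mode p z)"
  using modes_upto_mono[OF assms] by (intro sum.mono_neutral_cong_left) auto

text \<open>Indices in \<open>mode_span\<close> are unordered; the symmetry of \<open>phi\<close>
  sorts them. Sums are brought to a common block of indices by padding with zero
  coefficients.\<close>

lemma mode_span_normal: "mode_span f \<Longrightarrow> \<exists>N c. \<forall>z. f z = (\<Sum>p\<in>modes_upto N. c p * mode p z)"
proof (induction rule: mode_span.induct)
  case (mono c m n)
  define q where "q = (max m n, min m n)"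
  have q: "q \<in> modes_upto (max m n)" "mode q = phi m n" by (auto simp: q_def modes_upto_def max_def min_def phi_swap)
  have "c * phi m n z = (\<Sum>p\<in>modes_upto (max m n). (if p = q then c else 0) * mode p z)" for z
  proof -
    have "(\<Sum>p\<in>modes_upto (max m n). (if p = q then c else 0) * mode p z) = (\<Sum>p\<in>{q}. (if p = q then c else 0) * mode p z)"
      using q(1) by (intro sum.mono_neutral_right) auto
    then show ?thesis using q(2) by simp
  qed
  then show ?case by (intro exI[of _ "max m n"] exI[of _ "\<lambda>p. if p = q then c else 0"] allI)
next
  case (add f g)
  then obtain N c N' c' where f: "\<And>z. f z = (\<Sum>p\<in>modes_upto N. c p * mode p z)" and g: "\<And>z. g z = (\<Sum>p\<in>modes_upto N'. c' p * mode p z)" by blast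
  let ?M = "max N N'"
  have "f z + g z = (\<Sum>p\<in>modes_upto ?M. ((if p \<in> modes_upto N then c p else 0) + (if p \<in> modes_upto N' then c' p else 0)) * mode p z)" for z
    unfolding f g modes_upto_extend[of N ?M c z, OF max.cobounded1] modes_upto_extend[of N' ?M c' z, OF max.cobounded2]
    by (simp only: sum.distrib[symmetric] distrib_right)
  then show ?case
    by (intro exI[of _ ?M] exI[of _ "\<lambda>p. (if p \<in> modes_upto N then c p else 0) + (if p \<in> modes_upto N' then c' p else 0)"] allI)
qed

lemma compact_iso_triangle: "compact iso_triangle"
proof -
  have eq: "iso_triangle = {z. inner (0, -1) z \<le> 0} \<inter> {z. inner (-1, 1) z \<le> 0} \<inter> {z. inner (1, 0) z \<le> pi}"
    by (auto simp: iso_triangle_def inner_prod_def)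
  have "closed iso_triangle" unfolding eq by (intro closed_Int closed_halfspace_le)
  moreover have "iso_triangle \<subseteq> cbox (0, 0) (pi, pi)" by (auto simp: iso_triangle_def cbox_Pair_eq)
  ultimately show ?thesis using bounded_cbox bounded_subset compact_eq_bounded_closed by blast
qed

lemma open_triangle_subset: "open_triangle \<subseteq> iso_triangle"
  unfolding interior_iso_triangle[symmetric] by (rule interior_subset)

text \<open>The two modes give the sum and the product of cos x and cos y, hence the unordered pair;
  y \<le> x and the monotonicity of cos on [0, pi] fix the order.\<close>

lemma phi_separates:
  assumes "(x, y) \<in> iso_triangle" "(x', y') \<in> iso_triangle"
    and "phi 1 0 (x, y) = phi 1 0 (x', y')" "phi 1 1 (x, y) = phi 1 1 (x', y')"
  shows "(x, y) = (x', y')"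
proof -
  have D: "0 \<le> y" "y \<le> x" "x \<le> pi" "0 \<le> y'" "y' \<le> x'" "x' \<le> pi" using assms(1,2) by (auto simp: iso_triangle_def)
  have le: "cos x \<le> cos y" "cos x' \<le> cos y'" using D cos_monotone_0_pi_le by auto
  have s: "cos x + cos y = cos x' + cos y'" using assms(3) by (simp add: phi_def)
  have p: "cos x * cos y = cos x' * cos y'" using assms(4) by (simp add: phi_def)
  have "(cos y - cos x)\<^sup>2 = (cos x + cos y)\<^sup>2 - 4 * (cos x * cos y)" by (simp add: power2_eq_square algebra_simps)
  also have "\<dots> = (cos x' + cos y')\<^sup>2 - 4 * (cos x' * cos y')" unfolding s p ..
  also have "\<dots> = (cos y' - cos x')\<^sup>2" by (simp add: power2_eq_square algebra_simps)
  finally have "cos y - cos x = cos y' - cos x'" using le by (simp add: power2_eq_iff_nonneg)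
  then have "cos x = cos x'" "cos y = cos y'" using s by linarith+
  then show ?thesis using D cos_inj_pi[of x x'] cos_inj_pi[of y y'] by auto
qed

lemma phi_dense:
  assumes "continuous_on UNIV f" "e > 0"
  shows "\<exists>N c. \<forall>z\<in>iso_triangle. \<bar>f z - (\<Sum>p\<in>modes_upto N. c p * mode p z)\<bar> < e"
proof -
  have "\<exists>g. mode_span g \<and> (\<forall>z\<in>iso_triangle. \<bar>f z - g z\<bar> < e)"
  proof (rule Stone_Weierstrass_HOL[OF compact_iso_triangle])
    show "mode_span (\<lambda>z. c)" for c using mode_span.mono[of "c / 2" 0 0] by (simp add: phi_def)
    show "\<And>f. mode_span f \<Longrightarrow> continuous_on iso_triangle f" using mode_span_continuous continuous_on_subset by blast
    show "continuous_on iso_triangle f" using assms(1) continuous_on_subset by blast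
    fix a b assume ab: "a \<in> iso_triangle \<and> b \<in> iso_triangle \<and> a \<noteq> b"
    have "phi 1 0 a \<noteq> phi 1 0 b \<or> phi 1 1 a \<noteq> phi 1 1 b"
      using phi_separates[of "fst a" "snd a" "fst b" "snd b"] ab by (auto simp: prod_eq_iff)
    then show "\<exists>f. mode_span f \<and> f a \<noteq> f b" 
    proof
      assume "phi 1 0 a \<noteq> phi 1 0 b"
      then show ?thesis using mode_span.mono[of 1 1 0] by (intro exI[of _ "\<lambda>z. 1 * phi 1 0 z"]) simp
    next
      assume "phi 1 1 a \<noteq> phi 1 1 b"
      then show ?thesis using mode_span.mono[of 1 1 1] by (intro exI[of _ "\<lambda>z. 1 * phi 1 1 z"]) simp
    qed
  qed (use assms(2) mode_span.add mode_span_mult in blast)+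
  then show ?thesis using mode_span_normal by metis
qed

section \<open>Orthogonal expansions and the variational principle\<close>

lemma norm_diff_power2:
  fixes a b :: "'a::real_inner"
  shows "(norm (a - b))\<^sup>2 = (norm a)\<^sup>2 - 2 * (a \<bullet> b) + b \<bullet> b"
  by (simp add: power2_norm_eq_inner inner_diff_left inner_diff_right inner_commute)

text \<open>Stated for an orthogonal, unnormalised family with values in any Euclidean space,
  because it is applied both to the modes and to their gradients.\<close>

lemma L2_expand:
  fixes f :: "'a \<Rightarrow> 'b::euclidean_space"
  assumes A: "finite A" and f: "L2 M f" and e: "\<And>p. p \<in> A \<Longrightarrow> L2 M (e p)"
    and b: "\<And>p. p \<in> A \<Longrightarrow> (\<integral>x. f x \<bullet> e p x \<partial>M) = b p"
    and d: "\<And>p q. p \<in> A \<Longrightarrow> q \<in> A \<Longrightarrow> (\<integral>x. e p x \<bullet> e q x \<partial>M) = (if p = q then d p else 0)"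
  shows "(\<integral>x. (norm (f x - (\<Sum>p\<in>A. c p *\<^sub>R e p x)))\<^sup>2 \<partial>M) = (\<integral>x. (norm (f x))\<^sup>2 \<partial>M) - 2 * (\<Sum>p\<in>A. c p * b p) + (\<Sum>p\<in>A. (c p)\<^sup>2 * d p)"
proof -
  let ?S = "\<lambda>x. \<Sum>p\<in>A. c p *\<^sub>R e p x"
  have LS: "L2 M ?S" by (intro L2_sum L2_scaleR e)
  have 1: "(\<integral>x. f x \<bullet> ?S x \<partial>M) = (\<Sum>p\<in>A. c p * b p)"
  proof -
    have "(\<integral>x. f x \<bullet> ?S x \<partial>M) = (\<integral>x. (\<Sum>p\<in>A. c p * (f x \<bullet> e p x)) \<partial>M)" by (simp add: inner_sum_right)
    also have "\<dots> = (\<Sum>p\<in>A. \<integral>x. c p * (f x \<bullet> e p x) \<partial>M)"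
      using L2_inner_integrable[OF f e] by (intro Bochner_Integration.integral_sum) auto
    also have "\<dots> = (\<Sum>p\<in>A. c p * b p)" using b by (intro sum.cong) auto
    finally show ?thesis .
  qed
  have 2: "(\<integral>x. ?S x \<bullet> ?S x \<partial>M) = (\<Sum>p\<in>A. (c p)\<^sup>2 * d p)"
  proof -
    have "(\<integral>x. ?S x \<bullet> ?S x \<partial>M) = (\<integral>x. (\<Sum>p\<in>A. c p * (e p x \<bullet> ?S x)) \<partial>M)" by (simp add: inner_sum_left)
    also have "\<dots> = (\<Sum>p\<in>A. \<integral>x. c p * (e p x \<bullet> ?S x) \<partial>M)"
      using L2_inner_integrable[OF e LS] by (intro Bochner_Integration.integral_sum) auto
    also have "\<dots> = (\<Sum>p\<in>A. (c p)\<^sup>2 * d p)"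
    proof (rule sum.cong[OF refl])
      fix p assume p: "p \<in> A"
      have "(\<integral>x. e p x \<bullet> ?S x \<partial>M) = (\<integral>x. (\<Sum>q\<in>A. c q * (e p x \<bullet> e q x)) \<partial>M)" by (simp add: inner_sum_right)
      also have "\<dots> = (\<Sum>q\<in>A. \<integral>x. c q * (e p x \<bullet> e q x) \<partial>M)"
        using L2_inner_integrable[OF e[OF p] e] by (intro Bochner_Integration.integral_sum) auto
      also have "\<dots> = (\<Sum>q\<in>A. if p = q then c q * d p else 0)" using d[OF p] by (intro sum.cong) auto
      also have "\<dots> = c p * d p" using A p by simp
      finally show "(\<integral>x. c p * (e p x \<bullet> ?S x) \<partial>M) = (c p)\<^sup>2 * d p" by (simp add: power2_eq_square)
    qed
    finally show ?thesis .
  qed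
  have "(\<integral>x. (norm (f x - ?S x))\<^sup>2 \<partial>M) = (\<integral>x. (norm (f x))\<^sup>2 - 2 * (f x \<bullet> ?S x) + ?S x \<bullet> ?S x \<partial>M)"
    by (intro Bochner_Integration.integral_cong refl norm_diff_power2)
  also have "\<dots> = (\<integral>x. (norm (f x))\<^sup>2 \<partial>M) - 2 * (\<integral>x. f x \<bullet> ?S x \<partial>M) + (\<integral>x. ?S x \<bullet> ?S x \<partial>M)"
    using L2_norm2_integrable[OF f] L2_inner_integrable[OF f LS] L2_inner_integrable[OF LS LS] by simp
  finally show ?thesis unfolding 1 2 .
qed

lemma mode_L2: "L2 (leb_on open_triangle) (mode p)"
  by (rule L2_continuous[OF open_triangle_bounded open_triangle_sets phi_continuous])

lemma grad_mode_L2: "L2 (leb_on open_triangle) (grad_mode p)"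
  using phi_C1 by (intro L2_continuous[OF open_triangle_bounded open_triangle_sets]) (simp add: has_C1_gradient_def)

lemma mode_FD: "form_domain open_triangle {} (\<lambda>z. (mode p z, grad_mode p z))"
  using phi_weak_pair unfolding weak_pair_def by blast

lemma mode_gram:
  assumes "snd p \<le> fst p" "snd q \<le> fst q"
  shows "(\<integral>z. mode p z \<bullet> mode q z \<partial>leb_on open_triangle) = (if p = q then mode_norm2 p else 0)"
  using phi_orthogonal[OF assms] by (auto simp: mode_norm2_def power2_eq_square prod_eq_iff)

text \<open>The weak equation of a mode, tested with P. It ties the coefficients of a weak gradient
  to those of its function through the factor \<open>mode_eigenvalue p\<close>.\<close>

lemma grad_mode_test:
  assumes "form_domain open_triangle {} P"
  shows "(\<integral>z. grad_mode p z \<bullet> snd (P z) \<partial>leb_on open_triangle) = mode_eigenvalue p * (\<integral>z. mode p z * fst (P z) \<partial>leb_on open_triangle)"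
proof -
  note L = form_domain_L2[OF assms]
  have "(\<integral>z. twist (mode_eigenvalue p) (mode p z, grad_mode p z) \<bullet> P z \<partial>leb_on open_triangle) = 0"
    using phi_weak_pair[of "fst p" "snd p"] assms unfolding weak_pair_def mode_eigenvalue_def by blast
  then have "(\<integral>z. grad_mode p z \<bullet> snd (P z) - mode_eigenvalue p * (mode p z * fst (P z)) \<partial>leb_on open_triangle) = 0" by (simp add: twist_inner)
  then show ?thesis
    using L2_inner_integrable[OF grad_mode_L2 L2_snd[OF L]] L2_inner_integrable[OF mode_L2 L2_fst[OF L]] by simp
qed

lemma grad_mode_gram:
  assumes "snd p \<le> fst p" "snd q \<le> fst q"
  shows "(\<integral>z. grad_mode p z \<bullet> grad_mode q z \<partial>leb_on open_triangle) = (if p = q then mode_eigenvalue p * mode_norm2 p else 0)"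
  using grad_mode_test[OF mode_FD[of q], of p] mode_gram[OF assms] by simp

definition modes_below :: "real \<Rightarrow> (nat \<times> nat) set" where
  "modes_below \<mu> = {p. snd p \<le> fst p \<and> mode_eigenvalue p < \<mu>}"

definition modes_at :: "real \<Rightarrow> (nat \<times> nat) set" where
  "modes_at \<mu> = {p. snd p \<le> fst p \<and> mode_eigenvalue p = \<mu>}"

lemma modes_bound: "{p. snd p \<le> fst p \<and> mode_eigenvalue p \<le> \<mu>} \<subseteq> modes_upto (nat \<lfloor>\<mu>\<rfloor>)"
proof
  fix p assume p: "p \<in> {p. snd p \<le> fst p \<and> mode_eigenvalue p \<le> \<mu>}"
  have "real (fst p) \<le> mode_eigenvalue p" unfolding mode_eigenvalue_def of_nat_le_iff by (simp add: power2_nat_le_imp_le trans_le_add1 power2_eq_square)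
  then have "real (fst p) \<le> \<mu>" using p by auto
  then have "fst p \<le> nat \<lfloor>\<mu>\<rfloor>" by (simp add: le_nat_floor)
  then show "p \<in> modes_upto (nat \<lfloor>\<mu>\<rfloor>)" using p by (simp add: modes_upto_def)
qed

lemma finite_modes_below: "finite (modes_below \<mu>)"
proof -
  have "modes_below \<mu> \<subseteq> modes_upto (nat \<lfloor>\<mu>\<rfloor>)" using modes_bound[of \<mu>] by (auto simp: modes_below_def)
  then show ?thesis by (rule finite_subset) simp
qed

lemma modes_at_subset: "modes_at \<mu> \<subseteq> modes_upto (nat \<lfloor>\<mu>\<rfloor>)"
  using modes_bound[of \<mu>] by (auto simp: modes_at_def)

lemma finite_modes_at: "finite (modes_at \<mu>)"
  using modes_at_subset by (rule finite_subset) simp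

lemma le_all_epsilon:
  fixes x K :: real
  assumes "\<And>e. e > 0 \<Longrightarrow> x \<le> K * e" "K \<ge> 0" shows "x \<le> 0"
proof (rule field_le_epsilon)
  fix e :: real assume e: "e > 0"
  have "x \<le> K * (e / (K + 1))" using e assms(2) by (intro assms(1)) simp
  also have "\<dots> \<le> e" using e assms(2) by (simp add: divide_le_eq mult.commute)
  finally show "x \<le> 0 + e" by simp
qed

text \<open>By hypothesis the Dirichlet form of w = fst P is \<mu> times its squared norm. Bessel's
  inequality for the gradient and Parseval's identity for w show that the sum of
  (\<open>mode_eigenvalue p\<close> - \<mu>) times the squared coefficients, weighted by
  \<open>mode_norm2 p\<close>, is at most 0. Its terms are nonnegative, as the coefficients below
  \<mu> vanish; so only modes at \<mu> survive.\<close>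

theorem neumann_extremal:
  assumes P: "form_domain open_triangle {} P" and q: "(\<integral>z. twist \<mu> (P z) \<bullet> P z \<partial>leb_on open_triangle) = 0"
    and low: "\<And>p. p \<in> modes_below \<mu> \<Longrightarrow> (\<integral>z. mode p z * fst (P z) \<partial>leb_on open_triangle) = 0"
  shows "\<exists>a. AE z in leb_on open_triangle. fst (P z) = (\<Sum>p\<in>modes_at \<mu>. a p * mode p z)"
proof -
  let ?w = "\<lambda>z. fst (P z)" and ?g = "\<lambda>z. snd (P z)"
  have Lw: "L2 (leb_on open_triangle) ?w" and Lg: "L2 (leb_on open_triangle) ?g" using L2_fst[OF form_domain_L2[OF P]] L2_snd[OF form_domain_L2[OF P]] .
  define a where "a p = (\<integral>z. mode p z * ?w z \<partial>leb_on open_triangle) / mode_norm2 p" for p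
  have aw: "(\<integral>z. ?w z \<bullet> mode p z \<partial>leb_on open_triangle) = a p * mode_norm2 p" for p
    using mode_norm2_pos[of p] by (simp add: a_def mult.commute)
  have ag: "(\<integral>z. ?g z \<bullet> grad_mode p z \<partial>leb_on open_triangle) = mode_eigenvalue p * (a p * mode_norm2 p)" for p
    using grad_mode_test[OF P, of p] aw[of p] by (simp add: inner_commute mult.commute)
  define W where "W = (\<integral>z. (norm (?w z))\<^sup>2 \<partial>leb_on open_triangle)"
  define B where "B = (\<integral>z. (norm (?g z))\<^sup>2 \<partial>leb_on open_triangle)"
  have BW: "B = \<mu> * W"
  proof -
    have "(\<integral>z. ?g z \<bullet> ?g z - \<mu> * (?w z * ?w z) \<partial>leb_on open_triangle) = 0" using q by (simp add: twist_inner)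
    then have "(\<integral>z. ?g z \<bullet> ?g z \<partial>leb_on open_triangle) = \<mu> * (\<integral>z. ?w z \<bullet> ?w z \<partial>leb_on open_triangle)"
      using L2_inner_integrable[OF Lg Lg] L2_inner_integrable[OF Lw Lw] by simp
    then show ?thesis unfolding B_def W_def power2_norm_eq_inner .
  qed
  have exp_w: "(\<integral>z. (norm (?w z - (\<Sum>p\<in>A. c p *\<^sub>R mode p z)))\<^sup>2 \<partial>leb_on open_triangle) = W - (\<Sum>p\<in>A. (a p)\<^sup>2 * mode_norm2 p) + (\<Sum>p\<in>A. (c p - a p)\<^sup>2 * mode_norm2 p)"
    if A: "finite A" "\<And>p. p \<in> A \<Longrightarrow> snd p \<le> fst p" for A c
  proof -
    have "(\<integral>z. (norm (?w z - (\<Sum>p\<in>A. c p *\<^sub>R mode p z)))\<^sup>2 \<partial>leb_on open_triangle) = W - 2 * (\<Sum>p\<in>A. c p * (a p * mode_norm2 p)) + (\<Sum>p\<in>A. (c p)\<^sup>2 * mode_norm2 p)"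
      unfolding W_def using mode_gram A(2) aw by (intro L2_expand[OF A(1) Lw mode_L2]) blast+
    also have "\<dots> = W + (\<Sum>p\<in>A. - 2 * (c p * (a p * mode_norm2 p)) + (c p)\<^sup>2 * mode_norm2 p)"
      by (simp add: sum.distrib sum_distrib_left sum_negf sum_subtractf)
    also have "\<dots> = W + (\<Sum>p\<in>A. - ((a p)\<^sup>2 * mode_norm2 p) + (c p - a p)\<^sup>2 * mode_norm2 p)"
      by (simp add: power2_eq_square algebra_simps)
    also have "\<dots> = W - (\<Sum>p\<in>A. (a p)\<^sup>2 * mode_norm2 p) + (\<Sum>p\<in>A. (c p - a p)\<^sup>2 * mode_norm2 p)"
      by (simp add: sum.distrib sum_negf sum_subtractf)
    finally show ?thesis .
  qed
  have QNok: "snd p \<le> fst p" if "p \<in> modes_upto N" for p N using that by (simp add: modes_upto_def)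
  have bess: "(\<Sum>p\<in>modes_upto N. (a p)\<^sup>2 * mode_norm2 p) \<le> W" for N
  proof -
    have "0 \<le> (\<integral>z. (norm (?w z - (\<Sum>p\<in>modes_upto N. a p *\<^sub>R mode p z)))\<^sup>2 \<partial>leb_on open_triangle)" by simp
    also have "\<dots> = W - (\<Sum>p\<in>modes_upto N. (a p)\<^sup>2 * mode_norm2 p) + (\<Sum>p\<in>modes_upto N. (a p - a p)\<^sup>2 * mode_norm2 p)"
      by (rule exp_w[OF finite_modes_upto QNok])
    finally show ?thesis by simp
  qed
  have bessg: "(\<Sum>p\<in>modes_upto N. (a p)\<^sup>2 * (mode_eigenvalue p * mode_norm2 p)) \<le> B" for N
  proof -
    have "0 \<le> (\<integral>z. (norm (?g z - (\<Sum>p\<in>modes_upto N. a p *\<^sub>R grad_mode p z)))\<^sup>2 \<partial>leb_on open_triangle)" by simp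
    also have "\<dots> = B - 2 * (\<Sum>p\<in>modes_upto N. a p * (mode_eigenvalue p * (a p * mode_norm2 p))) + (\<Sum>p\<in>modes_upto N. (a p)\<^sup>2 * (mode_eigenvalue p * mode_norm2 p))"
      unfolding B_def using grad_mode_gram QNok ag by (intro L2_expand[OF finite_modes_upto Lg grad_mode_L2]) blast+
    also have "(\<Sum>p\<in>modes_upto N. a p * (mode_eigenvalue p * (a p * mode_norm2 p))) = (\<Sum>p\<in>modes_upto N. (a p)\<^sup>2 * (mode_eigenvalue p * mode_norm2 p))"
      by (intro sum.cong) (auto simp: power2_eq_square)
    finally show ?thesis by simp
  qed
  \<comment> \<open>w is close to a C1 function v, and v is uniformly close to a combination of
    modes. Fourier sums are best approximations, so they do at least as well, and better with more
    modes.\<close>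
  have parseval: "\<exists>N0. \<forall>N\<ge>N0. W - (\<Sum>p\<in>modes_upto N. (a p)\<^sup>2 * mode_norm2 p) < e" if e: "e > 0" for e
  proof -
    \<comment> \<open>K is the area of the triangle. Errors e / 4 and at most e / 8 combine to less
      than 2 (e / 4) + 2 (e / 8), which is below e.\<close>
    define K where "K = (\<integral>z. (1::real) \<partial>leb_on open_triangle)"
    have K0: "K \<ge> 0" by (simp add: K_def)
    define \<delta> where "\<delta> = sqrt (e / (8 * (K + 1)))"
    have d: "\<delta> > 0" "\<delta>\<^sup>2 * K \<le> e / 8"
    proof -
      show "\<delta> > 0" unfolding \<delta>_def using e K0 by simp
      have "\<delta>\<^sup>2 = e / (8 * (K + 1))" unfolding \<delta>_def using e K0 by simp
      then have "\<delta>\<^sup>2 * K = e / 8 * (K / (K + 1))" by simp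
      also have "\<dots> \<le> e / 8 * 1" using e K0 by (intro mult_left_mono) (auto simp: divide_le_eq_1)
      also have "\<dots> = e / 8" by simp
      finally show "\<delta>\<^sup>2 * K \<le> e / 8" .
    qed
    have "e / 4 > 0" using e by simp
    then obtain v G where v: "core_function {} v G" "(\<integral>z. (norm (P z - (v z, G z)))\<^sup>2 \<partial>leb_on open_triangle) < e / 4"
      using P unfolding form_domain_def by blast
    have cv: "continuous_on UNIV v" using v(1) C1_continuous by (auto simp: core_function_def)
    have Lv: "L2 (leb_on open_triangle) v" by (rule L2_continuous[OF open_triangle_bounded open_triangle_sets cv])
    have LP: "L2 (leb_on open_triangle) (\<lambda>z. P z - (v z, G z))" by (rule L2_diff[OF form_domain_L2[OF P] core_pair_L2[OF open_triangle_bounded open_triangle_sets v(1)]])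
    have wv: "(\<integral>z. (norm (?w z - v z))\<^sup>2 \<partial>leb_on open_triangle) < e / 4"
    proof -
      have "(\<integral>z. (norm (?w z - v z))\<^sup>2 \<partial>leb_on open_triangle) \<le> (\<integral>z. (norm (P z - (v z, G z)))\<^sup>2 \<partial>leb_on open_triangle)"
      proof (rule integral_mono[OF L2_norm2_integrable[OF L2_diff[OF Lw Lv]] L2_norm2_integrable[OF LP]])
        fix z
        have "norm (fst (P z - (v z, G z))) \<le> norm (P z - (v z, G z))" by (metis norm_fst_le prod.collapse)
        then show "(norm (?w z - v z))\<^sup>2 \<le> (norm (P z - (v z, G z)))\<^sup>2" by (intro power_mono) auto
      qed
      then show ?thesis using v(2) by linarith
    qed
    obtain N0 c where c: "\<And>z. z \<in> iso_triangle \<Longrightarrow> \<bar>v z - (\<Sum>p\<in>modes_upto N0. c p * mode p z)\<bar> < \<delta>"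
      using phi_dense[OF cv d(1)] by blast
    let ?S = "\<lambda>z. \<Sum>p\<in>modes_upto N0. c p *\<^sub>R mode p z"
    have LS: "L2 (leb_on open_triangle) ?S" by (intro L2_sum L2_scaleR mode_L2)
    have "(\<integral>z. (norm (v z - ?S z))\<^sup>2 \<partial>leb_on open_triangle) \<le> (\<integral>z. \<delta>\<^sup>2 * 1 \<partial>leb_on open_triangle)"
    proof (rule integral_mono[OF L2_norm2_integrable[OF L2_diff[OF Lv LS]]])
      show "integrable (leb_on open_triangle) (\<lambda>z. \<delta>\<^sup>2 * 1)"
        by (rule integrable_leb_on_continuous[OF open_triangle_bounded open_triangle_sets]) (intro continuous_intros)
      fix z assume "z \<in> space (leb_on open_triangle)"
      then have "z \<in> iso_triangle" using open_triangle_subset by (auto simp: space_restrict_space)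
      then have "\<bar>v z - ?S z\<bar> \<le> \<delta>" using c by fastforce
      then show "(norm (v z - ?S z))\<^sup>2 \<le> \<delta>\<^sup>2 * 1" using power_mono[of "\<bar>v z - ?S z\<bar>" \<delta> 2] by simp
    qed
    also have "\<dots> = \<delta>\<^sup>2 * K" unfolding K_def by (rule integral_mult_right_zero)
    finally have vS: "(\<integral>z. (norm (v z - ?S z))\<^sup>2 \<partial>leb_on open_triangle) \<le> e / 8" using d(2) by linarith
    have "(\<integral>z. (norm (?w z - ?S z))\<^sup>2 \<partial>leb_on open_triangle) < e" using L2_triangle2[OF Lw Lv LS] wv vS e by linarith
    then have N0: "W - (\<Sum>p\<in>modes_upto N0. (a p)\<^sup>2 * mode_norm2 p) < e"
    proof -
      have "0 \<le> (\<Sum>p\<in>modes_upto N0. (c p - a p)\<^sup>2 * mode_norm2 p)" by (intro sum_nonneg mult_nonneg_nonneg) (auto intro: less_imp_le[OF mode_norm2_pos])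
      moreover have "(\<integral>z. (norm (?w z - ?S z))\<^sup>2 \<partial>leb_on open_triangle) = W - (\<Sum>p\<in>modes_upto N0. (a p)\<^sup>2 * mode_norm2 p) + (\<Sum>p\<in>modes_upto N0. (c p - a p)\<^sup>2 * mode_norm2 p)"
        by (rule exp_w[OF finite_modes_upto QNok])
      ultimately show ?thesis using \<open>(\<integral>z. (norm (?w z - ?S z))\<^sup>2 \<partial>leb_on open_triangle) < e\<close> by linarith
    qed
    have "W - (\<Sum>p\<in>modes_upto N. (a p)\<^sup>2 * mode_norm2 p) < e" if "N \<ge> N0" for N
    proof -
      have "(\<Sum>p\<in>modes_upto N0. (a p)\<^sup>2 * mode_norm2 p) \<le> (\<Sum>p\<in>modes_upto N. (a p)\<^sup>2 * mode_norm2 p)"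
        using modes_upto_mono[OF that] by (intro sum_mono2) (auto intro: mult_nonneg_nonneg less_imp_le[OF mode_norm2_pos])
      then show ?thesis using N0 by linarith
    qed
    then show ?thesis by blast
  qed
  have a0: "a p = 0" if p: "snd p \<le> fst p" "mode_eigenvalue p \<noteq> \<mu>" for p
  proof -
    have nn: "0 \<le> (mode_eigenvalue q - \<mu>) * ((a q)\<^sup>2 * mode_norm2 q)" if "snd q \<le> fst q" for q
    proof (cases "mode_eigenvalue q < \<mu>")
      case True
      then have "a q = 0" using low[of q] that by (simp add: modes_below_def a_def)
      then show ?thesis by simp
    qed (auto intro!: mult_nonneg_nonneg less_imp_le[OF mode_norm2_pos])
    \<comment> \<open>One term of a sum with nonnegative terms is at most the sum, which is
      controlled by \<mu> times the Parseval defect. The absolute value is there because the sign of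
      \<mu> is arbitrary.\<close>
    have "(mode_eigenvalue p - \<mu>) * ((a p)\<^sup>2 * mode_norm2 p) \<le> \<bar>\<mu>\<bar> * e" if e: "e > 0" for e
    proof -
      obtain N0 where N0: "\<And>N. N \<ge> N0 \<Longrightarrow> W - (\<Sum>p\<in>modes_upto N. (a p)\<^sup>2 * mode_norm2 p) < e" using parseval[OF e] by blast
      define N where "N = max N0 (fst p)"
      have pN: "p \<in> modes_upto N" using p(1) by (simp add: modes_upto_def N_def)
      have "(mode_eigenvalue p - \<mu>) * ((a p)\<^sup>2 * mode_norm2 p) \<le> (\<Sum>q\<in>modes_upto N. (mode_eigenvalue q - \<mu>) * ((a q)\<^sup>2 * mode_norm2 q))"
        using pN nn QNok by (intro member_le_sum) auto
      also have "\<dots> = (\<Sum>q\<in>modes_upto N. (a q)\<^sup>2 * (mode_eigenvalue q * mode_norm2 q)) - \<mu> * (\<Sum>q\<in>modes_upto N. (a q)\<^sup>2 * mode_norm2 q)"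
        by (simp add: sum_subtractf[symmetric] sum_distrib_left algebra_simps)
      also have "\<dots> \<le> \<mu> * (W - (\<Sum>q\<in>modes_upto N. (a q)\<^sup>2 * mode_norm2 q))" using bessg[of N] unfolding BW by (simp add: right_diff_distrib)
      also have "\<dots> \<le> \<bar>\<mu>\<bar> * (W - (\<Sum>q\<in>modes_upto N. (a q)\<^sup>2 * mode_norm2 q))" using bess[of N] by (intro mult_right_mono) auto
      also have "\<dots> \<le> \<bar>\<mu>\<bar> * e" using N0[of N] by (intro mult_left_mono) (auto simp: N_def)
      finally show ?thesis .
    qed
    then have "(mode_eigenvalue p - \<mu>) * ((a p)\<^sup>2 * mode_norm2 p) \<le> 0" by (rule le_all_epsilon[OF _ abs_ge_zero])
    then have "(mode_eigenvalue p - \<mu>) * ((a p)\<^sup>2 * mode_norm2 p) = 0" using nn[OF p(1)] by linarith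
    then show ?thesis using p(2) mode_norm2_pos[of p] by simp
  qed
  have "(\<integral>z. (norm (?w z - (\<Sum>p\<in>modes_at \<mu>. a p *\<^sub>R mode p z)))\<^sup>2 \<partial>leb_on open_triangle) \<le> 1 * e" if e: "e > 0" for e
  proof -
    obtain N0 where N0: "\<And>N. N \<ge> N0 \<Longrightarrow> W - (\<Sum>p\<in>modes_upto N. (a p)\<^sup>2 * mode_norm2 p) < e" using parseval[OF e] by blast
    define N where "N = max N0 (nat \<lfloor>\<mu>\<rfloor>)"
    have "modes_at \<mu> \<subseteq> modes_upto N" using modes_at_subset[of \<mu>] modes_upto_mono[of "nat \<lfloor>\<mu>\<rfloor>" N] by (auto simp: N_def)
    then have "(\<Sum>p\<in>modes_at \<mu>. (a p)\<^sup>2 * mode_norm2 p) = (\<Sum>p\<in>modes_upto N. (a p)\<^sup>2 * mode_norm2 p)"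
    proof (rule sum.mono_neutral_left[OF finite_modes_upto], intro ballI)
      fix p assume "p \<in> modes_upto N - modes_at \<mu>"
      then have "snd p \<le> fst p" "mode_eigenvalue p \<noteq> \<mu>" by (auto simp: modes_upto_def modes_at_def)
      from a0[OF this] show "(a p)\<^sup>2 * mode_norm2 p = 0" by simp
    qed
    moreover have "(\<integral>z. (norm (?w z - (\<Sum>p\<in>modes_at \<mu>. a p *\<^sub>R mode p z)))\<^sup>2 \<partial>leb_on open_triangle) = W - (\<Sum>p\<in>modes_at \<mu>. (a p)\<^sup>2 * mode_norm2 p)"
    proof -
      have "(\<integral>z. (norm (?w z - (\<Sum>p\<in>modes_at \<mu>. a p *\<^sub>R mode p z)))\<^sup>2 \<partial>leb_on open_triangle) = W - (\<Sum>p\<in>modes_at \<mu>. (a p)\<^sup>2 * mode_norm2 p) + (\<Sum>p\<in>modes_at \<mu>. (a p - a p)\<^sup>2 * mode_norm2 p)"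
        by (rule exp_w[OF finite_modes_at]) (simp add: modes_at_def)
      then show ?thesis by simp
    qed
    ultimately show ?thesis using N0[of N] by (simp add: N_def)
  qed
  then have "(\<integral>z. (norm (?w z - (\<Sum>p\<in>modes_at \<mu>. a p *\<^sub>R mode p z)))\<^sup>2 \<partial>leb_on open_triangle) \<le> 0" by (rule le_all_epsilon[OF _ zero_le_one])
  then have z: "(\<integral>z. (norm (?w z - (\<Sum>p\<in>modes_at \<mu>. a p *\<^sub>R mode p z)))\<^sup>2 \<partial>leb_on open_triangle) = 0" by (intro antisym) auto
  have "L2 (leb_on open_triangle) (\<lambda>z. ?w z - (\<Sum>p\<in>modes_at \<mu>. a p *\<^sub>R mode p z))" by (intro L2_diff Lw L2_sum L2_scaleR mode_L2)
  from integral_nonneg_eq_0_iff_AE[OF L2_norm2_integrable[OF this]] z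
  have "AE z in leb_on open_triangle. (norm (?w z - (\<Sum>p\<in>modes_at \<mu>. a p *\<^sub>R mode p z)))\<^sup>2 = 0" by simp
  then have "AE z in leb_on open_triangle. ?w z = (\<Sum>p\<in>modes_at \<mu>. a p * mode p z)" by eventually_elim simp
  then show ?thesis by blast
qed

section \<open>Neumann eigenspaces and frames\<close>

lemma weak_pair_add:
  assumes B: "bounded \<Omega>" "\<Omega> \<in> sets borel" and P: "weak_pair \<Omega> \<Gamma> \<mu> P" and Q: "weak_pair \<Omega> \<Gamma> \<mu> Q"
  shows "weak_pair \<Omega> \<Gamma> \<mu> (\<lambda>z. P z + Q z)"
  unfolding weak_pair_def
proof (intro conjI allI impI)
  have form_domain: "form_domain \<Omega> \<Gamma> P" "form_domain \<Omega> \<Gamma> Q" using P Q by (simp_all add: weak_pair_def)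
  show "form_domain \<Omega> \<Gamma> (\<lambda>z. P z + Q z)" by (rule form_domain_add[OF B form_domain])
  fix V assume V: "form_domain \<Omega> \<Gamma> V"
  have twist: "twist \<mu> (p + q) \<bullet> v = twist \<mu> p \<bullet> v + twist \<mu> q \<bullet> v" for p q v
    by (simp add: twist_inner inner_add_left algebra_simps)
  show "(\<integral>z. twist \<mu> (P z + Q z) \<bullet> V z \<partial>leb_on \<Omega>) = 0"
    unfolding twist using P Q V L2_inner_integrable[OF L2_bounded_linear[OF bounded_linear_twist form_domain_L2[OF form_domain(1)]] form_domain_L2[OF V]]
      L2_inner_integrable[OF L2_bounded_linear[OF bounded_linear_twist form_domain_L2[OF form_domain(2)]] form_domain_L2[OF V]]
    by (simp add: weak_pair_def)
qed

lemma weak_pair_scaleR: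
  assumes P: "weak_pair \<Omega> \<Gamma> \<mu> P"
  shows "weak_pair \<Omega> \<Gamma> \<mu> (\<lambda>z. c *\<^sub>R P z)"
  unfolding weak_pair_def
proof (intro conjI allI impI)
  show "form_domain \<Omega> \<Gamma> (\<lambda>z. c *\<^sub>R P z)" using P by (intro form_domain_scaleR) (simp add: weak_pair_def)
  fix V assume V: "form_domain \<Omega> \<Gamma> V"
  have twist: "twist \<mu> (c *\<^sub>R p) \<bullet> v = c * (twist \<mu> p \<bullet> v)" for p v
    by (simp add: twist_inner algebra_simps)
  show "(\<integral>z. twist \<mu> (c *\<^sub>R P z) \<bullet> V z \<partial>leb_on \<Omega>) = 0"
    unfolding twist using P V by (simp add: weak_pair_def)
qed

lemma weak_pair_zero:
  assumes B: "bounded \<Omega>" "\<Omega> \<in> sets borel"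
  shows "weak_pair \<Omega> \<Gamma> \<mu> (\<lambda>z. 0)"
  unfolding weak_pair_def using form_domain_zero[OF B] by simp

lemma weak_pair_sum:
  assumes B: "bounded \<Omega>" "\<Omega> \<in> sets borel" and P: "\<And>i. i \<in> I \<Longrightarrow> weak_pair \<Omega> \<Gamma> \<mu> (P i)"
  shows "weak_pair \<Omega> \<Gamma> \<mu> (\<lambda>z. \<Sum>i\<in>I. P i z)"
  using P by (induction I rule: infinite_finite_induct) (auto intro: weak_pair_add[OF B] weak_pair_zero[OF B])

lemma weak_pair_cong:
  assumes "\<And>z. z \<in> \<Omega> \<Longrightarrow> P z = Q z" "weak_pair \<Omega> \<Gamma> \<mu> P"
  shows "weak_pair \<Omega> \<Gamma> \<mu> Q"
proof -
  have "(\<integral>z. twist \<mu> (Q z) \<bullet> V z \<partial>leb_on \<Omega>) = (\<integral>z. twist \<mu> (P z) \<bullet> V z \<partial>leb_on \<Omega>)" for V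
    using assms(1) by (intro Bochner_Integration.integral_cong) (auto simp: space_restrict_space)
  then show ?thesis using assms(2) form_domain_cong[OF assms(1)] unfolding weak_pair_def by auto
qed

lemma sum_function: "(\<Sum>i\<in>I. f i) x = (\<Sum>i\<in>I. f i x)"
  by (induction I rule: infinite_finite_induct) auto

text \<open>Members of \<open>eigenspace\<close> are 0 off the domain, so a basis has to consist of
  modes cut off there.\<close>

definition mode0 :: "nat \<times> nat \<Rightarrow> real \<times> real \<Rightarrow> real" where
  "mode0 p = (\<lambda>z. if z \<in> open_triangle then mode p z else 0)"

lemma mode_lincomb_weak_pair:
  "weak_pair open_triangle {} \<mu> (\<lambda>z. \<Sum>p\<in>modes_at \<mu>. a p *\<^sub>R (mode p z, grad_mode p z))"
proof (rule weak_pair_sum[OF open_triangle_bounded open_triangle_sets weak_pair_scaleR])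
  fix p assume "p \<in> modes_at \<mu>"
  then have "real ((fst p)\<^sup>2 + (snd p)\<^sup>2) = \<mu>" by (simp add: modes_at_def mode_eigenvalue_def)
  then show "weak_pair open_triangle {} \<mu> (\<lambda>z. (mode p z, grad_mode p z))" using phi_weak_pair[of "fst p" "snd p"] by simp
qed

lemma mode_lincomb_eigenspace:
  "(\<lambda>z. if z \<in> open_triangle then (\<Sum>p\<in>modes_at \<mu>. a p * mode p z) else 0) \<in> eigenspace open_triangle {} \<mu>"
proof -
  let ?u = "\<lambda>z. if z \<in> open_triangle then (\<Sum>p\<in>modes_at \<mu>. a p * mode p z) else 0"
  have "weak_pair open_triangle {} \<mu> (\<lambda>z. (?u z, \<Sum>p\<in>modes_at \<mu>. a p *\<^sub>R grad_mode p z))"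
    by (rule weak_pair_cong[OF _ mode_lincomb_weak_pair[of \<mu> a]]) (simp add: prod_eq_iff fst_sum snd_sum)
  moreover have "continuous_on open_triangle ?u"
  proof -
    have "continuous_on open_triangle (\<lambda>z. \<Sum>p\<in>modes_at \<mu>. a p * mode p z)"
      by (intro continuous_intros continuous_on_subset[OF phi_continuous]) auto
    then show ?thesis by (rule continuous_on_eq) simp
  qed
  ultimately show ?thesis unfolding eigenspace_def weak_iff[OF open_triangle_bounded open_triangle_sets] by auto
qed

text \<open>An eigenfunction meets the hypotheses of \<open>neumann_extremal\<close>: tested with
  itself its form is 0, and tested with a lower mode it yields (\<open>mode_eigenvalue p\<close> -
  \<mu>) times the inner product = 0. Continuity turns the resulting equality almost everywhere into
  equality.\<close>

lemma neumann_eigenfunction: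
  assumes u: "u \<in> eigenspace open_triangle {} \<mu>"
  shows "\<exists>a. u = (\<lambda>z. if z \<in> open_triangle then (\<Sum>p\<in>modes_at \<mu>. a p * mode p z) else 0)"
proof -
  have cu: "continuous_on open_triangle u" and off: "\<And>z. z \<notin> open_triangle \<Longrightarrow> u z = 0" using u by (auto simp: eigenspace_def)
  obtain g where w: "weak_pair open_triangle {} \<mu> (\<lambda>z. (u z, g z))"
    using u unfolding eigenspace_def weak_iff[OF open_triangle_bounded open_triangle_sets] by blast
  have F: "form_domain open_triangle {} (\<lambda>z. (u z, g z))" using w by (simp add: weak_pair_def)
  have q: "(\<integral>z. twist \<mu> (u z, g z) \<bullet> (u z, g z) \<partial>leb_on open_triangle) = 0" using w F unfolding weak_pair_def by blast
  have low: "(\<integral>z. mode p z * fst (u z, g z) \<partial>leb_on open_triangle) = 0" if p: "p \<in> modes_below \<mu>" for p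
  proof -
    have "(\<integral>z. twist \<mu> (u z, g z) \<bullet> (mode p z, grad_mode p z) \<partial>leb_on open_triangle) = 0" using w mode_FD[of p] unfolding weak_pair_def by blast
    then have "(\<integral>z. grad_mode p z \<bullet> g z - \<mu> * (mode p z * u z) \<partial>leb_on open_triangle) = 0" by (simp add: twist_inner inner_commute mult.commute)
    moreover have "integrable (leb_on open_triangle) (\<lambda>z. grad_mode p z \<bullet> g z)" "integrable (leb_on open_triangle) (\<lambda>z. mode p z * u z)"
      using L2_inner_integrable[OF grad_mode_L2[of p] L2_snd[OF form_domain_L2[OF F]]] L2_inner_integrable[OF mode_L2[of p] L2_fst[OF form_domain_L2[OF F]]] by simp_all
    ultimately have "(\<integral>z. grad_mode p z \<bullet> g z \<partial>leb_on open_triangle) = \<mu> * (\<integral>z. mode p z * u z \<partial>leb_on open_triangle)" by simp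
    then have "(mode_eigenvalue p - \<mu>) * (\<integral>z. mode p z * u z \<partial>leb_on open_triangle) = 0" using grad_mode_test[OF F, of p] unfolding left_diff_distrib fst_conv snd_conv by linarith
    then show ?thesis using p by (simp add: modes_below_def)
  qed
  obtain a where a: "AE z in leb_on open_triangle. fst (u z, g z) = (\<Sum>p\<in>modes_at \<mu>. a p * mode p z)"
    using neumann_extremal[OF F q low] by blast
  then have "AE z in lborel. z \<in> open_triangle \<longrightarrow> u z = (\<Sum>p\<in>modes_at \<mu>. a p * mode p z)" using open_triangle_sets by (subst (asm) AE_restrict_space_iff) auto
  then have ae: "AE z in lborel. z \<in> open_triangle \<longrightarrow> u z - (\<Sum>p\<in>modes_at \<mu>. a p * mode p z) = 0" by eventually_elim auto
  have "u z - (\<Sum>p\<in>modes_at \<mu>. a p * mode p z) = 0" if "z \<in> open_triangle" for z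
    by (rule AE_zero_continuous[OF open_triangle_open _ ae that]) 
       (intro continuous_intros cu continuous_on_subset[OF phi_continuous], auto)
  then have "u = (\<lambda>z. if z \<in> open_triangle then (\<Sum>p\<in>modes_at \<mu>. a p * mode p z) else 0)" using off by (auto simp: fun_eq_iff)
  then show ?thesis by blast
qed

lemma mode_independent:
  assumes A: "finite A" "\<And>p. p \<in> A \<Longrightarrow> snd p \<le> fst p" and z: "\<And>z. z \<in> open_triangle \<Longrightarrow> (\<Sum>p\<in>A. c p * mode p z) = 0" and q: "q \<in> A"
  shows "c q = 0"
proof -
  have "(\<integral>z. (norm (0 - (\<Sum>p\<in>A. c p *\<^sub>R mode p z)))\<^sup>2 \<partial>leb_on open_triangle) = (\<integral>z. (norm (0::real))\<^sup>2 \<partial>leb_on open_triangle) - 2 * (\<Sum>p\<in>A. c p * 0) + (\<Sum>p\<in>A. (c p)\<^sup>2 * mode_norm2 p)"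
  proof (rule L2_expand[OF A(1) L2_zero mode_L2])
    show "(\<integral>x. 0 \<bullet> mode p x \<partial>leb_on open_triangle) = 0" for p by simp
    show "(\<integral>x. mode p x \<bullet> mode q x \<partial>leb_on open_triangle) = (if p = q then mode_norm2 p else 0)" if "p \<in> A" "q \<in> A" for p q
      by (rule mode_gram[OF A(2)[OF that(1)] A(2)[OF that(2)]])
  qed
  moreover have "(\<integral>z. (norm (0 - (\<Sum>p\<in>A. c p *\<^sub>R mode p z)))\<^sup>2 \<partial>leb_on open_triangle) = (\<integral>z. 0 \<partial>leb_on open_triangle)"
    using z by (intro Bochner_Integration.integral_cong) (auto simp: space_restrict_space)
  ultimately have "(\<Sum>p\<in>A. (c p)\<^sup>2 * mode_norm2 p) = 0" by simp
  then have "(c q)\<^sup>2 * mode_norm2 q = 0"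
    using q sum_nonneg_eq_0_iff[OF A(1), of "\<lambda>p. (c p)\<^sup>2 * mode_norm2 p"] mult_nonneg_nonneg[OF zero_le_power2 less_imp_le[OF mode_norm2_pos]] by blast
  then show ?thesis using mode_norm2_pos[of q] by simp
qed

lemma mode0_inj: "inj_on mode0 (modes_at \<mu>)"
proof (rule inj_onI, rule ccontr)
  fix p q assume pq: "p \<in> modes_at \<mu>" "q \<in> modes_at \<mu>" "mode0 p = mode0 q" "p \<noteq> q"
  have "(if p = p then 1 else - 1 :: real) = 0"
  proof (rule mode_independent[of "{p, q}" "\<lambda>r. if r = p then 1 else - 1"])
    fix z assume z: "z \<in> open_triangle"
    have "mode p z = mode q z" using fun_cong[OF pq(3), of z] z by (simp add: mode0_def)
    then show "(\<Sum>r\<in>{p, q}. (if r = p then 1 else - 1) * mode r z) = 0" using pq(4) by simp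
  qed (use pq in \<open>auto simp: modes_at_def\<close>)
  then show False by simp
qed

lemma mode0_sum: "(\<Sum>p\<in>modes_at \<mu>. c p * mode0 p z) = (if z \<in> open_triangle then (\<Sum>p\<in>modes_at \<mu>. c p * mode p z) else 0)"
proof (cases "z \<in> open_triangle")
  case True
  then show ?thesis by (simp add: mode0_def)
next
  case False
  then have "mode0 p z = 0" for p unfolding mode0_def by (rule if_not_P)
  then show ?thesis using False by (simp only: mult_zero_right sum.neutral_const if_False)
qed

lemma mode0_independent: "\<not> fun_space.dependent (mode0 ` modes_at \<mu>)"
proof (rule fun_space.independent_if_scalars_zero)
  show "finite (mode0 ` modes_at \<mu>)" using finite_modes_at by simp
  fix f x assume s: "(\<Sum>v\<in>mode0 ` modes_at \<mu>. (\<lambda>z. f v * v z)) = 0" and x: "x \<in> mode0 ` modes_at \<mu>"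
  obtain q where q: "q \<in> modes_at \<mu>" "x = mode0 q" using x by blast
  have "f (mode0 q) = 0"
  proof (rule mode_independent[OF finite_modes_at _ _ q(1)])
    fix z assume z: "z \<in> open_triangle"
    have "0 = (\<Sum>v\<in>mode0 ` modes_at \<mu>. (\<lambda>z. f v * v z)) z" using s by simp
    also have "\<dots> = (\<Sum>p\<in>modes_at \<mu>. f (mode0 p) * mode0 p z)" unfolding sum_function sum.reindex[OF mode0_inj] by simp
    also have "\<dots> = (\<Sum>p\<in>modes_at \<mu>. f (mode0 p) * mode p z)" using z by (simp add: mode0_sum)
    finally show "(\<Sum>p\<in>modes_at \<mu>. f (mode0 p) * mode p z) = 0" by simp
  qed (simp add: modes_at_def)
  then show "f x = 0" using q(2) by simp
qed

lemma neumann_eigenspace_span: "eigenspace open_triangle {} \<mu> = fun_space.span (mode0 ` modes_at \<mu>)"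
proof -
  have fin: "finite (mode0 ` modes_at \<mu>)" using finite_modes_at by simp
  show ?thesis
  proof
    show "eigenspace open_triangle {} \<mu> \<subseteq> fun_space.span (mode0 ` modes_at \<mu>)"
    proof
      fix u assume "u \<in> eigenspace open_triangle {} \<mu>"
      then obtain a where a: "u = (\<lambda>z. if z \<in> open_triangle then (\<Sum>p\<in>modes_at \<mu>. a p * mode p z) else 0)" using neumann_eigenfunction by blast
      have "u = (\<Sum>p\<in>modes_at \<mu>. (\<lambda>z. a p * mode0 p z))" by (rule ext) (simp only: a sum_function mode0_sum)
      moreover have "(\<Sum>p\<in>modes_at \<mu>. (\<lambda>z. a p * mode0 p z)) \<in> fun_space.span (mode0 ` modes_at \<mu>)"
        by (intro fun_space.span_sum fun_space.span_scale fun_space.span_base) auto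
      ultimately show "u \<in> fun_space.span (mode0 ` modes_at \<mu>)" by simp
    qed
    show "fun_space.span (mode0 ` modes_at \<mu>) \<subseteq> eigenspace open_triangle {} \<mu>"
    proof
      fix u assume "u \<in> fun_space.span (mode0 ` modes_at \<mu>)"
      then obtain f where f: "u = (\<Sum>v\<in>mode0 ` modes_at \<mu>. (\<lambda>z. f v * v z))" unfolding fun_space.span_finite[OF fin] by blast
      have "u = (\<lambda>z. if z \<in> open_triangle then (\<Sum>p\<in>modes_at \<mu>. f (mode0 p) * mode p z) else 0)"
        by (rule ext) (simp only: f sum_function sum.reindex[OF mode0_inj] comp_def mode0_sum)
      then show "u \<in> eigenspace open_triangle {} \<mu>" using mode_lincomb_eigenspace by simp
    qed
  qed
qed

lemma neumann_multiplicity: "eigenvalue_multiplicity open_triangle {} \<mu> = card (modes_at \<mu>)"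
  unfolding eigenvalue_multiplicity_def neumann_eigenspace_span
  using fun_space.dim_span_eq_card_independent[OF mode0_independent] card_image[OF mode0_inj] by simp

text \<open>Both sets are partitioned by eigenvalue, and corresponding classes have equal size. A
  value of \<open>lam\<close> has positive multiplicity, so it is the eigenvalue of some
  mode.\<close>

lemma count_below:
  assumes "eigenvalue_sequence open_triangle {} lam"
  shows "card {j. lam j < \<mu>} = card (modes_below \<mu>)"
proof -
  have lam: "finite {j. lam j = \<nu>}" "card {j. lam j = \<nu>} = card (modes_at \<nu>)" for \<nu>
    using assms by (auto simp: eigenvalue_sequence_def neumann_multiplicity)
  have 1: "{j. lam j < \<mu>} = (\<Union>\<nu>\<in>mode_eigenvalue ` modes_below \<mu>. {j. lam j = \<nu>})"
  proof
    show "{j. lam j < \<mu>} \<subseteq> (\<Union>\<nu>\<in>mode_eigenvalue ` modes_below \<mu>. {j. lam j = \<nu>})"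
    proof
      fix j assume j: "j \<in> {j. lam j < \<mu>}"
      have "card {i. lam i = lam j} \<noteq> 0" using lam(1)[of "lam j"] by (auto simp: card_eq_0_iff)
      then have "modes_at (lam j) \<noteq> {}" using lam(2)[of "lam j"] by auto
      then obtain p where "p \<in> modes_at (lam j)" by blast
      then have "p \<in> modes_below \<mu>" "lam j = mode_eigenvalue p" using j by (auto simp: modes_at_def modes_below_def)
      then show "j \<in> (\<Union>\<nu>\<in>mode_eigenvalue ` modes_below \<mu>. {j. lam j = \<nu>})" by blast
    qed
  qed (auto simp: modes_below_def)
  have 2: "modes_below \<mu> = (\<Union>\<nu>\<in>mode_eigenvalue ` modes_below \<mu>. modes_at \<nu>)" by (auto simp: modes_below_def modes_at_def)
  have "card {j. lam j < \<mu>} = (\<Sum>\<nu>\<in>mode_eigenvalue ` modes_below \<mu>. card {j. lam j = \<nu>})"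
    unfolding 1 by (rule card_UN_disjoint) (use finite_modes_below lam(1) in auto)
  also have "\<dots> = (\<Sum>\<nu>\<in>mode_eigenvalue ` modes_below \<mu>. card (modes_at \<nu>))" by (simp add: lam(2))
  also have "\<dots> = card (\<Union>\<nu>\<in>mode_eigenvalue ` modes_below \<mu>. modes_at \<nu>)"
    by (rule card_UN_disjoint[symmetric]) (use finite_modes_below finite_modes_at in \<open>auto simp: modes_at_def\<close>)
  finally show ?thesis using 2 by simp
qed

text \<open>The fold map is sqrt 2 times a reflection of the plane, so composing with it doubles
  eigenvalues: the squares of a + b and a - b add up to twice the sum of those of a and b.\<close>

lemma phi_fold:
  assumes "b \<le> a" shows "phi (a + b) (a - b) (x, y) = phi a b (fold_map (x, y))"
proof -
  have eq: "real (a - b) = real a - real b" using assms by simp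
  have "cos (A + C) * cos (B - D) + cos (B + D) * cos (A - C) = cos (A + B) * cos (C - D) + cos (A - B) * cos (C + D)" for A B C D :: real
    by (simp add: cos_add cos_diff algebra_simps)
  from this[of "a * x" "b * x" "a * y" "b * y"] show ?thesis
    unfolding phi_def fold_map_def eq by (simp add: algebra_simps)
qed

lemma cos_nat_pi_minus: "cos (real m * (pi - t)) = (- 1) ^ m * cos (real m * t)"
  by (simp add: right_diff_distrib cos_diff cos_npi)

text \<open>Modes with m + n odd are antisymmetric across L, hence vanish on it; the others are
  symmetric.\<close>

lemma phi_refl: "phi m n (refl_L z) = (- 1) ^ (m + n) * phi m n z"
  by (cases z) (simp only: phi_def refl_L_def prod.case fst_conv snd_conv cos_nat_pi_minus power_add, simp add: algebra_simps)

lemma fold_in_triangle: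
  "z \<in> half_triangle \<Longrightarrow> fold_map z \<in> iso_triangle"
  "z \<in> iso_triangle - half_triangle \<Longrightarrow> fold_map (refl_L z) \<in> iso_triangle"
  by (auto simp: half_triangle_def iso_triangle_def fold_map_def refl_L_def)

lemma phi_fold_refl:
  assumes "b \<le> a" shows "phi (a + b) (a - b) z = phi a b (fold_map (refl_L z))"
proof -
  have "(a + b) + (a - b) = 2 * a" using assms by simp
  then have "phi (a + b) (a - b) (refl_L z) = phi (a + b) (a - b) z" unfolding phi_refl by (simp add: power_mult)
  then show ?thesis using phi_fold[OF assms, of "fst (refl_L z)" "snd (refl_L z)"] by simp
qed

lemma unfold_zero_set:
  assumes "b \<le> a" "A = iso_triangle \<inter> {z. phi a b z = 0}"
  shows "unfold_set A = iso_triangle \<inter> {z. phi (a + b) (a - b) z = 0}"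
proof -
  have "half_triangle \<subseteq> iso_triangle" by (auto simp: half_triangle_def)
  moreover have "fold_map z \<in> A \<longleftrightarrow> phi (a + b) (a - b) z = 0" if "z \<in> half_triangle" for z
    using fold_in_triangle(1)[OF that] phi_fold[OF assms(1), of "fst z" "snd z"] assms(2) by simp
  moreover have "fold_map (refl_L z) \<in> A \<longleftrightarrow> phi (a + b) (a - b) z = 0" if "z \<in> iso_triangle - half_triangle" for z
    using fold_in_triangle(2)[OF that] phi_fold_refl[OF assms(1), of z] assms(2) by simp
  ultimately show ?thesis unfolding unfold_set_def by blast
qed

lemma unfold_vanish:
  assumes "b \<le> a" "\<And>z. z \<in> A \<Longrightarrow> phi a b z = 0" "z \<in> unfold_set A"
  shows "phi (a + b) (a - b) z = 0"
  using assms(3) unfolding unfold_set_def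
proof
  assume "z \<in> {z \<in> half_triangle. fold_map z \<in> A}"
  then show ?thesis using phi_fold[OF assms(1), of "fst z" "snd z"] assms(2) by simp
next
  assume "z \<in> {z \<in> iso_triangle - half_triangle. fold_map (refl_L z) \<in> A}"
  then show ?thesis using phi_fold_refl[OF assms(1), of z] assms(2) by simp
qed

lemma segment_L_zero_set: "segment_L = iso_triangle \<inter> {z. phi 1 0 z = 0}"
proof -
  have "x + y = pi \<longleftrightarrow> cos x + cos y = 0" if "0 \<le> y" "y \<le> x" "x \<le> pi" for x y
  proof
    assume "x + y = pi"
    then have "x = pi - y" by simp
    then show "cos x + cos y = 0" by simp
  next
    assume "cos x + cos y = 0"
    then have "cos x = cos (pi - y)" by simp
    then have "x = pi - y" using that cos_inj_pi[of x "pi - y"] by (simp del: cos_pi_minus)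
    then show "x + y = pi" by simp
  qed
  note key = this
  have "(x, y) \<in> segment_L \<longleftrightarrow> (x, y) \<in> iso_triangle \<inter> {z. phi 1 0 z = 0}" for x y
  proof (cases "(x, y) \<in> iso_triangle")
    case True
    then show ?thesis using key[of y x] by (simp add: segment_L_def iso_triangle_def phi_def)
  qed (simp add: segment_L_def)
  then show ?thesis by (auto simp only: set_eq_iff split_paired_All)
qed

lemma frame_zero_set: "\<exists>a b. b \<le> a \<and> 0 < a \<and> frame k = iso_triangle \<inter> {z. phi a b z = 0}"
proof (induction k)
  case 0
  show ?case using segment_L_zero_set by (intro exI[of _ 1] exI[of _ 0]) (simp add: frame_def)
next
  case (Suc k)
  then obtain a b where ab: "b \<le> a" "0 < a" "frame k = iso_triangle \<inter> {z. phi a b z = 0}" by blast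
  have "frame (Suc k) = unfold_set (frame k)" by (simp add: frame_def)
  then have "frame (Suc k) = iso_triangle \<inter> {z. phi (a + b) (a - b) z = 0}" using unfold_zero_set[OF ab(1,3)] by simp
  then show ?case using ab by (intro exI[of _ "a + b"] exI[of _ "a - b"]) auto
qed

lemma phi_vanishes_on_frame:
  assumes "odd l" "n \<le> m" "m\<^sup>2 + n\<^sup>2 = 2 ^ k * l" "z \<in> frame k"
  shows "phi m n z = 0"
  using assms(2-4)
proof (induction k arbitrary: m n z)
  case 0
  then have "odd (m\<^sup>2 + n\<^sup>2)" using assms(1) by simp
  then have "odd (m + n)" by simp
  moreover have "refl_L z = z" using 0 by (auto simp: frame_def segment_L_def refl_L_def)
  ultimately show ?case using phi_refl[of m n z] by simp
next
  case (Suc k)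
  have "even (m\<^sup>2 + n\<^sup>2)" using Suc.prems(2) by simp
  then have mode_eigenvalue: "even (m + n)" "even (m - n)" using Suc.prems(1) by auto
  define a where "a = (m + n) div 2"
  define b where "b = (m - n) div 2"
  have ab: "2 * a = m + n" "2 * b = m - n" using mode_eigenvalue by (simp_all add: a_def b_def)
  then have mn: "m = a + b" "n = a - b" "b \<le> a" using Suc.prems(1) by auto
  obtain c where c: "a = b + c" using mn(3) le_Suc_ex by blast
  have "2 * (a\<^sup>2 + b\<^sup>2) = m\<^sup>2 + n\<^sup>2" unfolding mn c by (simp add: power2_eq_square algebra_simps)
  then have "a\<^sup>2 + b\<^sup>2 = 2 ^ k * l" using Suc.prems(2) by simp
  then have "phi a b w = 0" if "w \<in> frame k" for w using Suc.IH mn(3) that by blast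
  moreover have "z \<in> unfold_set (frame k)" using Suc.prems(3) by (simp add: frame_def)
  ultimately show ?case using unfold_vanish[OF mn(3)] mn(1,2) by blast
qed

section \<open>Simplicity of Courant-sharp eigenvalues\<close>

lemma homogeneous_system:
  fixes A :: "'j \<Rightarrow> 'i \<Rightarrow> real"
  assumes "finite J" "finite I" "card J < card I"
  shows "\<exists>c. (\<exists>i\<in>I. c i \<noteq> 0) \<and> (\<forall>j\<in>J. (\<Sum>i\<in>I. A j i * c i) = 0)"
  using assms
proof (induction J arbitrary: I A rule: finite_induct)
  case empty
  then obtain i where "i \<in> I" by fastforce
  then show ?case by (intro exI[of _ "\<lambda>_. 1"]) auto
next
  case (insert j J)
  show ?case
  proof (cases "\<forall>i\<in>I. A j i = 0")
    case True
    have "card J < card I" using insert by simp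
    from insert.IH[OF insert.prems(1) this, of A] obtain c where c: "\<exists>i\<in>I. c i \<noteq> 0" "\<forall>k\<in>J. (\<Sum>i\<in>I. A k i * c i) = 0" by blast
    have "(\<Sum>i\<in>I. A j i * c i) = 0" using True by (intro sum.neutral) auto
    then show ?thesis using c by blast
  next
    case False
    then obtain i0 where i0: "i0 \<in> I" "A j i0 \<noteq> 0" by blast
    define I' where "I' = I - {i0}"
    have fI': "finite I'" "card J < card I'" "i0 \<notin> I'" "I = insert i0 I'"
      using insert.prems insert.hyps i0 by (auto simp: I'_def)
    define A' where "A' k i = A k i - A k i0 * A j i / A j i0" for k i
    obtain c where c: "\<exists>i\<in>I'. c i \<noteq> 0" "\<forall>k\<in>J. (\<Sum>i\<in>I'. A' k i * c i) = 0"
      using insert.IH[OF fI'(1,2), of A'] by blast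
    define c0 where "c0 = - (\<Sum>i\<in>I'. A j i * c i) / A j i0"
    define d where "d i = (if i = i0 then c0 else c i)" for i
    have sd: "(\<Sum>i\<in>I. A k i * d i) = A k i0 * c0 + (\<Sum>i\<in>I'. A k i * c i)" for k
    proof -
      have "(\<Sum>i\<in>I'. A k i * d i) = (\<Sum>i\<in>I'. A k i * c i)" using fI'(3) by (intro sum.cong) (auto simp: d_def)
      then show ?thesis unfolding fI'(4) using fI' by (simp add: d_def)
    qed
    have "(\<Sum>i\<in>I. A k i * d i) = 0" if k: "k \<in> insert j J" for k
    proof (cases "k = j")
      case True
      then show ?thesis unfolding sd using i0 by (simp add: c0_def)
    next
      case False
      then have "0 = (\<Sum>i\<in>I'. A' k i * c i)" using c(2) k by simp
      also have "\<dots> = (\<Sum>i\<in>I'. A k i * c i - A k i0 / A j i0 * (A j i * c i))"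
        by (intro sum.cong) (auto simp: A'_def algebra_simps)
      also have "\<dots> = (\<Sum>i\<in>I'. A k i * c i) - A k i0 / A j i0 * (\<Sum>i\<in>I'. A j i * c i)"
        by (simp add: sum_subtractf sum_distrib_left)
      finally show ?thesis unfolding sd by (simp add: c0_def)
    qed
    moreover have "\<exists>i\<in>I. d i \<noteq> 0" using c(1) fI' by (auto simp: d_def)
    ultimately show ?thesis by blast
  qed
qed

lemma eigenspace_add_scaled:
  assumes B: "bounded \<Omega>" "\<Omega> \<in> sets borel" and u: "u \<in> eigenspace \<Omega> \<Gamma> \<mu>" and v: "v \<in> eigenspace \<Omega> \<Gamma> \<mu>"
  shows "(\<lambda>z. u z + c * v z) \<in> eigenspace \<Omega> \<Gamma> \<mu>"
proof -
  obtain g where g: "weak_pair \<Omega> \<Gamma> \<mu> (\<lambda>z. (u z, g z))" using u unfolding eigenspace_def weak_iff[OF B] by blast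
  obtain h where h: "weak_pair \<Omega> \<Gamma> \<mu> (\<lambda>z. (v z, h z))" using v unfolding eigenspace_def weak_iff[OF B] by blast
  have "weak_pair \<Omega> \<Gamma> \<mu> (\<lambda>z. (u z, g z) + c *\<^sub>R (v z, h z))"
    by (rule weak_pair_add[OF B g weak_pair_scaleR[OF h]])
  then have "weak_pair \<Omega> \<Gamma> \<mu> (\<lambda>z. (u z + c * v z, g z + c *\<^sub>R h z))" by simp
  moreover have "continuous_on \<Omega> (\<lambda>z. u z + c * v z)" using u v by (intro continuous_intros) (auto simp: eigenspace_def)
  ultimately show ?thesis using u v unfolding eigenspace_def weak_iff[OF B] by auto
qed

lemma eigenspace_line_simple:
  assumes w: "w \<in> eigenspace \<Omega> \<Gamma> \<mu>" "w \<noteq> 0" and l: "\<And>e. e \<in> eigenspace \<Omega> \<Gamma> \<mu> \<Longrightarrow> \<exists>c. e = (\<lambda>z. c * w z)"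
  shows "simple_eigenvalue \<Omega> \<Gamma> \<mu>"
proof -
  have "fun_space.span {w} = fun_space.span (eigenspace \<Omega> \<Gamma> \<mu>)"
  proof
    show "fun_space.span {w} \<subseteq> fun_space.span (eigenspace \<Omega> \<Gamma> \<mu>)" using w(1) by (intro fun_space.span_mono) auto
    have "eigenspace \<Omega> \<Gamma> \<mu> \<subseteq> fun_space.span {w}"
    proof
      fix e assume "e \<in> eigenspace \<Omega> \<Gamma> \<mu>"
      then obtain c where "e = (\<lambda>z. c * w z)" using l by blast
      then show "e \<in> fun_space.span {w}" using fun_space.span_scale[OF fun_space.span_base[of w "{w}"], of c] by simp
    qed
    then show "fun_space.span (eigenspace \<Omega> \<Gamma> \<mu>) \<subseteq> fun_space.span {w}"
      by (rule fun_space.span_minimal[OF _ fun_space.subspace_span])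
  qed
  moreover have "\<not> fun_space.dependent {w}" using w(2) by (simp add: fun_space.dependent_single)
  ultimately have "fun_space.dim (eigenspace \<Omega> \<Gamma> \<mu>) = card {w}" by (rule fun_space.dim_eq_card)
  then show ?thesis by (simp add: simple_eigenvalue_def eigenvalue_multiplicity_def)
qed

lemma closed_frame: "closed (frame k)"
proof -
  obtain a b where "frame k = iso_triangle \<inter> {z. phi a b z = 0}" using frame_zero_set by blast
  moreover have "closed {z. phi a b z = 0}" by (intro closed_Collect_eq phi_continuous continuous_intros)
  ultimately show ?thesis using compact_iso_triangle by (simp add: closed_Int compact_imp_closed)
qed

text \<open>The frame is the zero set of an eigenfunction of mean zero, which has to change sign.\<close>

lemma frame_disconnects:
  assumes "connected \<Omega>" "\<Omega> \<subseteq> open_triangle - frame k"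
  shows "\<exists>z. z \<in> open_triangle - frame k \<and> z \<notin> \<Omega>"
proof (rule ccontr)
  assume "\<nexists>z. z \<in> open_triangle - frame k \<and> z \<notin> \<Omega>"
  then have eq: "open_triangle - frame k \<subseteq> \<Omega>" by blast
  obtain a b where ab: "b \<le> a" "0 < a" "frame k = iso_triangle \<inter> {z. phi a b z = 0}" using frame_zero_set by blast
  have nz: "phi a b z \<noteq> 0" if "z \<in> \<Omega>" for z using that assms(2) ab(3) open_triangle_subset by blast
  have z0: "phi a b z = 0" if "z \<in> open_triangle" "z \<notin> \<Omega>" for z using that eq ab(3) by blast
  have con: "connected (phi a b ` \<Omega>)" by (rule connected_continuous_image[OF continuous_on_subset[OF phi_continuous] assms(1)]) simp
  have "(\<forall>z\<in>\<Omega>. phi a b z > 0) \<or> (\<forall>z\<in>\<Omega>. phi a b z < 0)"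
  proof (rule ccontr)
    assume "\<not> ((\<forall>z\<in>\<Omega>. phi a b z > 0) \<or> (\<forall>z\<in>\<Omega>. phi a b z < 0))"
    then obtain z z' where z: "z \<in> \<Omega>" "phi a b z \<le> 0" "z' \<in> \<Omega>" "phi a b z' \<ge> 0" by (meson not_less)
    have "0 \<in> phi a b ` \<Omega>" by (rule connectedD_interval[OF con, of "phi a b z" "phi a b z'"]) (use z in auto)
    then show False using nz by force
  qed
  then have "\<exists>s::real. s \<noteq> 0 \<and> (\<forall>z\<in>open_triangle. 0 \<le> s * phi a b z)"
  proof
    assume p: "\<forall>z\<in>\<Omega>. phi a b z > 0"
    have "0 \<le> 1 * phi a b z" if "z \<in> open_triangle" for z
      using p z0[OF that] by (cases "z \<in> \<Omega>") (simp_all add: less_imp_le)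
    then show ?thesis by (intro exI[of _ 1] conjI ballI) simp_all
  next
    assume p: "\<forall>z\<in>\<Omega>. phi a b z < 0"
    have "0 \<le> (- 1) * phi a b z" if "z \<in> open_triangle" for z
      using p z0[OF that] by (cases "z \<in> \<Omega>") (simp_all add: less_imp_le)
    then show ?thesis by (intro exI[of _ "- 1"] conjI ballI) simp_all
  qed
  then obtain s :: real where s: "s \<noteq> 0" "\<And>z. z \<in> open_triangle \<Longrightarrow> 0 \<le> s * phi a b z" by blast
  have i: "integrable (leb_on open_triangle) (\<lambda>z. s * phi a b z)"
    by (rule integrable_leb_on_continuous[OF open_triangle_bounded open_triangle_sets]) (intro continuous_intros phi_continuous)
  have "(\<integral>z. phi a b z * phi 0 0 z \<partial>leb_on open_triangle) = 0" using ab by (intro phi_orthogonal) auto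
  then have "(\<integral>z. s * phi a b z \<partial>leb_on open_triangle) = 0" by (simp add: phi_def[of 0 0])
  moreover have "AE z in leb_on open_triangle. 0 \<le> s * phi a b z" using s(2) by (intro AE_I2) (auto simp: space_restrict_space)
  ultimately have "AE z in leb_on open_triangle. s * phi a b z = 0" using integral_nonneg_eq_0_iff_AE[OF i] by blast
  then have ae: "AE z in leb_on open_triangle. (phi a b z)\<^sup>2 = 0" by eventually_elim (use s(1) in simp)
  have "(\<integral>z. (phi a b z)\<^sup>2 \<partial>leb_on open_triangle) = 0" by (rule integral_eq_zero_AE[OF ae])
  then show False using phi_norm_pos[of a b] by simp
qed

lemma twist_sym: "twist \<mu> p \<bullet> q = twist \<mu> q \<bullet> p"
  unfolding twist_inner inner_commute[of "snd q"] by (simp add: mult.commute)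

lemma twist_sum_scaleR: "twist \<mu> (\<Sum>i\<in>I. c i *\<^sub>R f i) \<bullet> v = (\<Sum>i\<in>I. c i * (twist \<mu> (f i) \<bullet> v))"
proof -
  have lin: "linear (twist \<mu>)" by (rule bounded_linear.linear[OF bounded_linear_twist])
  show ?thesis by (simp add: linear_sum[OF lin] linear_scale[OF lin] inner_sum_left)
qed

locale courant_sharp_eigenfunction =
  fixes k :: nat and l :: nat and \<mu> :: real and U :: "real \<times> real \<Rightarrow> real"
  assumes l: "odd l" and mu: "\<mu> = 2 ^ k * real l"
    and U: "U \<in> eigenspace open_triangle {} \<mu>" "U \<noteq> 0"
    and count: "nodal_count open_triangle U = card (modes_below \<mu>) + 1"
begin

lemma frame_vanish:
  assumes "p \<in> modes_at \<mu>" "z \<in> frame k"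
  shows "mode p z = 0"
proof -
  have "real ((fst p)\<^sup>2 + (snd p)\<^sup>2) = real (2 ^ k * l)" using assms(1) by (simp add: modes_at_def mode_eigenvalue_def mu)
  then have "(fst p)\<^sup>2 + (snd p)\<^sup>2 = 2 ^ k * l" by (simp only: of_nat_eq_iff)
  then show ?thesis using phi_vanishes_on_frame[OF l _ _ assms(2)] assms(1) by (simp add: modes_at_def)
qed

definition lin :: "(nat \<times> nat \<Rightarrow> real) \<Rightarrow> real \<times> real \<Rightarrow> real" where
  "lin a z = (\<Sum>p\<in>modes_at \<mu>. a p * mode p z)"

definition glin :: "(nat \<times> nat \<Rightarrow> real) \<Rightarrow> real \<times> real \<Rightarrow> real \<times> real" where
  "glin a z = (\<Sum>p\<in>modes_at \<mu>. a p *\<^sub>R grad_mode p z)"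

lemma lin_C1: "has_C1_gradient (lin a) (glin a)"
  unfolding lin_def[abs_def] glin_def[abs_def] by (intro C1_sum C1_cmult phi_C1)

lemma lin_frame: "z \<in> frame k \<Longrightarrow> lin a z = 0"
  unfolding lin_def using frame_vanish by (intro sum.neutral) simp

lemma lin_weak_pair: "weak_pair open_triangle {} \<mu> (\<lambda>z. (lin a z, glin a z))"
  by (rule weak_pair_cong[OF _ mode_lincomb_weak_pair[of \<mu> a]]) (simp add: prod_eq_iff fst_sum snd_sum lin_def glin_def)

lemma lin_eigenspace: "(\<lambda>z. if z \<in> open_triangle then lin a z else 0) \<in> eigenspace open_triangle {} \<mu>"
  unfolding lin_def by (rule mode_lincomb_eigenspace)

lemma eigenspace_lin: "f \<in> eigenspace open_triangle {} \<mu> \<Longrightarrow> \<exists>a. f = (\<lambda>z. if z \<in> open_triangle then lin a z else 0)"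
  unfolding lin_def by (rule neumann_eigenfunction)

context
  fixes \<Omega> assumes component: "\<Omega> \<in> components (open_triangle - frame k)"
begin

lemma subdomain_props:
  "open \<Omega>" "\<Omega> \<subseteq> open_triangle" "\<Omega> \<inter> frame k = {}" "connected \<Omega>" "\<Omega> \<noteq> {}" "bounded \<Omega>" "\<Omega> \<in> sets borel" "(frame k \<inter> frontier \<Omega>) \<inter> \<Omega> = {}"
proof -
  show 1: "open \<Omega>" using open_components[OF open_Diff[OF open_triangle_open closed_frame] component] .
  show 2: "\<Omega> \<subseteq> open_triangle" and 3: "\<Omega> \<inter> frame k = {}" using in_components_subset[OF component] by auto
  show "connected \<Omega>" by (rule in_components_connected[OF component])
  show "\<Omega> \<noteq> {}" by (rule in_components_nonempty[OF component])
  show "bounded \<Omega>" using open_triangle_bounded 2 bounded_subset by blast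
  show "\<Omega> \<in> sets borel" using 1 by auto
  show "(frame k \<inter> frontier \<Omega>) \<inter> \<Omega> = {}" using 3 by auto
qed

lemma restrict_eigenspace:
  assumes "f \<in> eigenspace open_triangle {} \<mu>"
  shows "(\<lambda>z. if z \<in> \<Omega> then f z else 0) \<in> eigenspace \<Omega> (frame k \<inter> frontier \<Omega>) \<mu>"
proof -
  obtain a where a: "f = (\<lambda>z. if z \<in> open_triangle then lin a z else 0)" using eigenspace_lin[OF assms] by blast
  have "weak_pair \<Omega> (frame k \<inter> frontier \<Omega>) \<mu> (\<lambda>z. (lin a z, glin a z))"
    unfolding weak_pair_def
  proof (intro conjI allI impI)
    show "form_domain \<Omega> (frame k \<inter> frontier \<Omega>) (\<lambda>z. (lin a z, glin a z))"
      by (rule form_domain_core[OF subdomain_props(6,7)]) (use lin_C1 lin_frame in \<open>auto simp: core_function_def\<close>)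
    fix V assume "form_domain \<Omega> (frame k \<inter> frontier \<Omega>) V"
    from component_extension[OF open_triangle_open open_triangle_convex open_triangle_bounded closed_frame component this]
    have "(\<integral>z. twist \<mu> (lin a z, glin a z) \<bullet> (if z \<in> \<Omega> then V z else 0) \<partial>leb_on open_triangle) = 0"
      using lin_weak_pair unfolding weak_pair_def by blast
    moreover have "(\<integral>z. twist \<mu> (lin a z, glin a z) \<bullet> (if z \<in> \<Omega> then V z else 0) \<partial>leb_on open_triangle) 
       = (\<integral>z. (if z \<in> \<Omega> then twist \<mu> (lin a z, glin a z) \<bullet> V z else 0) \<partial>leb_on open_triangle)"
      by (intro Bochner_Integration.integral_cong) auto
    ultimately show "(\<integral>z. twist \<mu> (lin a z, glin a z) \<bullet> V z \<partial>leb_on \<Omega>) = 0"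
      by (simp add: integral_leb_on_indicator[OF subdomain_props(2,7) open_triangle_sets])
  qed
  then have "weak_pair \<Omega> (frame k \<inter> frontier \<Omega>) \<mu> (\<lambda>z. ((if z \<in> \<Omega> then f z else 0), glin a z))"
    by (rule weak_pair_cong[rotated]) (use subdomain_props(2) in \<open>auto simp: a\<close>)
  moreover have "continuous_on \<Omega> (\<lambda>z. if z \<in> \<Omega> then f z else 0)"
    by (rule continuous_on_eq[OF continuous_on_subset[OF C1_continuous[OF lin_C1[of a]]]]) (use subdomain_props(2) in \<open>auto simp: a\<close>)
  ultimately show ?thesis unfolding eigenspace_def weak_iff[OF subdomain_props(6,7)] by auto
qed

lemma nonzero_on_subdomain: "\<exists>z\<in>\<Omega>. U z \<noteq> 0"
proof (rule ccontr)
  assume "\<not> (\<exists>z\<in>\<Omega>. U z \<noteq> 0)"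
  then have "U = 0"
    by (intro unique_continuation[OF open_triangle_open open_triangle_bounded _ convex_connected[OF open_triangle_convex] U(1) subdomain_props(1,5,2)]) auto
  then show False using U(2) by simp
qed

lemma nodal_domain_in_subdomain: "\<exists>j\<in>components (open_triangle - {z. U z = 0}). j \<subseteq> \<Omega>"
proof -
  obtain z where z: "z \<in> \<Omega>" "U z \<noteq> 0" using nonzero_on_subdomain by blast
  have "z \<in> open_triangle - {z. U z = 0}" using z subdomain_props(2) by auto
  then obtain j where j: "j \<in> components (open_triangle - {z. U z = 0})" "z \<in> j" using Union_components[of "open_triangle - {z. U z = 0}"] by blast
  obtain a where a: "U = (\<lambda>z. if z \<in> open_triangle then lin a z else 0)" using eigenspace_lin[OF U(1)] by blast
  have "U w = 0" if "w \<in> frame k" for w unfolding a using lin_frame[OF that] by simp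
  then have "j \<subseteq> open_triangle - frame k" using in_components_subset[OF j(1)] by blast
  then have "j \<subseteq> \<Omega>" using components_maximal[OF component in_components_connected[OF j(1)]] z(1) j(2) by blast
  then show ?thesis using j(1) by blast
qed

end

context
  fixes \<Omega> assumes component: "\<Omega> \<in> components (open_triangle - frame k)"
begin

lemmas subdomain_facts = subdomain_props[OF component] and subdomain_restrict = restrict_eigenspace[OF component]

theorem subdomain_eigenfunction:
  assumes e: "e \<in> eigenspace \<Omega> (frame k \<inter> frontier \<Omega>) \<mu>"
  shows "\<exists>c. e = (\<lambda>z. c * (if z \<in> \<Omega> then U z else 0))"
proof -
  obtain a where a: "U = (\<lambda>z. if z \<in> open_triangle then lin a z else 0)" using eigenspace_lin[OF U(1)] by blast
  define \<Phi> where "\<Phi> = lin a"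
  define g\<Phi> where "g\<Phi> = glin a"
  define Z where "Z = {z. \<Phi> z = 0}"
  define J where "J = components (open_triangle - Z)"
  have cPhi: "continuous_on UNIV \<Phi>" unfolding \<Phi>_def by (rule C1_continuous[OF lin_C1])
  have cZ: "closed Z" unfolding Z_def by (intro closed_Collect_eq cPhi continuous_intros)
  have TZ: "open_triangle - {z. U z = 0} = open_triangle - Z" by (auto simp: a Z_def \<Phi>_def)
  have UPhi: "U z = \<Phi> z" if "z \<in> open_triangle" for z using that by (simp add: a \<Phi>_def)
  have cardJ: "card J = card (modes_below \<mu>) + 1" using count unfolding nodal_count_def TZ J_def .
  then have finJ: "finite J" by (metis add_eq_0_iff_both_eq_0 card.infinite zero_neq_one)
  have Jo: "open j" "j \<subseteq> open_triangle" "j \<noteq> {}" "\<And>z. z \<in> j \<Longrightarrow> \<Phi> z \<noteq> 0" if "j \<in> J" for j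
    using that open_components[OF open_Diff[OF open_triangle_open cZ]] in_components_subset[of j "open_triangle - Z"] in_components_nonempty[of j "open_triangle - Z"]
    unfolding J_def Z_def by blast+
  have Jdis: "j = j'" if "j \<in> J" "j' \<in> J" "z \<in> j" "z \<in> j'" for j j' z
    using components_eq[of j "open_triangle - Z" j'] that unfolding J_def by blast
  define P where "P = (\<lambda>z. (\<Phi> z, g\<Phi> z))"
  have weakP: "weak_pair open_triangle {} \<mu> P" unfolding P_def \<Phi>_def g\<Phi>_def by (rule lin_weak_pair)
  define uj where "uj j z = (if z \<in> j then P z else 0)" for j z
  have FDuj: "form_domain open_triangle Z (uj j)" if "j \<in> J" for j
    unfolding uj_def[abs_def] P_def Z_def
    by (rule component_extension_core[OF open_triangle_open open_triangle_convex open_triangle_bounded cZ])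
       (use that lin_C1 in \<open>auto simp: J_def Z_def \<Phi>_def g\<Phi>_def\<close>)
  obtain ge where we: "weak_pair \<Omega> (frame k \<inter> frontier \<Omega>) \<mu> (\<lambda>z. (e z, ge z))"
    using e unfolding eigenspace_def weak_iff[OF subdomain_facts(6,7)] by blast
  have ce: "continuous_on \<Omega> e" and eoff: "\<And>z. z \<notin> \<Omega> \<Longrightarrow> e z = 0" using e by (auto simp: eigenspace_def)
  define Pe where "Pe z = (e z, ge z)" for z
  have FDe: "form_domain \<Omega> (frame k \<inter> frontier \<Omega>) Pe" using we by (simp add: weak_pair_def Pe_def[abs_def])
  define f where "f i = (case i of None \<Rightarrow> (\<lambda>z. if z \<in> \<Omega> then Pe z else 0) | Some j \<Rightarrow> uj j)" for i
  define I where "I = insert None (Some ` J)"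
  have finI: "finite I" using finJ by (simp add: I_def)
  have cardI: "card I = card (modes_below \<mu>) + 2"
    using finJ cardJ card_image[of Some J] by (simp add: I_def card_insert_if image_iff)
  have FDf: "form_domain open_triangle {} (f i)" if "i \<in> I" for i
  proof (cases i)
    case None
    then show ?thesis using component_extension[OF open_triangle_open open_triangle_convex open_triangle_bounded closed_frame component FDe] by (simp add: f_def)
  next
    case (Some j)
    then have "j \<in> J" using that by (auto simp: I_def)
    from form_domain_mono[OF FDuj[OF this]] show ?thesis using Some by (simp add: f_def)
  qed
  have onOm: "(\<integral>z. (if z \<in> \<Omega> then h z else 0) \<partial>leb_on open_triangle) = integral\<^sup>L (leb_on \<Omega>) h" for h :: "real \<times> real \<Rightarrow> real"
    by (rule integral_leb_on_indicator[OF subdomain_facts(2,7) open_triangle_sets])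
  have form_e: "(\<integral>z. twist \<mu> (f None z) \<bullet> f i z \<partial>leb_on open_triangle) = 0" if "i \<in> I" for i
  proof -
    define V where "V = (case i of None \<Rightarrow> Pe | Some j \<Rightarrow> uj j)"
    have "form_domain \<Omega> (frame k \<inter> frontier \<Omega>) V"
    proof (cases i)
      case None then show ?thesis using FDe by (simp add: V_def)
    next
      case (Some j)
      then have j: "j \<in> J" using that by (auto simp: I_def)
      have "frame k \<subseteq> Z" using lin_frame by (auto simp: Z_def \<Phi>_def)
      then have "form_domain \<Omega> (frame k \<inter> frontier \<Omega>) (uj j)" 
        by (intro form_domain_mono[OF form_domain_subset[OF open_triangle_bounded subdomain_facts(2,7) open_triangle_sets FDuj[OF j]]]) blast
      then show ?thesis using Some by (simp add: V_def)
    qed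
    then have "(\<integral>z. twist \<mu> (Pe z) \<bullet> V z \<partial>leb_on \<Omega>) = 0" using we unfolding weak_pair_def Pe_def by blast
    moreover have "twist \<mu> (f None z) \<bullet> f i z = (if z \<in> \<Omega> then twist \<mu> (Pe z) \<bullet> V z else 0)" for z
      by (cases i) (simp_all add: f_def V_def)
    ultimately show ?thesis using onOm by simp
  qed
  have form_j: "(\<integral>z. twist \<mu> (uj j z) \<bullet> uj j' z \<partial>leb_on open_triangle) = 0" if j: "j \<in> J" "j' \<in> J" for j j'
  proof (cases "j = j'")
    case True
    have "(\<integral>z. twist \<mu> (P z) \<bullet> uj j z \<partial>leb_on open_triangle) = 0" using weakP form_domain_mono[OF FDuj[OF j(1)]] unfolding weak_pair_def by blast
    moreover have "twist \<mu> (uj j z) \<bullet> uj j z = twist \<mu> (P z) \<bullet> uj j z" for z by (simp add: uj_def)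
    ultimately show ?thesis using True by simp
  next
    case False
    have "twist \<mu> (uj j z) \<bullet> uj j' z = 0" for z
    proof -
      have "z \<notin> j \<or> z \<notin> j'" using Jdis[OF j] False by blast
      then show ?thesis by (auto simp: uj_def)
    qed
    then show ?thesis by simp
  qed
  have form: "(\<integral>z. twist \<mu> (f i z) \<bullet> f i' z \<partial>leb_on open_triangle) = 0" if i: "i \<in> I" "i' \<in> I" for i i'
  proof (cases i)
    case None then show ?thesis using form_e[OF i(2)] by simp
  next
    case (Some j)
    then have j: "j \<in> J" using i(1) by (auto simp: I_def)
    show ?thesis
    proof (cases i')
      case None
      then show ?thesis using form_e[OF i(1)] by (simp only: twist_sym[of \<mu> "f i _"])
    next
      case (Some j')
      then have "j' \<in> J" using i(2) by (auto simp: I_def)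
      then show ?thesis using form_j[OF j] \<open>i = Some j\<close> Some by (simp add: f_def)
    qed
  qed
  obtain z0 where z0: "z0 \<in> open_triangle - frame k" "z0 \<notin> \<Omega>" using frame_disconnects[OF subdomain_facts(4)] in_components_subset[OF component] by blast
  obtain \<Omega>2 where O2: "\<Omega>2 \<in> components (open_triangle - frame k)" "z0 \<in> \<Omega>2" using z0(1) Union_components[of "open_triangle - frame k"] by blast
  have dis2: "\<Omega>2 \<inter> \<Omega> = {}" using components_nonoverlap[OF O2(1) component] O2(2) z0(2) by blast
  obtain j0 where j0: "j0 \<in> J" "j0 \<subseteq> \<Omega>2"
    using nodal_domain_in_subdomain[OF O2(1)] unfolding TZ J_def by blast
  obtain j1 where j1: "j1 \<in> J" "j1 \<subseteq> \<Omega>" using nodal_domain_in_subdomain[OF component] unfolding TZ J_def by blast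
  define A where "A q i = (case q of None \<Rightarrow> (if i = Some j0 then 1 else 0) | Some p \<Rightarrow> (\<integral>z. mode p z * fst (f i z) \<partial>leb_on open_triangle))" for q i
  define EQ where "EQ = insert None (Some ` modes_below \<mu>)"
  have finEQ: "finite EQ" using finite_modes_below by (simp add: EQ_def)
  have "card EQ = card (modes_below \<mu>) + 1"
    using finite_modes_below card_image[of Some "modes_below \<mu>"] by (simp add: EQ_def card_insert_if image_iff)
  then have "card EQ < card I" using cardI by simp
  then obtain c where c: "\<exists>i\<in>I. c i \<noteq> 0" "\<And>q. q \<in> EQ \<Longrightarrow> (\<Sum>i\<in>I. A q i * c i) = 0"
    using homogeneous_system[OF finEQ finI, of A] by blast
  have cj0: "c (Some j0) = 0"
  proof -
    have "(\<Sum>i\<in>I. A None i * c i) = (\<Sum>i\<in>I. if i = Some j0 then c i else 0)" by (intro sum.cong) (auto simp: A_def)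
    also have "\<dots> = c (Some j0)" using finI j0(1) by (simp add: I_def)
    finally show ?thesis using c(2)[of None] by (simp add: EQ_def)
  qed
  define W where "W z = (\<Sum>i\<in>I. c i *\<^sub>R f i z)" for z
  have FDW: "form_domain open_triangle {} W" unfolding W_def[abs_def] by (intro form_domain_sum[OF open_triangle_bounded open_triangle_sets] form_domain_scaleR FDf)
  have twf: "L2 (leb_on open_triangle) (\<lambda>z. twist \<mu> (f i z))" if "i \<in> I" for i
    by (rule L2_bounded_linear[OF bounded_linear_twist form_domain_L2[OF FDf[OF that]]])
  have formW: "(\<integral>z. twist \<mu> (f i z) \<bullet> W z \<partial>leb_on open_triangle) = 0" if i: "i \<in> I" for i
  proof -
    have "(\<integral>z. twist \<mu> (f i z) \<bullet> W z \<partial>leb_on open_triangle) = (\<integral>z. (\<Sum>i'\<in>I. c i' * (twist \<mu> (f i z) \<bullet> f i' z)) \<partial>leb_on open_triangle)"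
      by (simp add: W_def inner_sum_right)
    also have "\<dots> = (\<Sum>i'\<in>I. \<integral>z. c i' * (twist \<mu> (f i z) \<bullet> f i' z) \<partial>leb_on open_triangle)"
      using L2_inner_integrable[OF twf[OF i] form_domain_L2[OF FDf]] by (intro Bochner_Integration.integral_sum) auto
    also have "\<dots> = 0" using form[OF i] by simp
    finally show ?thesis .
  qed
  have qW: "(\<integral>z. twist \<mu> (W z) \<bullet> W z \<partial>leb_on open_triangle) = 0"
  proof -
    have "(\<integral>z. twist \<mu> (W z) \<bullet> W z \<partial>leb_on open_triangle) = (\<integral>z. (\<Sum>i\<in>I. c i * (twist \<mu> (f i z) \<bullet> W z)) \<partial>leb_on open_triangle)"
      unfolding W_def[of "_"] twist_sum_scaleR ..
    also have "\<dots> = (\<Sum>i\<in>I. \<integral>z. c i * (twist \<mu> (f i z) \<bullet> W z) \<partial>leb_on open_triangle)"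
      using L2_inner_integrable[OF twf form_domain_L2[OF FDW]] by (intro Bochner_Integration.integral_sum) auto
    also have "\<dots> = 0" using formW by simp
    finally show ?thesis .
  qed
  have low: "(\<integral>z. mode p z * fst (W z) \<partial>leb_on open_triangle) = 0" if p: "p \<in> modes_below \<mu>" for p
  proof -
    have "(\<integral>z. mode p z * fst (W z) \<partial>leb_on open_triangle) = (\<integral>z. (\<Sum>i\<in>I. c i * (mode p z * fst (f i z))) \<partial>leb_on open_triangle)"
      by (simp add: W_def fst_sum sum_distrib_left mult.left_commute)
    also have "\<dots> = (\<Sum>i\<in>I. \<integral>z. c i * (mode p z * fst (f i z)) \<partial>leb_on open_triangle)"
      using L2_inner_integrable[OF mode_L2[of p] L2_fst[OF form_domain_L2[OF FDf]]] by (intro Bochner_Integration.integral_sum) auto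
    also have "\<dots> = (\<Sum>i\<in>I. A (Some p) i * c i)" by (simp add: A_def mult.commute)
    also have "\<dots> = 0" using c(2) p by (simp add: EQ_def)
    finally show ?thesis .
  qed
  obtain b where b: "AE z in leb_on open_triangle. fst (W z) = lin b z"
    using neumann_extremal[OF FDW qW low] unfolding lin_def by blast
  have val: "fst (W z) = c None * (if z \<in> \<Omega> then e z else 0) + c (Some j) * \<Phi> z" if j: "j \<in> J" "z \<in> j" for j z
  proof -
    have "fst (W z) = (\<Sum>i\<in>I. c i * fst (f i z))" by (simp add: W_def fst_sum)
    also have "\<dots> = c None * fst (f None z) + (\<Sum>i\<in>Some ` J. c i * fst (f i z))"
      unfolding I_def using finJ by (subst sum.insert) auto
    also have "(\<Sum>i\<in>Some ` J. c i * fst (f i z)) = (\<Sum>j'\<in>J. c (Some j') * fst (uj j' z))"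
      by (subst sum.reindex) (auto simp: f_def)
    also have "\<dots> = (\<Sum>j'\<in>J. if j' = j then c (Some j) * \<Phi> z else 0)"
    proof (rule sum.cong[OF refl])
      fix j' assume j': "j' \<in> J"
      show "c (Some j') * fst (uj j' z) = (if j' = j then c (Some j) * \<Phi> z else 0)"
      proof (cases "j' = j")
        case True
        then show ?thesis using j(2) by (simp add: uj_def P_def)
      next
        case False
        then have "z \<notin> j'" using Jdis[OF j' j(1) _ j(2)] by blast
        then show ?thesis using False by (simp add: uj_def)
      qed
    qed
    also have "\<dots> = c (Some j) * \<Phi> z" using finJ j(1) by simp
    also have "fst (f None z) = (if z \<in> \<Omega> then e z else 0)" by (simp add: f_def Pe_def)
    finally show ?thesis .
  qed
  have aeb: "AE z in lborel. z \<in> open_triangle \<longrightarrow> fst (W z) = lin b z" using b open_triangle_sets by (subst (asm) AE_restrict_space_iff) auto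
  have clin: "continuous_on UNIV (lin b)" by (rule C1_continuous[OF lin_C1])
  have "lin b z = 0" if z: "z \<in> j0" for z
  proof (rule AE_zero_continuous[OF Jo(1)[OF j0(1)] continuous_on_subset[OF clin] _ z])
    show "AE z in lborel. z \<in> j0 \<longrightarrow> lin b z = 0"
      using aeb
    proof eventually_elim
      case (elim z)
      show ?case
      proof
        assume z: "z \<in> j0"
        then have "z \<notin> \<Omega>" using dis2 j0(2) by blast
        then have "fst (W z) = 0" using val[OF j0(1) z] cj0 by simp
        then show "lin b z = 0" using elim z Jo(2)[OF j0(1)] by auto
      qed
    qed
  qed simp
  then have "(\<lambda>z. if z \<in> open_triangle then lin b z else 0) = 0"
    by (intro unique_continuation[OF open_triangle_open open_triangle_bounded _ convex_connected[OF open_triangle_convex] lin_eigenspace Jo(1,3,2)[OF j0(1)]]) auto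
  then have linb: "lin b z = 0" if "z \<in> open_triangle" for z using that by (metis (mono_tags, lifting) zero_fun_def)
  have W0: "AE z in lborel. z \<in> open_triangle \<longrightarrow> fst (W z) = 0" using aeb by eventually_elim (use linb in simp)
  have on_j: "c None * e z + c (Some j) * \<Phi> z = 0" if j: "j \<in> J" "j \<subseteq> \<Omega>" "z \<in> j" for j z
  proof (rule AE_zero_continuous[OF Jo(1)[OF j(1)] _ _ j(3)])
    show "continuous_on j (\<lambda>z. c None * e z + c (Some j) * \<Phi> z)"
      by (intro continuous_intros continuous_on_subset[OF ce j(2)] continuous_on_subset[OF cPhi]) simp
    show "AE z in lborel. z \<in> j \<longrightarrow> c None * e z + c (Some j) * \<Phi> z = 0"
      using W0
    proof eventually_elim
      case (elim z)
      show ?case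
      proof
        assume z: "z \<in> j"
        then have "z \<in> open_triangle" "z \<in> \<Omega>" using Jo(2)[OF j(1)] j(2) by blast+
        then show "c None * e z + c (Some j) * \<Phi> z = 0" using elim val[OF j(1) z] by simp
      qed
    qed
  qed
  have cN: "c None \<noteq> 0"
  proof
    assume 0: "c None = 0"
    have "c (Some j) = 0" if j: "j \<in> J" for j
    proof -
      obtain z where z: "z \<in> j" using Jo(3)[OF j] by blast
      have "c (Some j) * \<Phi> z = 0"
      proof (rule AE_zero_continuous[OF Jo(1)[OF j] _ _ z])
        show "continuous_on j (\<lambda>z. c (Some j) * \<Phi> z)"
          by (intro continuous_intros continuous_on_subset[OF cPhi]) simp
        show "AE z in lborel. z \<in> j \<longrightarrow> c (Some j) * \<Phi> z = 0"
          using W0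
        proof eventually_elim
          case (elim z)
          show ?case
          proof
            assume z: "z \<in> j"
            then have "z \<in> open_triangle" using Jo(2)[OF j] by blast
            then show "c (Some j) * \<Phi> z = 0" using elim val[OF j z] 0 by simp
          qed
        qed
      qed
      then show ?thesis using Jo(4)[OF j z] by simp
    qed
    then show False using c(1) 0 by (auto simp: I_def)
  qed
  define d where "d = - c (Some j1) / c None"
  have ej1: "e z = d * \<Phi> z" if "z \<in> j1" for z
  proof -
    have "c None * e z = - c (Some j1) * \<Phi> z" using on_j[OF j1 that] by simp
    then show ?thesis using cN by (simp add: d_def field_simps)
  qed
  define v where "v z = e z + (- d) * (if z \<in> \<Omega> then U z else 0)" for z
  have "v \<in> eigenspace \<Omega> (frame k \<inter> frontier \<Omega>) \<mu>"
    unfolding v_def[abs_def] by (rule eigenspace_add_scaled[OF subdomain_facts(6,7) e subdomain_restrict[OF U(1)]])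
  moreover have "v z = 0" if "z \<in> j1" for z
  proof -
    have "z \<in> \<Omega>" "z \<in> open_triangle" using that j1(2) subdomain_facts(2) by blast+
    then show ?thesis using ej1[OF that] UPhi by (simp add: v_def)
  qed
  ultimately have v0: "v = 0"
    using unique_continuation[OF subdomain_facts(1,6,8,4) _ Jo(1,3)[OF j1(1)] j1(2)] by blast
  have "e z = d * (if z \<in> \<Omega> then U z else 0)" for z
  proof -
    have "v z = 0" using v0 by simp
    then show ?thesis unfolding v_def by simp
  qed
  then show ?thesis by blast
qed

lemma subdomain_simple: "simple_eigenvalue \<Omega> (frame k \<inter> frontier \<Omega>) \<mu>"
proof (rule eigenspace_line_simple[OF subdomain_restrict[OF U(1)] _ subdomain_eigenfunction])
  show "(\<lambda>z. if z \<in> \<Omega> then U z else 0) \<noteq> 0"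
  proof
    assume 0: "(\<lambda>z. if z \<in> \<Omega> then U z else 0) = 0"
    obtain z where "z \<in> \<Omega>" "U z \<noteq> 0" using nonzero_on_subdomain[OF component] by blast
    then show False using fun_cong[OF 0, of z] by simp
  qed
qed

lemma neumann_line:
  assumes f: "f \<in> eigenspace open_triangle {} \<mu>"
  shows "\<exists>c. f = (\<lambda>z. c * U z)"
proof -
  obtain c where c: "(\<lambda>z. if z \<in> \<Omega> then f z else 0) = (\<lambda>z. c * (if z \<in> \<Omega> then U z else 0))"
    using subdomain_eigenfunction[OF subdomain_restrict[OF f]] by blast
  have "f z + (- c) * U z = 0" if "z \<in> \<Omega>" for z using fun_cong[OF c, of z] that by simp
  then have 0: "(\<lambda>z. f z + (- c) * U z) = 0"
    by (intro unique_continuation[OF open_triangle_open open_triangle_bounded _ convex_connected[OF open_triangle_convex] 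
          eigenspace_add_scaled[OF open_triangle_bounded open_triangle_sets f U(1)] subdomain_facts(1,5,2)]) auto
  have "f z = c * U z" for z using fun_cong[OF 0, of z] by simp
  then show ?thesis by blast
qed

end

lemma neumann_simple: "simple_eigenvalue open_triangle {} \<mu>"
proof -
  obtain z where "z \<in> open_triangle - frame k" using frame_disconnects[of "{}" k] by auto
  then obtain \<Omega> where "\<Omega> \<in> components (open_triangle - frame k)" using Union_components[of "open_triangle - frame k"] by blast
  then show ?thesis by (intro eigenspace_line_simple[OF U neumann_line])
qed

end

theorem lemma3p6:
  fixes k :: nat and lam0 :: real
  assumes "lam0 \<in> sigma_odd"
    and "neumann_courant_sharp (interior iso_triangle) (2 ^ k * lam0)"
  shows "(\<forall>\<Omega> \<in> frame_subdomains k. simple_eigenvalue \<Omega> (frame k \<inter> frontier \<Omega>) (2 ^ k * lam0)) \<and>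
         simple_eigenvalue (interior iso_triangle) {} (2 ^ k * lam0)"
proof -
  obtain m n :: nat where mn: "lam0 = real (m\<^sup>2 + n\<^sup>2)" "m mod 2 \<noteq> n mod 2" using assms(1) by (auto simp: sigma_odd_def)
  have "odd (m + n)" using mn(2) by presburger
  then have odd: "odd (m\<^sup>2 + n\<^sup>2)" by simp
  obtain lam u where u: "eigenvalue_sequence open_triangle {} lam" "u \<in> eigenspace open_triangle {} (2 ^ k * lam0)" "u \<noteq> 0"
    "nodal_count open_triangle u = card {j. lam j < 2 ^ k * lam0} + 1"
    using assms(2) unfolding neumann_courant_sharp_def interior_iso_triangle by blast
  interpret courant_sharp_eigenfunction k "m\<^sup>2 + n\<^sup>2" "2 ^ k * lam0" u
    using odd u mn(1) count_below[OF u(1)] by unfold_locales auto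
  show ?thesis
    unfolding frame_subdomains_def interior_iso_triangle using subdomain_simple neumann_simple by blast
qed

end
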